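(* Let $\mathcal{G}$ be a locally compact, second-countable Hausdorff étale groupoid with a continuous $2$-cocycle $\omega$, and let $(\mathcal{G},T,p)$ be a field of groupoids over a locally compact Hausdorff space $T$ with fibers $\mathcal{G}_t=p^{-1}(t)$, $t\in T$. If there exists a length function on $\mathcal{G}$ with respect to which $\mathcal{G}$ has the $\omega$-twisted rapid decay property, then $C_r^*(\mathcal{G},\omega)$ is a continuous field of $C^*$-algebras over $T$ with fibers $C_r^*(\mathcal{G}_t,\omega|_{\mathcal{G}_t})$, $t\in T$.
   Context: Groupoids. A topological groupoid $\mathcal{G}$ is étale if its source and range maps $s,r:\mathcal{G}\to\mathcal{G}^{(0)}$ are local homeomorphisms. $\mathcal{G}^{(2)}\subset\mathcal{G}\times\mathcal{G}$ is the set of composable pairs; for $u\in\mathcal{G}^{(0)}$, $\mathcal{G}_u=s^{-1}(\{u\})$ and $\mathcal{G}^u=r^{-1}(\{u\})$. The Haar system is given by counting measures. Field of groupoids. A field of groupoids over a topological space $T$ is a tuple $(\mathcal{G},T,p)$ with $\mathcal{G}$ a topological groupoid and $p:\mathcal{G}\to T$ a continuous open surjection with $p=p\circ s=p\circ r$. The fibers $\mathcal{G}_t=p^{-1}(t)$ are closed subgroupoids. Twisted algebras. A continuous $2$-cocycle is a continuous function $\omega:\mathcal{G}^{(2)}\to\mathbb{T}$ (complex numbers of modulus one) with $\omega(\gamma_1,\gamma_2)\omega(\gamma_1\gamma_2,\gamma_3)=\omega(\gamma_1,\gamma_2\gamma_3)\omega(\gamma_2,\gamma_3)$ whenever $(\gamma_1,\gamma_2),(\gamma_2,\gamma_3)\in\mathcal{G}^{(2)}$,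 normalized by $\omega(\gamma,s(\gamma))=\omega(r(\gamma),\gamma)=1$ for all $\gamma\in\mathcal{G}$. $C_c(\mathcal{G},\omega)$ is the space $C_c(\mathcal{G})$ of continuous compactly supported functions with the $*$-algebra structure $(f_1*f_2)(\gamma)=\sum_{\eta\in\mathcal{G}_{s(\gamma)}}\omega(\gamma\eta^{-1},\eta)f_1(\gamma\eta^{-1})f_2(\eta)$ and $f^*(\gamma)=\overline{\omega(\gamma,\gamma^{-1})}\,\overline{f(\gamma^{-1})}$. For $u\in\mathcal{G}^{(0)}$ it is represented on $\ell^2(\mathcal{G}_u)$ by $(\pi_u^\omega(f)\xi)(\gamma)=\sum_{\eta\in\mathcal{G}_u}\omega(\gamma\eta^{-1},\eta)f(\gamma\eta^{-1})\xi(\eta)$. $C_r^*(\mathcal{G},\omega)$ is the completion of $C_c(\mathcal{G},\omega)$ in the norm $\|f\|=\sup_{u\in\mathcal{G}^{(0)}}\|\pi_u^\omega(f)\|$. The same definitions apply to each $\mathcal{G}_t$ with the restricted cocycle. Rapid decay. A length function is a continuous function $l:\mathcal{G}\to[0,\infty)$ with $l(\gamma\gamma')\le l(\gamma)+l(\gamma')$ for $(\gamma,\gamma')\in\mathcal{G}^{(2)}$, $l(\gamma)=l(\gamma^{-1})$, and $l(u)=0$ for all units $u$. For $f\in C_c(\mathcal{G})$ and $q\ge 0$ put $\|f\|_{2,s,q}=\sup_{u\in\mathcal{G}^{(0)}}\big(\sum_{\gamma\in\mathcal{G}_u}|f(\gamma)|^2(1+l(\gamma))^{2q}\big)^{1/2}$,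 $\|f\|_{2,r,q}=\sup_{u\in\mathcal{G}^{(0)}}\big(\sum_{\gamma\in\mathcal{G}^u}|f(\gamma)|^2(1+l(\gamma))^{2q}\big)^{1/2}$, $\|f\|_{2,q}=\max(\|f\|_{2,s,q},\|f\|_{2,r,q})$. $\mathcal{G}$ has the $\omega$-twisted rapid decay property (with respect to $l$) if there are constants $C>0$, $q\ge0$ with $\|f\|_{C_r^*(\mathcal{G},\omega)}\le C\|f\|_{2,q}$ for all $f\in C_c(\mathcal{G})$. Continuous fields of $C^*$-algebras. A bundle of $C^*$-algebras over a locally compact Hausdorff space $T$ is a triple $(\mathcal{A},\{\mathcal{A}_t\}_{t\in T},\{\mathrm{ev}_t\}_{t\in T})$ of $C^*$-algebras $\mathcal{A},\mathcal{A}_t$ and surjective $*$-homomorphisms $\mathrm{ev}_t:\mathcal{A}\to\mathcal{A}_t$ such that (i) there is an action of $C_0(T)$ on $\mathcal{A}$ with $\mathrm{ev}_t(g\cdot a)=g(t)\,\mathrm{ev}_t(a)$ for $g\in C_0(T)$, $a\in\mathcal{A}$, $t\in T$; (ii) $\|a\|=\sup_{t\in T}\|\mathrm{ev}_t(a)\|$ for all $a\in\mathcal{A}$. It is a continuous field if moreover $t\mapsto\|\mathrm{ev}_t(a)\|$ is in $C_0(T)$ for each $a\in\mathcal{A}$. In the claim, $\mathcal{A}=C_r^*(\mathcal{G},\omega)$, $\mathcal{A}_t=C_r^*(\mathcal{G}_t,\omega|_{\mathcal{G}_t})$, $\mathrm{ev}_t$ is the continuous extension of the restriction map $C_c(\mathcal{G},\omega)\to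 C_c(\mathcal{G}_t,\omega|_{\mathcal{G}_t})$, and $C_0(T)$ acts by the continuous extension of $(g\cdot f)(\gamma)=g(p(\gamma))f(\gamma)$. *)

theory Defs
  imports "HOL-Analysis.Analysis"
begin

section \<open>Topological groupoids\<close>

text \<open>A groupoid is given by its arrows, the unit space being a subset of the arrows. The set of
  arrows is the underlying set of the topology; the operations are only meaningful on it, and
  \<^term>\<open>mul\<close> only on composable pairs.\<close>

record 'a groupoid =
  arr_top :: "'a topology"
  src :: "'a \<Rightarrow> 'a"
  rng :: "'a \<Rightarrow> 'a"
  mul :: "'a \<Rightarrow> 'a \<Rightarrow> 'a"
  ginv :: "'a \<Rightarrow> 'a"

abbreviation arrows :: "'a groupoid \<Rightarrow> 'a set" where
  "arrows G \<equiv> topspace (arr_top G)"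

definition units :: "'a groupoid \<Rightarrow> 'a set" where
  "units G = src G ` arrows G"

definition composable :: "'a groupoid \<Rightarrow> ('a \<times> 'a) set" where
  "composable G = {(x, y). x \<in> arrows G \<and> y \<in> arrows G \<and> src G x = rng G y}"

definition unit_top :: "'a groupoid \<Rightarrow> 'a topology" where
  "unit_top G = subtopology (arr_top G) (units G)"

definition composable_top :: "'a groupoid \<Rightarrow> ('a \<times> 'a) topology" where
  "composable_top G = subtopology (prod_topology (arr_top G) (arr_top G)) (composable G)"

definition src_fibre :: "'a groupoid \<Rightarrow> 'a \<Rightarrow> 'a set" where
  "src_fibre G u = {x \<in> arrows G. src G x = u}"

definition rng_fibre :: "'a groupoid \<Rightarrow> 'a \<Rightarrow> 'a set" where
  "rng_fibre G u = {x \<in> arrows G. rng G x = u}"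

locale topological_groupoid =
  fixes G :: "'a groupoid"
  assumes src_closed: "x \<in> arrows G \<Longrightarrow> src G x \<in> arrows G"
    and rng_closed: "x \<in> arrows G \<Longrightarrow> rng G x \<in> arrows G"
    and src_src: "x \<in> arrows G \<Longrightarrow> src G (src G x) = src G x"
    and rng_src: "x \<in> arrows G \<Longrightarrow> rng G (src G x) = src G x"
    and src_rng: "x \<in> arrows G \<Longrightarrow> src G (rng G x) = rng G x"
    and rng_rng: "x \<in> arrows G \<Longrightarrow> rng G (rng G x) = rng G x"
    and mul_closed: "(x, y) \<in> composable G \<Longrightarrow> mul G x y \<in> arrows G"
    and src_mul: "(x, y) \<in> composable G \<Longrightarrow> src G (mul G x y) = src G y"
    and rng_mul: "(x, y) \<in> composable G \<Longrightarrow> rng G (mul G x y) = rng G x"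
    and mul_assoc: "(x, y) \<in> composable G \<Longrightarrow> (y, z) \<in> composable G \<Longrightarrow>
      mul G (mul G x y) z = mul G x (mul G y z)"
    and mul_src: "x \<in> arrows G \<Longrightarrow> mul G x (src G x) = x"
    and rng_mul_self: "x \<in> arrows G \<Longrightarrow> mul G (rng G x) x = x"
    and ginv_closed: "x \<in> arrows G \<Longrightarrow> ginv G x \<in> arrows G"
    and src_ginv: "x \<in> arrows G \<Longrightarrow> src G (ginv G x) = rng G x"
    and rng_ginv: "x \<in> arrows G \<Longrightarrow> rng G (ginv G x) = src G x"
    and ginv_mul: "x \<in> arrows G \<Longrightarrow> mul G (ginv G x) x = src G x"
    and mul_ginv: "x \<in> arrows G \<Longrightarrow> mul G x (ginv G x) = rng G x"
    and continuous_src: "continuous_map (arr_top G) (unit_top G) (src G)"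
    and continuous_rng: "continuous_map (arr_top G) (unit_top G) (rng G)"
    and continuous_mul: "continuous_map (composable_top G) (arr_top G) (\<lambda>(x, y). mul G x y)"
    and continuous_ginv: "continuous_map (arr_top G) (arr_top G) (ginv G)"

definition local_homeomorphism :: "'a topology \<Rightarrow> 'b topology \<Rightarrow> ('a \<Rightarrow> 'b) \<Rightarrow> bool" where
  "local_homeomorphism X Y f \<longleftrightarrow>
    (\<forall>x\<in>topspace X. \<exists>U. openin X U \<and> x \<in> U \<and> openin Y (f ` U) \<and>
       homeomorphic_map (subtopology X U) (subtopology Y (f ` U)) f)"

locale etale_groupoid = topological_groupoid +
  assumes src_local_homeo: "local_homeomorphism (arr_top G) (unit_top G) (src G)"
    and rng_local_homeo: "local_homeomorphism (arr_top G) (unit_top G) (rng G)"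

definition field_of_groupoids :: "'a groupoid \<Rightarrow> 'b topology \<Rightarrow> ('a \<Rightarrow> 'b) \<Rightarrow> bool" where
  "field_of_groupoids G T p \<longleftrightarrow>
     topological_groupoid G \<and>
     continuous_map (arr_top G) T p \<and> open_map (arr_top G) T p \<and>
     p ` arrows G = topspace T \<and>
     (\<forall>x\<in>arrows G. p (src G x) = p x \<and> p (rng G x) = p x)"

definition fibre :: "'a groupoid \<Rightarrow> ('a \<Rightarrow> 'b) \<Rightarrow> 'b \<Rightarrow> 'a groupoid" where
  "fibre G p t = G\<lparr>arr_top := subtopology (arr_top G) {x \<in> arrows G. p x = t}\<rparr>"

definition continuous_cocycle :: "'a groupoid \<Rightarrow> ('a \<times> 'a \<Rightarrow> complex) \<Rightarrow> bool" where
  "continuous_cocycle G \<omega> \<longleftrightarrow>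
     continuous_map (composable_top G) (top_of_set (sphere 0 1)) \<omega> \<and>
     (\<forall>x y z. (x, y) \<in> composable G \<and> (y, z) \<in> composable G \<longrightarrow>
        \<omega> (x, y) * \<omega> (mul G x y, z) = \<omega> (x, mul G y z) * \<omega> (y, z)) \<and>
     (\<forall>x\<in>arrows G. \<omega> (x, src G x) = 1 \<and> \<omega> (rng G x, x) = 1)"


section \<open>Normed *-algebras, C*-algebras, completion\<close>

record 'x normed_star_alg =
  elems :: "'x set"
  zero_op :: "'x"
  plus_op :: "'x \<Rightarrow> 'x \<Rightarrow> 'x"
  scale_op :: "complex \<Rightarrow> 'x \<Rightarrow> 'x"
  times_op :: "'x \<Rightarrow> 'x \<Rightarrow> 'x"
  star_op :: "'x \<Rightarrow> 'x"
  norm_op :: "'x \<Rightarrow> real"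

definition dist_op :: "'x normed_star_alg \<Rightarrow> 'x \<Rightarrow> 'x \<Rightarrow> real" where
  "dist_op A a b = norm_op A (plus_op A a (scale_op A (- 1) b))"

definition cauchy_seqs :: "'x normed_star_alg \<Rightarrow> (nat \<Rightarrow> 'x) set" where
  "cauchy_seqs A = {\<sigma>. range \<sigma> \<subseteq> elems A \<and>
     (\<forall>e>0. \<exists>N. \<forall>m\<ge>N. \<forall>n\<ge>N. dist_op A (\<sigma> m) (\<sigma> n) < e)}"

text \<open>Algebras are not assumed to be unital, and the zero algebra is allowed.\<close>

locale cstar_algebra =
  fixes A :: "'x normed_star_alg"
  assumes zero_closed: "zero_op A \<in> elems A"
    and plus_closed: "a \<in> elems A \<Longrightarrow> b \<in> elems A \<Longrightarrow> plus_op A a b \<in> elems A"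
    and scale_closed: "a \<in> elems A \<Longrightarrow> scale_op A c a \<in> elems A"
    and times_closed: "a \<in> elems A \<Longrightarrow> b \<in> elems A \<Longrightarrow> times_op A a b \<in> elems A"
    and star_closed: "a \<in> elems A \<Longrightarrow> star_op A a \<in> elems A"
    and plus_assoc: "a \<in> elems A \<Longrightarrow> b \<in> elems A \<Longrightarrow> d \<in> elems A \<Longrightarrow>
      plus_op A (plus_op A a b) d = plus_op A a (plus_op A b d)"
    and plus_commute: "a \<in> elems A \<Longrightarrow> b \<in> elems A \<Longrightarrow> plus_op A a b = plus_op A b a"
    and plus_zero: "a \<in> elems A \<Longrightarrow> plus_op A a (zero_op A) = a"
    and plus_inverse: "a \<in> elems A \<Longrightarrow> plus_op A a (scale_op A (- 1) a) = zero_op A"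
    and scale_plus: "a \<in> elems A \<Longrightarrow> b \<in> elems A \<Longrightarrow>
      scale_op A c (plus_op A a b) = plus_op A (scale_op A c a) (scale_op A c b)"
    and plus_scale: "a \<in> elems A \<Longrightarrow>
      scale_op A (c + c') a = plus_op A (scale_op A c a) (scale_op A c' a)"
    and scale_scale: "a \<in> elems A \<Longrightarrow> scale_op A c (scale_op A c' a) = scale_op A (c * c') a"
    and scale_one: "a \<in> elems A \<Longrightarrow> scale_op A 1 a = a"
    and times_assoc: "a \<in> elems A \<Longrightarrow> b \<in> elems A \<Longrightarrow> d \<in> elems A \<Longrightarrow>
      times_op A (times_op A a b) d = times_op A a (times_op A b d)"
    and times_plus: "a \<in> elems A \<Longrightarrow> b \<in> elems A \<Longrightarrow> d \<in> elems A \<Longrightarrow>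
      times_op A a (plus_op A b d) = plus_op A (times_op A a b) (times_op A a d)"
    and plus_times: "a \<in> elems A \<Longrightarrow> b \<in> elems A \<Longrightarrow> d \<in> elems A \<Longrightarrow>
      times_op A (plus_op A a b) d = plus_op A (times_op A a d) (times_op A b d)"
    and scale_times: "a \<in> elems A \<Longrightarrow> b \<in> elems A \<Longrightarrow>
      times_op A (scale_op A c a) b = scale_op A c (times_op A a b)"
    and times_scale: "a \<in> elems A \<Longrightarrow> b \<in> elems A \<Longrightarrow>
      times_op A a (scale_op A c b) = scale_op A c (times_op A a b)"
    and star_star: "a \<in> elems A \<Longrightarrow> star_op A (star_op A a) = a"
    and star_plus: "a \<in> elems A \<Longrightarrow> b \<in> elems A \<Longrightarrow>
      star_op A (plus_op A a b) = plus_op A (star_op A a) (star_op A b)"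
    and star_scale: "a \<in> elems A \<Longrightarrow> star_op A (scale_op A c a) = scale_op A (cnj c) (star_op A a)"
    and star_times: "a \<in> elems A \<Longrightarrow> b \<in> elems A \<Longrightarrow>
      star_op A (times_op A a b) = times_op A (star_op A b) (star_op A a)"
    and norm_nonneg: "a \<in> elems A \<Longrightarrow> 0 \<le> norm_op A a"
    and norm_eq_zero: "a \<in> elems A \<Longrightarrow> norm_op A a = 0 \<longleftrightarrow> a = zero_op A"
    and norm_triangle: "a \<in> elems A \<Longrightarrow> b \<in> elems A \<Longrightarrow>
      norm_op A (plus_op A a b) \<le> norm_op A a + norm_op A b"
    and norm_scale: "a \<in> elems A \<Longrightarrow> norm_op A (scale_op A c a) = cmod c * norm_op A a"
    and norm_times: "a \<in> elems A \<Longrightarrow> b \<in> elems A \<Longrightarrow>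
      norm_op A (times_op A a b) \<le> norm_op A a * norm_op A b"
    and norm_star_times: "a \<in> elems A \<Longrightarrow> norm_op A (times_op A (star_op A a) a) = (norm_op A a)\<^sup>2"
    and complete: "\<sigma> \<in> cauchy_seqs A \<Longrightarrow> \<exists>a\<in>elems A. (\<lambda>n. dist_op A (\<sigma> n) a) \<longlonglongrightarrow> 0"

definition star_hom :: "'x normed_star_alg \<Rightarrow> 'y normed_star_alg \<Rightarrow> ('x \<Rightarrow> 'y) \<Rightarrow> bool" where
  "star_hom A B \<phi> \<longleftrightarrow>
     \<phi> \<in> elems A \<rightarrow> elems B \<and>
     (\<forall>a\<in>elems A. \<forall>b\<in>elems A. \<phi> (plus_op A a b) = plus_op B (\<phi> a) (\<phi> b)) \<and>
     (\<forall>c. \<forall>a\<in>elems A. \<phi> (scale_op A c a) = scale_op B c (\<phi> a)) \<and>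
     (\<forall>a\<in>elems A. \<forall>b\<in>elems A. \<phi> (times_op A a b) = times_op B (\<phi> a) (\<phi> b)) \<and>
     (\<forall>a\<in>elems A. \<phi> (star_op A a) = star_op B (\<phi> a))"

text \<open>The completion consists of the classes of Cauchy sequences modulo null sequences, with the
  operations induced from those on representatives.\<close>

definition cauchy_equiv :: "'x normed_star_alg \<Rightarrow> ((nat \<Rightarrow> 'x) \<times> (nat \<Rightarrow> 'x)) set" where
  "cauchy_equiv D = {(\<sigma>, \<tau>). \<sigma> \<in> cauchy_seqs D \<and> \<tau> \<in> cauchy_seqs D \<and>
     (\<lambda>n. dist_op D (\<sigma> n) (\<tau> n)) \<longlonglongrightarrow> 0}"

definition completion :: "'x normed_star_alg \<Rightarrow> (nat \<Rightarrow> 'x) set normed_star_alg" where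
  "completion D = \<lparr>
     elems = cauchy_seqs D // cauchy_equiv D,
     zero_op = cauchy_equiv D `` {\<lambda>_. zero_op D},
     plus_op = (\<lambda>X Y. \<Union>\<sigma>\<in>X. \<Union>\<tau>\<in>Y. cauchy_equiv D `` {\<lambda>n. plus_op D (\<sigma> n) (\<tau> n)}),
     scale_op = (\<lambda>c X. \<Union>\<sigma>\<in>X. cauchy_equiv D `` {\<lambda>n. scale_op D c (\<sigma> n)}),
     times_op = (\<lambda>X Y. \<Union>\<sigma>\<in>X. \<Union>\<tau>\<in>Y. cauchy_equiv D `` {\<lambda>n. times_op D (\<sigma> n) (\<tau> n)}),
     star_op = (\<lambda>X. \<Union>\<sigma>\<in>X. cauchy_equiv D `` {\<lambda>n. star_op D (\<sigma> n)}),
     norm_op = (\<lambda>X. THE r. \<forall>\<sigma>\<in>X. (\<lambda>n. norm_op D (\<sigma> n)) \<longlonglongrightarrow> r)\<rparr>"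

definition completion_embed :: "'x normed_star_alg \<Rightarrow> 'x \<Rightarrow> (nat \<Rightarrow> 'x) set" where
  "completion_embed D d = cauchy_equiv D `` {\<lambda>_. d}"

definition norm_continuous ::
  "'x normed_star_alg \<Rightarrow> 'y normed_star_alg \<Rightarrow> ('x \<Rightarrow> 'y) \<Rightarrow> bool" where
  "norm_continuous A B \<Phi> \<longleftrightarrow>
     (\<forall>a\<in>elems A. \<forall>e>0. \<exists>d>0. \<forall>b\<in>elems A. dist_op A b a < d \<longrightarrow> dist_op B (\<Phi> b) (\<Phi> a) < e)"

definition continuous_extension ::
  "'x normed_star_alg \<Rightarrow> 'y normed_star_alg \<Rightarrow> ('x \<Rightarrow> 'y) \<Rightarrow>
   ((nat \<Rightarrow> 'x) set \<Rightarrow> (nat \<Rightarrow> 'y) set) \<Rightarrow> bool" where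
  "continuous_extension D E \<phi> \<Phi> \<longleftrightarrow>
     \<Phi> \<in> elems (completion D) \<rightarrow> elems (completion E) \<and>
     norm_continuous (completion D) (completion E) \<Phi> \<and>
     (\<forall>d\<in>elems D. \<phi> d \<in> elems E \<and> \<Phi> (completion_embed D d) = completion_embed E (\<phi> d))"


section \<open>Twisted groupoid algebras\<close>

text \<open>Functions on a space are represented by functions on the ambient type that vanish off the
  space.\<close>

definition Cc :: "'a topology \<Rightarrow> ('a \<Rightarrow> complex) set" where
  "Cc X = {f. continuous_map X euclidean f \<and>
     compactin X (X closure_of {x \<in> topspace X. f x \<noteq> 0}) \<and>
     (\<forall>x. x \<notin> topspace X \<longrightarrow> f x = 0)}"

definition restrict0 :: "('a \<Rightarrow> complex) \<Rightarrow> 'a set \<Rightarrow> 'a \<Rightarrow> complex" where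
  "restrict0 f S = (\<lambda>x. if x \<in> S then f x else 0)"

text \<open>For \<^term>\<open>f\<close> in \<^term>\<open>Cc (arr_top G)\<close> and \<^term>\<open>G\<close> etale, all sums over source and range fibres
  below have only finitely many nonzero terms.\<close>

definition twisted_conv ::
  "'a groupoid \<Rightarrow> ('a \<times> 'a \<Rightarrow> complex) \<Rightarrow> ('a \<Rightarrow> complex) \<Rightarrow> ('a \<Rightarrow> complex) \<Rightarrow> 'a \<Rightarrow> complex" where
  "twisted_conv G \<omega> f1 f2 = restrict0
     (\<lambda>x. \<Sum>\<^sub>\<infinity>y\<in>src_fibre G (src G x).
        \<omega> (mul G x (ginv G y), y) * f1 (mul G x (ginv G y)) * f2 y) (arrows G)"

definition twisted_star ::
  "'a groupoid \<Rightarrow> ('a \<times> 'a \<Rightarrow> complex) \<Rightarrow> ('a \<Rightarrow> complex) \<Rightarrow> 'a \<Rightarrow> complex" where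
  "twisted_star G \<omega> f = restrict0 (\<lambda>x. cnj (\<omega> (x, ginv G x)) * cnj (f (ginv G x))) (arrows G)"

definition ell2 :: "'a set \<Rightarrow> ('a \<Rightarrow> complex) set" where
  "ell2 S = {\<xi>. (\<lambda>x. (cmod (\<xi> x))\<^sup>2) summable_on S \<and> (\<forall>x. x \<notin> S \<longrightarrow> \<xi> x = 0)}"

definition ell2_norm :: "'a set \<Rightarrow> ('a \<Rightarrow> complex) \<Rightarrow> real" where
  "ell2_norm S \<xi> = sqrt (\<Sum>\<^sub>\<infinity>x\<in>S. (cmod (\<xi> x))\<^sup>2)"

text \<open>Suprema of norms are taken in \<^typ>\<open>ennreal\<close>, so that the supremum over the empty set is 0
  and no boundedness has to be presupposed.\<close>

definition ell2_opnorm :: "'a set \<Rightarrow> (('a \<Rightarrow> complex) \<Rightarrow> 'a \<Rightarrow> complex) \<Rightarrow> ennreal" where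
  "ell2_opnorm S F = (SUP \<xi>\<in>{\<xi> \<in> ell2 S. ell2_norm S \<xi> \<le> 1}. ennreal (ell2_norm S (F \<xi>)))"

definition regular_rep ::
  "'a groupoid \<Rightarrow> ('a \<times> 'a \<Rightarrow> complex) \<Rightarrow> 'a \<Rightarrow> ('a \<Rightarrow> complex) \<Rightarrow> ('a \<Rightarrow> complex) \<Rightarrow> 'a \<Rightarrow> complex" where
  "regular_rep G \<omega> u f \<xi> = restrict0
     (\<lambda>x. \<Sum>\<^sub>\<infinity>y\<in>src_fibre G u.
        \<omega> (mul G x (ginv G y), y) * f (mul G x (ginv G y)) * \<xi> y) (src_fibre G u)"

definition reduced_norm ::
  "'a groupoid \<Rightarrow> ('a \<times> 'a \<Rightarrow> complex) \<Rightarrow> ('a \<Rightarrow> complex) \<Rightarrow> ennreal" where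
  "reduced_norm G \<omega> f = (SUP u\<in>units G. ell2_opnorm (src_fibre G u) (regular_rep G \<omega> u f))"

definition Cc_alg ::
  "'a groupoid \<Rightarrow> ('a \<times> 'a \<Rightarrow> complex) \<Rightarrow> ('a \<Rightarrow> complex) normed_star_alg" where
  "Cc_alg G \<omega> = \<lparr>
     elems = Cc (arr_top G),
     zero_op = (\<lambda>_. 0),
     plus_op = (\<lambda>f1 f2 x. f1 x + f2 x),
     scale_op = (\<lambda>c f x. c * f x),
     times_op = twisted_conv G \<omega>,
     star_op = twisted_star G \<omega>,
     norm_op = (\<lambda>f. enn2real (reduced_norm G \<omega> f))\<rparr>"

definition reduced_cstar ::
  "'a groupoid \<Rightarrow> ('a \<times> 'a \<Rightarrow> complex) \<Rightarrow> (nat \<Rightarrow> 'a \<Rightarrow> complex) set normed_star_alg" where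
  "reduced_cstar G \<omega> = completion (Cc_alg G \<omega>)"


section \<open>Rapid decay\<close>

definition length_function :: "'a groupoid \<Rightarrow> ('a \<Rightarrow> real) \<Rightarrow> bool" where
  "length_function G l \<longleftrightarrow>
     continuous_map (arr_top G) (top_of_set {0..}) l \<and>
     (\<forall>(x, y)\<in>composable G. l (mul G x y) \<le> l x + l y) \<and>
     (\<forall>x\<in>arrows G. l (ginv G x) = l x) \<and>
     (\<forall>u\<in>units G. l u = 0)"

definition norm_2s :: "'a groupoid \<Rightarrow> ('a \<Rightarrow> real) \<Rightarrow> real \<Rightarrow> ('a \<Rightarrow> complex) \<Rightarrow> ennreal" where
  "norm_2s G l q f = (SUP u\<in>units G.
     ennreal (sqrt (\<Sum>\<^sub>\<infinity>x\<in>src_fibre G u. (cmod (f x))\<^sup>2 * (1 + l x) powr (2 * q))))"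

definition norm_2r :: "'a groupoid \<Rightarrow> ('a \<Rightarrow> real) \<Rightarrow> real \<Rightarrow> ('a \<Rightarrow> complex) \<Rightarrow> ennreal" where
  "norm_2r G l q f = (SUP u\<in>units G.
     ennreal (sqrt (\<Sum>\<^sub>\<infinity>x\<in>rng_fibre G u. (cmod (f x))\<^sup>2 * (1 + l x) powr (2 * q))))"

definition norm_2 :: "'a groupoid \<Rightarrow> ('a \<Rightarrow> real) \<Rightarrow> real \<Rightarrow> ('a \<Rightarrow> complex) \<Rightarrow> ennreal" where
  "norm_2 G l q f = max (norm_2s G l q f) (norm_2r G l q f)"

definition rapid_decay ::
  "'a groupoid \<Rightarrow> ('a \<times> 'a \<Rightarrow> complex) \<Rightarrow> ('a \<Rightarrow> real) \<Rightarrow> bool" where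
  "rapid_decay G \<omega> l \<longleftrightarrow> (\<exists>C q :: real. C > 0 \<and> q \<ge> 0 \<and>
     (\<forall>f\<in>Cc (arr_top G). reduced_norm G \<omega> f \<le> ennreal C * norm_2 G l q f))"


section \<open>Continuous fields of C*-algebras\<close>

definition C0 :: "'b topology \<Rightarrow> ('b \<Rightarrow> 'v::real_normed_vector) set" where
  "C0 T = {g. continuous_map T euclidean g \<and>
     (\<forall>e>0. \<exists>K. compactin T K \<and> (\<forall>t\<in>topspace T - K. norm (g t) < e)) \<and>
     (\<forall>t. t \<notin> topspace T \<longrightarrow> g t = 0)}"

definition C0_action ::
  "'b topology \<Rightarrow> 'x normed_star_alg \<Rightarrow> (('b \<Rightarrow> complex) \<Rightarrow> 'x \<Rightarrow> 'x) \<Rightarrow> bool" where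
  "C0_action T A act \<longleftrightarrow>
     (\<forall>g\<in>C0 T. \<forall>a\<in>elems A. act g a \<in> elems A) \<and>
     (\<forall>g\<in>C0 T. \<forall>h\<in>C0 T. \<forall>a\<in>elems A.
        act (\<lambda>t. g t + h t) a = plus_op A (act g a) (act h a) \<and>
        act (\<lambda>t. g t * h t) a = act g (act h a)) \<and>
     (\<forall>c. \<forall>g\<in>C0 T. \<forall>a\<in>elems A.
        act (\<lambda>t. c * g t) a = scale_op A c (act g a) \<and>
        act g (scale_op A c a) = scale_op A c (act g a)) \<and>
     (\<forall>g\<in>C0 T. \<forall>a\<in>elems A. \<forall>b\<in>elems A.
        act g (plus_op A a b) = plus_op A (act g a) (act g b) \<and>
        act g (times_op A a b) = times_op A (act g a) b \<and>
        act g (times_op A a b) = times_op A a (act g b)) \<and>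
     (\<forall>g\<in>C0 T. \<forall>a\<in>elems A. star_op A (act g a) = act (\<lambda>t. cnj (g t)) (star_op A a))"

definition cstar_bundle ::
  "'b topology \<Rightarrow> 'x normed_star_alg \<Rightarrow> ('b \<Rightarrow> 'y normed_star_alg) \<Rightarrow> ('b \<Rightarrow> 'x \<Rightarrow> 'y) \<Rightarrow>
   (('b \<Rightarrow> complex) \<Rightarrow> 'x \<Rightarrow> 'x) \<Rightarrow> bool" where
  "cstar_bundle T A At ev act \<longleftrightarrow>
     locally_compact_space T \<and> Hausdorff_space T \<and>
     cstar_algebra A \<and> (\<forall>t\<in>topspace T. cstar_algebra (At t)) \<and>
     (\<forall>t\<in>topspace T. star_hom A (At t) (ev t) \<and> ev t ` elems A = elems (At t)) \<and>
     C0_action T A act \<and>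
     (\<forall>g\<in>C0 T. \<forall>a\<in>elems A. \<forall>t\<in>topspace T. ev t (act g a) = scale_op (At t) (g t) (ev t a)) \<and>
     (\<forall>a\<in>elems A. ennreal (norm_op A a) = (SUP t\<in>topspace T. ennreal (norm_op (At t) (ev t a))))"

definition continuous_field ::
  "'b topology \<Rightarrow> 'x normed_star_alg \<Rightarrow> ('b \<Rightarrow> 'y normed_star_alg) \<Rightarrow> ('b \<Rightarrow> 'x \<Rightarrow> 'y) \<Rightarrow>
   (('b \<Rightarrow> complex) \<Rightarrow> 'x \<Rightarrow> 'x) \<Rightarrow> bool" where
  "continuous_field T A At ev act \<longleftrightarrow>
     cstar_bundle T A At ev act \<and>
     (\<forall>a\<in>elems A. (\<lambda>t. if t \<in> topspace T then norm_op (At t) (ev t a) else 0) \<in> C0 T)"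

end

theory Submission
  imports Defs "HOL-Real_Asymp.Real_Asymp"
begin

text \<open>
The norm of \<open>C_c(G)\<close> is a supremum over the base: if \<open>fnorm t f\<close> denotes the supremum of the norms of
\<open>f\<close> in the regular representations at the units over \<open>t\<close>, then the reduced norm is the supremum of
the \<open>fnorm t f\<close>, and \<open>fnorm t f\<close> is the reduced norm of the restriction of \<open>f\<close> to the fibre groupoid
over \<open>t\<close>. So everything rests on the continuity of \<open>t \<mapsto> fnorm t f\<close>.

Lower semicontinuity is a matter of the topology. Finitely supported vectors on a source fibre extend
to functions in \<open>C_c(G)\<close> (\<open>extend_finite_support\<close>), so the norm at a unit \<open>u\<close> is the supremum of the
quotients \<open>\<parallel>f * h\<parallel>\<^sub>u / \<parallel>h\<parallel>\<^sub>u\<close> with \<open>h\<close> in \<open>C_c(G)\<close> and \<open>\<parallel>h\<parallel>\<^sub>u\<close> the \<open>\<ell>\<^sup>2\<close>-norm on the source fibre of \<open>u\<close>. Each such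
quotient depends continuously on \<open>u\<close>, because \<open>\<parallel>h\<parallel>\<^sub>u\<^sup>2 = (h\<^sup>* * h)(u)\<close> and convolutions are continuous;
the latter comes from the continuity of fibrewise sums along a local homeomorphism
(\<open>continuous_map_fibre_sum\<close>). Suprema over the fibres of the open map \<open>p\<close> stay lower semicontinuous.

Upper semicontinuity is where rapid decay enters (\<open>fnorm_upper_semicontinuous\<close>). Replace \<open>f\<close> by
\<open>h\<^sub>0 = f\<close>, \<open>h\<^sub>k\<^sub>+\<^sub>1 = h\<^sub>k\<^sup>* * h\<^sub>k\<close>. By the C*-identity the norm of \<open>h\<^sub>k\<close> in each fibre is the \<open>2\<^sup>k\<close>-th power of
that of \<open>f\<close>, while the length on the support grows at most by the factor \<open>2\<^sup>k\<close>. Rapid decay bounds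
the norm of \<open>h\<^sub>k\<close>, cut off to a small set of base points, by a factor of polynomial growth in \<open>2\<^sup>k\<close> times
its fibrewise \<open>\<ell>\<^sup>2\<close>-norms, and these are upper semicontinuous by compactness and at \<open>t\<^sub>0\<close> at most \<open>fnorm t\<^sub>0 h\<^sub>k\<close>. Taking
\<open>2\<^sup>k\<close>-th roots, this factor disappears in the limit.

By upper semicontinuity a compactly supported function on a fibre lifts to one on \<open>G\<close> with nearly the
same norm: cut off an arbitrary lift near \<open>t\<close>. Summing a geometric series of such lifts makes the
evaluation maps surjective (\<open>extend_surj\<close>) without the general theorem on ranges of
*-homomorphisms. The remaining axioms hold on \<open>C_c(G)\<close> and pass to the completion.
\<close>

section \<open>Completing a seminormed *-algebra\<close>

lemma null_seq_le:
  assumes "g \<longlonglongrightarrow> (0::real)" "\<And>n. 0 \<le> f n" "\<And>n. f n \<le> g n"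
  shows "f \<longlonglongrightarrow> 0"
  by (rule tendsto_sandwich[OF _ _ tendsto_const assms(1)]) (simp_all add: assms(2,3))

lemma cauchy_seqs_if_dist_le:
  assumes \<sigma>: "\<sigma> \<in> cauchy_seqs D" and f: "\<And>n. f n \<in> elems E" and B: "0 \<le> B"
    and nonneg: "\<And>m n. 0 \<le> dist_op D (\<sigma> m) (\<sigma> n)"
    and le: "\<And>m n. dist_op E (f m) (f n) \<le> B * dist_op D (\<sigma> m) (\<sigma> n)"
  shows "f \<in> cauchy_seqs E"
  unfolding cauchy_seqs_def
proof (safe)
  fix e :: real assume e: "e > 0"
  then have "0 < e / (B + 1)" using B by simp
  then obtain N where N: "\<forall>m\<ge>N. \<forall>n\<ge>N. dist_op D (\<sigma> m) (\<sigma> n) < e / (B + 1)"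
    using \<sigma> unfolding cauchy_seqs_def by blast
  have "dist_op E (f m) (f n) < e" if "m \<ge> N" "n \<ge> N" for m n
  proof -
    have "dist_op E (f m) (f n) \<le> (B + 1) * dist_op D (\<sigma> m) (\<sigma> n)"
      using le[of m n] nonneg[of m n] by (simp add: distrib_right)
    also have "\<dots> < e" using N that B e by (simp add: pos_less_divide_eq mult.commute)
    finally show ?thesis .
  qed
  then show "\<exists>N. \<forall>m\<ge>N. \<forall>n\<ge>N. dist_op E (f m) (f n) < e" by blast
qed (use f in auto)

text \<open>The norm is only required to be a seminorm, since the completion identifies sequences at distance
  zero anyway. In this way the same *-algebra can carry several norms, one for each set of regular
  representations.\<close>

locale pre_cstar_algebra =
  fixes D :: "'x normed_star_alg"
  assumes zero_closed: "zero_op D \<in> elems D"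
    and plus_closed: "a \<in> elems D \<Longrightarrow> b \<in> elems D \<Longrightarrow> plus_op D a b \<in> elems D"
    and scale_closed: "a \<in> elems D \<Longrightarrow> scale_op D c a \<in> elems D"
    and times_closed: "a \<in> elems D \<Longrightarrow> b \<in> elems D \<Longrightarrow> times_op D a b \<in> elems D"
    and star_closed: "a \<in> elems D \<Longrightarrow> star_op D a \<in> elems D"
    and plus_assoc: "a \<in> elems D \<Longrightarrow> b \<in> elems D \<Longrightarrow> d \<in> elems D \<Longrightarrow>
      plus_op D (plus_op D a b) d = plus_op D a (plus_op D b d)"
    and plus_commute: "a \<in> elems D \<Longrightarrow> b \<in> elems D \<Longrightarrow> plus_op D a b = plus_op D b a"
    and plus_zero: "a \<in> elems D \<Longrightarrow> plus_op D a (zero_op D) = a"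
    and plus_inverse: "a \<in> elems D \<Longrightarrow> plus_op D a (scale_op D (- 1) a) = zero_op D"
    and scale_plus: "a \<in> elems D \<Longrightarrow> b \<in> elems D \<Longrightarrow>
      scale_op D c (plus_op D a b) = plus_op D (scale_op D c a) (scale_op D c b)"
    and plus_scale: "a \<in> elems D \<Longrightarrow>
      scale_op D (c + c') a = plus_op D (scale_op D c a) (scale_op D c' a)"
    and scale_scale: "a \<in> elems D \<Longrightarrow> scale_op D c (scale_op D c' a) = scale_op D (c * c') a"
    and scale_one: "a \<in> elems D \<Longrightarrow> scale_op D 1 a = a"
    and times_assoc: "a \<in> elems D \<Longrightarrow> b \<in> elems D \<Longrightarrow> d \<in> elems D \<Longrightarrow>
      times_op D (times_op D a b) d = times_op D a (times_op D b d)"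
    and times_plus: "a \<in> elems D \<Longrightarrow> b \<in> elems D \<Longrightarrow> d \<in> elems D \<Longrightarrow>
      times_op D a (plus_op D b d) = plus_op D (times_op D a b) (times_op D a d)"
    and plus_times: "a \<in> elems D \<Longrightarrow> b \<in> elems D \<Longrightarrow> d \<in> elems D \<Longrightarrow>
      times_op D (plus_op D a b) d = plus_op D (times_op D a d) (times_op D b d)"
    and scale_times: "a \<in> elems D \<Longrightarrow> b \<in> elems D \<Longrightarrow>
      times_op D (scale_op D c a) b = scale_op D c (times_op D a b)"
    and times_scale: "a \<in> elems D \<Longrightarrow> b \<in> elems D \<Longrightarrow>
      times_op D a (scale_op D c b) = scale_op D c (times_op D a b)"
    and star_star: "a \<in> elems D \<Longrightarrow> star_op D (star_op D a) = a"
    and star_plus: "a \<in> elems D \<Longrightarrow> b \<in> elems D \<Longrightarrow>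
      star_op D (plus_op D a b) = plus_op D (star_op D a) (star_op D b)"
    and star_scale: "a \<in> elems D \<Longrightarrow> star_op D (scale_op D c a) = scale_op D (cnj c) (star_op D a)"
    and star_times: "a \<in> elems D \<Longrightarrow> b \<in> elems D \<Longrightarrow>
      star_op D (times_op D a b) = times_op D (star_op D b) (star_op D a)"
    and norm_nonneg: "a \<in> elems D \<Longrightarrow> 0 \<le> norm_op D a"
    and norm_triangle: "a \<in> elems D \<Longrightarrow> b \<in> elems D \<Longrightarrow>
      norm_op D (plus_op D a b) \<le> norm_op D a + norm_op D b"
    and norm_scale: "a \<in> elems D \<Longrightarrow> norm_op D (scale_op D c a) = cmod c * norm_op D a"
    and norm_times: "a \<in> elems D \<Longrightarrow> b \<in> elems D \<Longrightarrow>
      norm_op D (times_op D a b) \<le> norm_op D a * norm_op D b"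
    and norm_star_times: "a \<in> elems D \<Longrightarrow> norm_op D (times_op D (star_op D a) a) = (norm_op D a)\<^sup>2"
begin

lemmas op_closed = zero_closed plus_closed scale_closed times_closed star_closed

lemma plus_left_commute:
  "a \<in> elems D \<Longrightarrow> b \<in> elems D \<Longrightarrow> d \<in> elems D \<Longrightarrow>
    plus_op D a (plus_op D b d) = plus_op D b (plus_op D a d)"
  by (metis plus_assoc plus_commute)

lemmas plus_ac = plus_assoc plus_commute plus_left_commute

lemma zero_plus: "a \<in> elems D \<Longrightarrow> plus_op D (zero_op D) a = a"
  by (metis plus_commute plus_zero zero_closed)

lemma inverse_plus: "a \<in> elems D \<Longrightarrow> plus_op D (scale_op D (- 1) a) a = zero_op D"
  by (metis plus_commute plus_inverse scale_closed)

lemma scale_0: "a \<in> elems D \<Longrightarrow> scale_op D 0 a = zero_op D"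
  using plus_scale[of a 1 "- 1"] by (simp add: scale_one plus_inverse)

lemma norm_zero: "norm_op D (zero_op D) = 0"
  using norm_scale[of "zero_op D" 0] scale_0[of "zero_op D"] zero_closed by simp

lemma scale_zero: "scale_op D c (zero_op D) = zero_op D"
  using scale_scale[OF zero_closed, of c 0] scale_0[OF zero_closed] by simp

lemma norm_star: assumes "a \<in> elems D" shows "norm_op D (star_op D a) = norm_op D a"
proof -
  have le: "norm_op D x \<le> norm_op D (star_op D x)" if "x \<in> elems D" for x
  proof (cases "norm_op D x = 0")
    case False
    have "norm_op D x * norm_op D x \<le> norm_op D (star_op D x) * norm_op D x"
      using norm_star_times[OF that] norm_times[OF star_closed[OF that] that]
      by (simp add: power2_eq_square)
    then show ?thesis using False norm_nonneg[OF that] by simp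
  qed (use that norm_nonneg star_closed in auto)
  show ?thesis using le[OF assms] le[OF star_closed[OF assms]] star_star[OF assms] by simp
qed

lemma dist_nonneg: "a \<in> elems D \<Longrightarrow> b \<in> elems D \<Longrightarrow> 0 \<le> dist_op D a b"
  by (simp add: dist_op_def norm_nonneg op_closed)

lemma dist_self: "a \<in> elems D \<Longrightarrow> dist_op D a a = 0"
  by (simp add: dist_op_def plus_inverse norm_zero)

lemma dist_zero: "a \<in> elems D \<Longrightarrow> dist_op D a (zero_op D) = norm_op D a"
  by (simp add: dist_op_def scale_zero plus_zero)

lemma dist_commute: "a \<in> elems D \<Longrightarrow> b \<in> elems D \<Longrightarrow> dist_op D a b = dist_op D b a"
  using norm_scale[of "plus_op D b (scale_op D (- 1) a)" "- 1"]
  by (simp add: dist_op_def op_closed scale_plus scale_scale scale_one plus_ac)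

lemma plus_cancel_mid:
  assumes "a \<in> elems D" "b \<in> elems D" "d \<in> elems D"
  shows "plus_op D (plus_op D a (scale_op D (- 1) b)) (plus_op D b d) = plus_op D a d"
  using assms plus_assoc[of a "scale_op D (- 1) b" "plus_op D b d"]
    plus_assoc[of "scale_op D (- 1) b" b d]
  by (simp add: op_closed inverse_plus zero_plus)

lemma dist_triangle:
  assumes "a \<in> elems D" "b \<in> elems D" "d \<in> elems D"
  shows "dist_op D a d \<le> dist_op D a b + dist_op D b d"
  using norm_triangle[of "plus_op D a (scale_op D (- 1) b)" "plus_op D b (scale_op D (- 1) d)"]
    plus_cancel_mid[of a b "scale_op D (- 1) d"] assms
  by (simp add: dist_op_def op_closed)

lemma norm_diff_le_dist:
  assumes "a \<in> elems D" "b \<in> elems D"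
  shows "\<bar>norm_op D a - norm_op D b\<bar> \<le> dist_op D a b"
  using dist_triangle[of a b "zero_op D"] dist_triangle[of b a "zero_op D"] assms
    dist_commute[of a b]
  by (simp add: dist_zero zero_closed)

lemma dist_plus:
  assumes "a \<in> elems D" "b \<in> elems D" "a' \<in> elems D" "b' \<in> elems D"
  shows "dist_op D (plus_op D a b) (plus_op D a' b') \<le> dist_op D a a' + dist_op D b b'"
  using norm_triangle[of "plus_op D a (scale_op D (- 1) a')" "plus_op D b (scale_op D (- 1) b')"] assms
  by (simp add: dist_op_def op_closed scale_plus plus_ac)

lemma dist_scale:
  assumes "a \<in> elems D" "a' \<in> elems D"
  shows "dist_op D (scale_op D c a) (scale_op D c a') = cmod c * dist_op D a a'"
  using norm_scale[of "plus_op D a (scale_op D (- 1) a')" c] assms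
  by (simp add: dist_op_def op_closed scale_plus scale_scale)

lemma dist_star:
  assumes "a \<in> elems D" "a' \<in> elems D"
  shows "dist_op D (star_op D a) (star_op D a') = dist_op D a a'"
  using norm_star[of "plus_op D a (scale_op D (- 1) a')"] assms
  by (simp add: dist_op_def op_closed star_plus star_scale)

lemma dist_times:
  assumes "a \<in> elems D" "b \<in> elems D" "a' \<in> elems D" "b' \<in> elems D"
  shows "dist_op D (times_op D a b) (times_op D a' b')
    \<le> norm_op D a * dist_op D b b' + dist_op D a a' * norm_op D b'"
proof -
  have "dist_op D (times_op D a b) (times_op D a b') \<le> norm_op D a * dist_op D b b'"
    using norm_times[of a "plus_op D b (scale_op D (- 1) b')"] assms
    by (simp add: dist_op_def op_closed times_plus times_scale)
  moreover have "dist_op D (times_op D a b') (times_op D a' b') \<le> dist_op D a a' * norm_op D b'"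
    using norm_times[of "plus_op D a (scale_op D (- 1) a')" b'] assms
    by (simp add: dist_op_def op_closed plus_times scale_times)
  ultimately show ?thesis
    using dist_triangle[of "times_op D a b" "times_op D a b'" "times_op D a' b'"] assms
    by (simp add: op_closed)
qed

abbreviation cls :: "(nat \<Rightarrow> 'x) \<Rightarrow> (nat \<Rightarrow> 'x) set" where
  "cls \<sigma> \<equiv> cauchy_equiv D `` {\<sigma>}"

lemma cauchy_elems: "\<sigma> \<in> cauchy_seqs D \<Longrightarrow> \<sigma> n \<in> elems D"
  by (auto simp: cauchy_seqs_def)

lemma cauchyD:
  "\<sigma> \<in> cauchy_seqs D \<Longrightarrow> 0 < e \<Longrightarrow> \<exists>N. \<forall>m\<ge>N. \<forall>n\<ge>N. dist_op D (\<sigma> m) (\<sigma> n) < e"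
  by (simp add: cauchy_seqs_def)

lemma const_cauchy: "a \<in> elems D \<Longrightarrow> (\<lambda>_. a) \<in> cauchy_seqs D"
  by (auto simp: cauchy_seqs_def dist_self)

lemma equiv_cauchy: "equiv (cauchy_seqs D) (cauchy_equiv D)"
proof (rule equivI)
  show "cauchy_equiv D \<subseteq> cauchy_seqs D \<times> cauchy_seqs D" by (auto simp: cauchy_equiv_def)
  show "refl_on (cauchy_seqs D) (cauchy_equiv D)"
    by (auto simp: refl_on_def cauchy_equiv_def dist_self cauchy_elems)
  show "sym (cauchy_equiv D)"
    by (auto simp: sym_def cauchy_equiv_def dist_commute cauchy_elems)
  show "trans (cauchy_equiv D)"
  proof (rule transI)
    fix \<sigma> \<tau> \<rho> assume *: "(\<sigma>, \<tau>) \<in> cauchy_equiv D" "(\<tau>, \<rho>) \<in> cauchy_equiv D"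
    have lim: "(\<lambda>n. dist_op D (\<sigma> n) (\<tau> n) + dist_op D (\<tau> n) (\<rho> n)) \<longlonglongrightarrow> 0 + 0"
      using * by (intro tendsto_add) (auto simp: cauchy_equiv_def)
    have "(\<lambda>n. dist_op D (\<sigma> n) (\<rho> n)) \<longlonglongrightarrow> 0"
      by (rule null_seq_le[OF lim[simplified]])
        (use * in \<open>auto simp: cauchy_equiv_def cauchy_elems intro: dist_nonneg dist_triangle\<close>)
    then show "(\<sigma>, \<rho>) \<in> cauchy_equiv D" using * by (auto simp: cauchy_equiv_def)
  qed
qed

lemma cls_eqI:
  "\<sigma> \<in> cauchy_seqs D \<Longrightarrow> \<tau> \<in> cauchy_seqs D \<Longrightarrow> (\<lambda>n. dist_op D (\<sigma> n) (\<tau> n)) \<longlonglongrightarrow> 0 \<Longrightarrow>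
    cls \<sigma> = cls \<tau>"
  by (rule equiv_class_eq[OF equiv_cauchy]) (auto simp: cauchy_equiv_def)

lemma cls_closed: "\<sigma> \<in> cauchy_seqs D \<Longrightarrow> cls \<sigma> \<in> elems (completion D)"
  by (simp add: completion_def quotientI)

lemma cls_cases:
  assumes "X \<in> elems (completion D)"
  obtains \<sigma> where "\<sigma> \<in> cauchy_seqs D" "X = cls \<sigma>"
  using assms by (auto simp: completion_def elim: quotientE)

lemma norm_cauchy_convergent:
  assumes "\<sigma> \<in> cauchy_seqs D" shows "convergent (\<lambda>n. norm_op D (\<sigma> n))"
  unfolding Cauchy_convergent_iff[symmetric]
proof (rule CauchyI)
  fix e :: real assume "e > 0"
  then obtain N where "\<forall>m\<ge>N. \<forall>n\<ge>N. dist_op D (\<sigma> m) (\<sigma> n) < e"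
    using assms by (auto simp: cauchy_seqs_def)
  then have "norm (norm_op D (\<sigma> m) - norm_op D (\<sigma> n)) < e" if "m \<ge> N" "n \<ge> N" for m n
    using le_less_trans[OF norm_diff_le_dist[OF cauchy_elems[OF assms] cauchy_elems[OF assms]]] that
    by (simp only: real_norm_def)
  then show "\<exists>M. \<forall>m\<ge>M. \<forall>n\<ge>M. norm (norm_op D (\<sigma> m) - norm_op D (\<sigma> n)) < e" by blast
qed

lemma norm_cauchy_bounded:
  assumes "\<sigma> \<in> cauchy_seqs D"
  obtains B where "B > 0" "\<And>n. norm_op D (\<sigma> n) \<le> B"
proof -
  have "Bseq (\<lambda>n. norm_op D (\<sigma> n))" using norm_cauchy_convergent[OF assms] by (rule convergent_imp_Bseq)
  then obtain K where "K > 0" "\<And>n. norm (norm_op D (\<sigma> n)) \<le> K" by (rule BseqE) auto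
  then show ?thesis by (intro that[of K]) (auto simp: abs_le_iff)
qed

lemma cauchy_plus:
  assumes "\<sigma> \<in> cauchy_seqs D" "\<tau> \<in> cauchy_seqs D"
  shows "(\<lambda>n. plus_op D (\<sigma> n) (\<tau> n)) \<in> cauchy_seqs D"
  unfolding cauchy_seqs_def
proof (safe)
  fix e :: real assume e: "e > 0"
  obtain M where M: "\<forall>m\<ge>M. \<forall>n\<ge>M. dist_op D (\<sigma> m) (\<sigma> n) < e / 2"
    using cauchyD[OF assms(1), of "e / 2"] e by auto
  obtain N where N: "\<forall>m\<ge>N. \<forall>n\<ge>N. dist_op D (\<tau> m) (\<tau> n) < e / 2"
    using cauchyD[OF assms(2), of "e / 2"] e by auto
  show "\<exists>N. \<forall>m\<ge>N. \<forall>n\<ge>N. dist_op D (plus_op D (\<sigma> m) (\<tau> m)) (plus_op D (\<sigma> n) (\<tau> n)) < e"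
  proof (intro exI[of _ "max M N"] allI impI)
    fix m n assume "max M N \<le> m" "max M N \<le> n"
    then show "dist_op D (plus_op D (\<sigma> m) (\<tau> m)) (plus_op D (\<sigma> n) (\<tau> n)) < e"
      using M[rule_format, of m n] N[rule_format, of m n] assms
        dist_plus[of "\<sigma> m" "\<tau> m" "\<sigma> n" "\<tau> n"] by (simp add: cauchy_elems)
  qed
qed (use assms in \<open>auto simp: cauchy_elems op_closed\<close>)

lemma cauchy_scale:
  assumes "\<sigma> \<in> cauchy_seqs D" shows "(\<lambda>n. scale_op D c (\<sigma> n)) \<in> cauchy_seqs D"
  by (rule cauchy_seqs_if_dist_le[OF assms, of _ _ "cmod c"])
    (use assms in \<open>auto simp: cauchy_elems op_closed dist_nonneg dist_scale\<close>)

lemma cauchy_star: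
  assumes "\<sigma> \<in> cauchy_seqs D" shows "(\<lambda>n. star_op D (\<sigma> n)) \<in> cauchy_seqs D"
  by (rule cauchy_seqs_if_dist_le[OF assms, of _ _ 1])
    (use assms in \<open>auto simp: cauchy_elems op_closed dist_nonneg dist_star\<close>)

lemma cauchy_times:
  assumes "\<sigma> \<in> cauchy_seqs D" "\<tau> \<in> cauchy_seqs D"
  shows "(\<lambda>n. times_op D (\<sigma> n) (\<tau> n)) \<in> cauchy_seqs D"
  unfolding cauchy_seqs_def
proof (safe)
  obtain A B where A: "A > 0" "\<And>n. norm_op D (\<sigma> n) \<le> A" and B: "B > 0" "\<And>n. norm_op D (\<tau> n) \<le> B"
    using norm_cauchy_bounded assms by metis
  fix e :: real assume e: "e > 0"
  obtain M where M: "\<forall>m\<ge>M. \<forall>n\<ge>M. dist_op D (\<sigma> m) (\<sigma> n) < e / (2 * B)"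
    using cauchyD[OF assms(1), of "e / (2 * B)"] e B(1) by auto
  obtain N where N: "\<forall>m\<ge>N. \<forall>n\<ge>N. dist_op D (\<tau> m) (\<tau> n) < e / (2 * A)"
    using cauchyD[OF assms(2), of "e / (2 * A)"] e A(1) by auto
  show "\<exists>N. \<forall>m\<ge>N. \<forall>n\<ge>N. dist_op D (times_op D (\<sigma> m) (\<tau> m)) (times_op D (\<sigma> n) (\<tau> n)) < e"
  proof (intro exI[of _ "max M N"] allI impI)
    fix m n assume mn: "max M N \<le> m" "max M N \<le> n"
    have s: "dist_op D (\<sigma> m) (\<sigma> n) < e / (2 * B)" and t: "dist_op D (\<tau> m) (\<tau> n) < e / (2 * A)"
      using M N mn by auto
    have "norm_op D (\<sigma> m) * dist_op D (\<tau> m) (\<tau> n) \<le> A * dist_op D (\<tau> m) (\<tau> n)"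
      using A assms by (intro mult_right_mono) (auto simp: dist_nonneg cauchy_elems)
    also have "\<dots> < e / 2" using t A(1) by (simp add: field_simps)
    finally have 1: "norm_op D (\<sigma> m) * dist_op D (\<tau> m) (\<tau> n) < e / 2" .
    have "dist_op D (\<sigma> m) (\<sigma> n) * norm_op D (\<tau> n) \<le> dist_op D (\<sigma> m) (\<sigma> n) * B"
      using B assms by (intro mult_left_mono) (auto simp: dist_nonneg cauchy_elems)
    also have "\<dots> < e / 2" using s B(1) by (simp add: field_simps)
    finally show "dist_op D (times_op D (\<sigma> m) (\<tau> m)) (times_op D (\<sigma> n) (\<tau> n)) < e"
      using 1 dist_times[of "\<sigma> m" "\<tau> m" "\<sigma> n" "\<tau> n"] assms by (simp add: cauchy_elems)
  qed
qed (use assms in \<open>auto simp: cauchy_elems op_closed\<close>)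

lemma mem_cls:
  "(\<sigma>, \<tau>) \<in> cauchy_equiv D \<longleftrightarrow> \<sigma> \<in> cauchy_seqs D \<and> \<tau> \<in> cauchy_seqs D \<and> (\<lambda>n. dist_op D (\<sigma> n) (\<tau> n)) \<longlonglongrightarrow> 0"
  by (auto simp: cauchy_equiv_def)

lemma self_in_cls: "\<sigma> \<in> cauchy_seqs D \<Longrightarrow> \<sigma> \<in> cls \<sigma>"
  by (simp add: mem_cls dist_self cauchy_elems)

lemma UN_cls_const:
  assumes "\<sigma> \<in> cauchy_seqs D" "\<And>\<sigma>'. \<sigma>' \<in> cls \<sigma> \<Longrightarrow> f \<sigma>' = f \<sigma>"
  shows "(\<Union>\<sigma>'\<in>cls \<sigma>. f \<sigma>') = f \<sigma>"
  using self_in_cls[OF assms(1)] assms(2) by blast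

lemma UN_cls_const2:
  assumes "\<sigma> \<in> cauchy_seqs D" "\<tau> \<in> cauchy_seqs D"
    and "\<And>\<sigma>' \<tau>'. \<sigma>' \<in> cls \<sigma> \<Longrightarrow> \<tau>' \<in> cls \<tau> \<Longrightarrow> f \<sigma>' \<tau>' = f \<sigma> \<tau>"
  shows "(\<Union>\<sigma>'\<in>cls \<sigma>. \<Union>\<tau>'\<in>cls \<tau>. f \<sigma>' \<tau>') = f \<sigma> \<tau>"
  using self_in_cls[OF assms(1)] self_in_cls[OF assms(2)] assms(3) by blast

lemma completion_plus:
  assumes "\<sigma> \<in> cauchy_seqs D" "\<tau> \<in> cauchy_seqs D"
  shows "plus_op (completion D) (cls \<sigma>) (cls \<tau>) = cls (\<lambda>n. plus_op D (\<sigma> n) (\<tau> n))"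
proof -
  have eq: "cls (\<lambda>n. plus_op D (\<sigma>' n) (\<tau>' n)) = cls (\<lambda>n. plus_op D (\<sigma> n) (\<tau> n))"
    if "\<sigma>' \<in> cls \<sigma>" "\<tau>' \<in> cls \<tau>" for \<sigma>' \<tau>'
  proof (rule cls_eqI[symmetric])
    have lim: "(\<lambda>n. dist_op D (\<sigma> n) (\<sigma>' n) + dist_op D (\<tau> n) (\<tau>' n)) \<longlonglongrightarrow> 0 + 0"
      using that by (intro tendsto_add) (auto simp: mem_cls)
    show "(\<lambda>n. dist_op D (plus_op D (\<sigma> n) (\<tau> n)) (plus_op D (\<sigma>' n) (\<tau>' n))) \<longlonglongrightarrow> 0"
      by (rule null_seq_le[OF lim[simplified]])
        (use that in \<open>auto simp: mem_cls cauchy_elems op_closed intro: dist_nonneg dist_plus\<close>)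
  qed (use that in \<open>auto simp: mem_cls cauchy_plus\<close>)
  show ?thesis
    using UN_cls_const2[OF assms, where f="\<lambda>\<sigma> \<tau>. cls (\<lambda>n. plus_op D (\<sigma> n) (\<tau> n))"] eq
    by (simp add: completion_def)
qed

lemma completion_times:
  assumes "\<sigma> \<in> cauchy_seqs D" "\<tau> \<in> cauchy_seqs D"
  shows "times_op (completion D) (cls \<sigma>) (cls \<tau>) = cls (\<lambda>n. times_op D (\<sigma> n) (\<tau> n))"
proof -
  have eq: "cls (\<lambda>n. times_op D (\<sigma>' n) (\<tau>' n)) = cls (\<lambda>n. times_op D (\<sigma> n) (\<tau> n))"
    if \<sigma>': "\<sigma>' \<in> cls \<sigma>" and \<tau>': "\<tau>' \<in> cls \<tau>" for \<sigma>' \<tau>'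
  proof (rule cls_eqI[symmetric])
    obtain A where A: "A > 0" "\<And>n. norm_op D (\<sigma> n) \<le> A"
      using norm_cauchy_bounded assms(1) by metis
    obtain B where B: "B > 0" "\<And>n. norm_op D (\<tau>' n) \<le> B"
      using norm_cauchy_bounded[of \<tau>'] \<tau>' by (auto simp: mem_cls)
    have "(\<lambda>n. A * dist_op D (\<tau> n) (\<tau>' n) + dist_op D (\<sigma> n) (\<sigma>' n) * B) \<longlonglongrightarrow> A * 0 + 0 * B"
      using that by (intro tendsto_intros) (auto simp: mem_cls)
    then have lim: "(\<lambda>n. A * dist_op D (\<tau> n) (\<tau>' n) + dist_op D (\<sigma> n) (\<sigma>' n) * B) \<longlonglongrightarrow> 0" by simp
    show "(\<lambda>n. dist_op D (times_op D (\<sigma> n) (\<tau> n)) (times_op D (\<sigma>' n) (\<tau>' n))) \<longlonglongrightarrow> 0"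
    proof (rule null_seq_le[OF lim])
      fix n
      show "0 \<le> dist_op D (times_op D (\<sigma> n) (\<tau> n)) (times_op D (\<sigma>' n) (\<tau>' n))"
        using that by (auto simp: mem_cls cauchy_elems dist_nonneg op_closed)
      have "dist_op D (times_op D (\<sigma> n) (\<tau> n)) (times_op D (\<sigma>' n) (\<tau>' n))
        \<le> norm_op D (\<sigma> n) * dist_op D (\<tau> n) (\<tau>' n) + dist_op D (\<sigma> n) (\<sigma>' n) * norm_op D (\<tau>' n)"
        using that by (intro dist_times) (auto simp: mem_cls cauchy_elems)
      also have "\<dots> \<le> A * dist_op D (\<tau> n) (\<tau>' n) + dist_op D (\<sigma> n) (\<sigma>' n) * B"
        using that A B by (intro add_mono mult_mono) (auto simp: mem_cls cauchy_elems dist_nonneg norm_nonneg less_imp_le)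
      finally show "dist_op D (times_op D (\<sigma> n) (\<tau> n)) (times_op D (\<sigma>' n) (\<tau>' n))
        \<le> A * dist_op D (\<tau> n) (\<tau>' n) + dist_op D (\<sigma> n) (\<sigma>' n) * B" .
    qed
  qed (use that in \<open>auto simp: mem_cls cauchy_times\<close>)
  show ?thesis
    using UN_cls_const2[OF assms, where f="\<lambda>\<sigma> \<tau>. cls (\<lambda>n. times_op D (\<sigma> n) (\<tau> n))"] eq
    by (simp add: completion_def)
qed

lemma completion_scale:
  assumes "\<sigma> \<in> cauchy_seqs D"
  shows "scale_op (completion D) c (cls \<sigma>) = cls (\<lambda>n. scale_op D c (\<sigma> n))"
proof -
  have "(\<Union>\<sigma>'\<in>cls \<sigma>. cls (\<lambda>n. scale_op D c (\<sigma>' n))) = cls (\<lambda>n. scale_op D c (\<sigma> n))"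
  proof (rule UN_cls_const[OF assms])
    fix \<sigma>' assume that: "\<sigma>' \<in> cls \<sigma>"
    show "cls (\<lambda>n. scale_op D c (\<sigma>' n)) = cls (\<lambda>n. scale_op D c (\<sigma> n))"
    proof (rule cls_eqI[symmetric])
      have "(\<lambda>n. cmod c * dist_op D (\<sigma> n) (\<sigma>' n)) \<longlonglongrightarrow> cmod c * 0"
        using that by (intro tendsto_intros) (auto simp: mem_cls)
      then show "(\<lambda>n. dist_op D (scale_op D c (\<sigma> n)) (scale_op D c (\<sigma>' n))) \<longlonglongrightarrow> 0"
        using that by (simp add: mem_cls dist_scale cauchy_elems)
    qed (use that in \<open>auto simp: mem_cls cauchy_scale\<close>)
  qed
  then show ?thesis by (simp add: completion_def)
qed

lemma completion_star:
  assumes "\<sigma> \<in> cauchy_seqs D"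
  shows "star_op (completion D) (cls \<sigma>) = cls (\<lambda>n. star_op D (\<sigma> n))"
proof -
  have "(\<Union>\<sigma>'\<in>cls \<sigma>. cls (\<lambda>n. star_op D (\<sigma>' n))) = cls (\<lambda>n. star_op D (\<sigma> n))"
  proof (rule UN_cls_const[OF assms])
    fix \<sigma>' assume that: "\<sigma>' \<in> cls \<sigma>"
    show "cls (\<lambda>n. star_op D (\<sigma>' n)) = cls (\<lambda>n. star_op D (\<sigma> n))"
      by (rule cls_eqI[symmetric])
        (use that in \<open>auto simp: mem_cls cauchy_star dist_star cauchy_elems\<close>)
  qed
  then show ?thesis by (simp add: completion_def)
qed

lemma completion_zero: "zero_op (completion D) = cls (\<lambda>_. zero_op D)"
  by (simp add: completion_def)

text \<open>Two equivalent Cauchy sequences have norms with the same limit, so the definite description in the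
  norm of the completion denotes that limit.\<close>

lemma completion_norm:
  assumes "\<sigma> \<in> cauchy_seqs D"
  shows "(\<lambda>n. norm_op D (\<sigma> n)) \<longlonglongrightarrow> norm_op (completion D) (cls \<sigma>)"
proof -
  obtain r where r: "(\<lambda>n. norm_op D (\<sigma> n)) \<longlonglongrightarrow> r"
    using norm_cauchy_convergent[OF assms] by (auto simp: convergent_def)
  have lim: "(\<lambda>n. norm_op D (\<sigma>' n)) \<longlonglongrightarrow> r" if "\<sigma>' \<in> cls \<sigma>" for \<sigma>'
  proof -
    have "(\<lambda>n. dist_op D (\<sigma> n) (\<sigma>' n)) \<longlonglongrightarrow> 0" using that by (simp add: mem_cls)
    then have "(\<lambda>n. \<bar>norm_op D (\<sigma> n) - norm_op D (\<sigma>' n)\<bar>) \<longlonglongrightarrow> 0"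
      by (rule null_seq_le) (use that in \<open>auto simp: mem_cls cauchy_elems intro: norm_diff_le_dist\<close>)
    then have "(\<lambda>n. norm_op D (\<sigma> n) - norm_op D (\<sigma>' n)) \<longlonglongrightarrow> 0"
      by (simp add: tendsto_rabs_zero_iff)
    from tendsto_diff[OF r this] show ?thesis by simp
  qed
  have "norm_op (completion D) (cls \<sigma>) = (THE r. \<forall>\<sigma>'\<in>cls \<sigma>. (\<lambda>n. norm_op D (\<sigma>' n)) \<longlonglongrightarrow> r)"
    by (simp add: completion_def)
  also have "\<dots> = r"
    using lim self_in_cls[OF assms] r LIMSEQ_unique by (intro the_equality) blast+
  finally show ?thesis using r by simp
qed

lemma completion_dist:
  assumes "\<sigma> \<in> cauchy_seqs D" "\<tau> \<in> cauchy_seqs D"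
  shows "(\<lambda>n. dist_op D (\<sigma> n) (\<tau> n)) \<longlonglongrightarrow> dist_op (completion D) (cls \<sigma>) (cls \<tau>)"
  unfolding dist_op_def
  using completion_norm[OF cauchy_plus[OF assms(1) cauchy_scale[OF assms(2), of "- 1"]]]
  by (simp add: completion_scale completion_plus assms cauchy_scale)

lemma completion_dist_const:
  assumes "\<sigma> \<in> cauchy_seqs D" "\<And>m. m \<ge> N \<Longrightarrow> dist_op D (\<sigma> m) a \<le> e" "a \<in> elems D"
  shows "dist_op (completion D) (cls \<sigma>) (cls (\<lambda>_. a)) \<le> e"
  using completion_dist[OF assms(1) const_cauchy[OF assms(3)]] assms(2)
  by (intro Lim_bounded[where M=N]) auto

lemma completion_dense:
  assumes "X \<in> elems (completion D)" "0 < e"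
  shows "\<exists>a\<in>elems D. dist_op (completion D) X (cls (\<lambda>_. a)) \<le> e"
proof -
  obtain \<sigma> where \<sigma>: "\<sigma> \<in> cauchy_seqs D" "X = cls \<sigma>" using cls_cases[OF assms(1)] by blast
  obtain N where N: "\<And>m n. m\<ge>N \<Longrightarrow> n\<ge>N \<Longrightarrow> dist_op D (\<sigma> m) (\<sigma> n) < e"
    using cauchyD[OF \<sigma>(1) assms(2)] by blast
  have "dist_op (completion D) (cls \<sigma>) (cls (\<lambda>_. \<sigma> N)) \<le> e"
    by (rule completion_dist_const[of _ N]) (use \<sigma> N in \<open>auto simp: cauchy_elems less_imp_le\<close>)
  then show ?thesis using \<sigma> cauchy_elems by blast
qed

end

lemma (in pre_cstar_algebra) pre_cstar_completion: "pre_cstar_algebra (completion D)"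
proof -
  let ?C = "completion D"
  note c = completion_plus completion_times completion_scale completion_star completion_zero
    cauchy_plus cauchy_times cauchy_scale cauchy_star const_cauchy[OF zero_closed] cauchy_elems
    op_closed cls_closed
  note lims = completion_norm cauchy_plus cauchy_times cauchy_scale cauchy_star
  show ?thesis
  proof
    show "zero_op ?C \<in> elems ?C" by (simp add: c)
  next
    fix X assume "X \<in> elems ?C"
    then obtain \<sigma> where \<sigma>: "\<sigma> \<in> cauchy_seqs D" and X: "X = cls \<sigma>" by (rule cls_cases)
    fix k k'
    show "scale_op ?C k X \<in> elems ?C"
      "star_op ?C X \<in> elems ?C"
      using \<sigma> by (simp_all add: X c)
    show "plus_op ?C X (zero_op ?C) = X"
      "plus_op ?C X (scale_op ?C (- 1) X) = zero_op ?C"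
      "scale_op ?C (k + k') X = plus_op ?C (scale_op ?C k X) (scale_op ?C k' X)"
      "scale_op ?C k (scale_op ?C k' X) = scale_op ?C (k * k') X"
      "scale_op ?C 1 X = X"
      "star_op ?C (star_op ?C X) = X"
      "star_op ?C (scale_op ?C k X) = scale_op ?C (cnj k) (star_op ?C X)"
      using \<sigma> by (simp_all add: X c plus_zero plus_inverse plus_scale scale_scale scale_one star_star star_scale)
    show "0 \<le> norm_op ?C X"
      unfolding X by (rule LIMSEQ_le_const[OF completion_norm[OF \<sigma>]]) (use \<sigma> in \<open>auto simp: norm_nonneg c\<close>)
    show "norm_op ?C (scale_op ?C k X) = cmod k * norm_op ?C X"
      using LIMSEQ_unique[OF completion_norm[OF cauchy_scale[OF \<sigma>, of k]]]
        tendsto_mult_left[OF completion_norm[OF \<sigma>], of "cmod k"] \<sigma>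
      by (simp add: X c norm_scale)
    show "norm_op ?C (times_op ?C (star_op ?C X) X) = (norm_op ?C X)\<^sup>2"
      using LIMSEQ_unique[OF completion_norm[OF cauchy_times[OF cauchy_star[OF \<sigma>] \<sigma>]]]
        tendsto_power[OF completion_norm[OF \<sigma>], of 2] \<sigma>
      by (simp add: X c norm_star_times)
    fix Y assume "Y \<in> elems ?C"
    then obtain \<tau> where \<tau>: "\<tau> \<in> cauchy_seqs D" and Y: "Y = cls \<tau>" by (rule cls_cases)
    show "plus_op ?C X Y \<in> elems ?C"
      "times_op ?C X Y \<in> elems ?C"
      using \<sigma> \<tau> by (simp_all add: X Y c)
    show "scale_op ?C k (plus_op ?C X Y) = plus_op ?C (scale_op ?C k X) (scale_op ?C k Y)"
      "times_op ?C (scale_op ?C k X) Y = scale_op ?C k (times_op ?C X Y)"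
      "times_op ?C X (scale_op ?C k Y) = scale_op ?C k (times_op ?C X Y)"
      "star_op ?C (plus_op ?C X Y) = plus_op ?C (star_op ?C X) (star_op ?C Y)"
      "star_op ?C (times_op ?C X Y) = times_op ?C (star_op ?C Y) (star_op ?C X)"
      using \<sigma> \<tau> by (simp_all add: X Y c scale_plus scale_times times_scale star_plus star_times)
    have "(\<lambda>n. plus_op D (\<sigma> n) (\<tau> n)) = (\<lambda>n. plus_op D (\<tau> n) (\<sigma> n))"
      using \<sigma> \<tau> by (intro ext plus_commute cauchy_elems)
    then show "plus_op ?C X Y = plus_op ?C Y X"
      using \<sigma> \<tau> by (simp add: X Y c)
    show "norm_op ?C (plus_op ?C X Y) \<le> norm_op ?C X + norm_op ?C Y"
      using LIMSEQ_le[OF completion_norm[OF cauchy_plus[OF \<sigma> \<tau>]]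
          tendsto_add[OF completion_norm[OF \<sigma>] completion_norm[OF \<tau>]]] \<sigma> \<tau>
      by (simp add: X Y c norm_triangle)
    show "norm_op ?C (times_op ?C X Y) \<le> norm_op ?C X * norm_op ?C Y"
      using LIMSEQ_le[OF completion_norm[OF cauchy_times[OF \<sigma> \<tau>]]
          tendsto_mult[OF completion_norm[OF \<sigma>] completion_norm[OF \<tau>]]] \<sigma> \<tau>
      by (simp add: X Y c norm_times)
    fix Z assume "Z \<in> elems ?C"
    then obtain \<rho> where \<rho>: "\<rho> \<in> cauchy_seqs D" and Z: "Z = cls \<rho>" by (rule cls_cases)
    show "plus_op ?C (plus_op ?C X Y) Z = plus_op ?C X (plus_op ?C Y Z)"
      "times_op ?C (times_op ?C X Y) Z = times_op ?C X (times_op ?C Y Z)"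
      "times_op ?C X (plus_op ?C Y Z) = plus_op ?C (times_op ?C X Y) (times_op ?C X Z)"
      "times_op ?C (plus_op ?C X Y) Z = plus_op ?C (times_op ?C X Z) (times_op ?C Y Z)"
      using \<sigma> \<tau> \<rho> by (simp_all add: X Y Z c plus_assoc times_assoc times_plus plus_times)
  qed
qed

text \<open>Constant sequences are dense; choosing one within \<open>1 / (k + 1)\<close> of the \<open>k\<close>-th term of a Cauchy sequence
  of classes gives a Cauchy sequence of the original algebra, and its class is the limit.\<close>

lemma (in pre_cstar_algebra) completion_complete:
  assumes seq: "\<Xi> \<in> cauchy_seqs (completion D)"
  shows "\<exists>X\<in>elems (completion D). (\<lambda>n. dist_op (completion D) (\<Xi> n) X) \<longlonglongrightarrow> 0"
proof -
  interpret C: pre_cstar_algebra "completion D" by (rule pre_cstar_completion)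
  let ?d = "dist_op (completion D)"
  have el: "\<Xi> k \<in> elems (completion D)" for k using seq by (auto simp: cauchy_seqs_def)
  have "\<exists>a. a \<in> elems D \<and> ?d (\<Xi> k) (cls (\<lambda>_. a)) \<le> 1 / (Suc k)" for k
    using completion_dense[OF el, of "1 / (Suc k)"] by auto
  then obtain a where a: "\<And>k. a k \<in> elems D" "\<And>k. ?d (\<Xi> k) (cls (\<lambda>_. a k)) \<le> 1 / (Suc k)"
    by metis
  have emb: "cls (\<lambda>_. a k) \<in> elems (completion D)" for k
    by (intro cls_closed const_cauchy a)
  have demb: "?d (cls (\<lambda>_. a m)) (cls (\<lambda>_. a n)) = dist_op D (a m) (a n)" for m n
    using completion_dist[OF const_cauchy[OF a(1)[of m]] const_cauchy[OF a(1)[of n]]]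
    by (simp add: LIMSEQ_const_iff)
  have ca: "a \<in> cauchy_seqs D"
    unfolding cauchy_seqs_def
  proof (safe)
    fix e :: real assume e: "e > 0"
    obtain M where M: "\<forall>m\<ge>M. \<forall>n\<ge>M. ?d (\<Xi> m) (\<Xi> n) < e / 3"
      using seq e by (auto simp: cauchy_seqs_def dest!: spec[of _ "e / 3"])
    obtain K where K: "1 / (Suc K) < e / 3" using e
      using nat_approx_posE[of "e / 3"] by auto
    have "dist_op D (a m) (a n) < e" if "m \<ge> max M K" "n \<ge> max M K" for m n
    proof -
      have K': "1 / (Suc j) < e / 3" if "j \<ge> max M K" for j
        using that K by (intro le_less_trans[OF _ K] frac_le) auto
      have "dist_op D (a m) (a n) = ?d (cls (\<lambda>_. a m)) (cls (\<lambda>_. a n))" by (simp add: demb)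
      also have "\<dots> \<le> ?d (cls (\<lambda>_. a m)) (\<Xi> m) + ?d (\<Xi> m) (cls (\<lambda>_. a n))"
        by (intro C.dist_triangle emb el)
      also have "?d (\<Xi> m) (cls (\<lambda>_. a n)) \<le> ?d (\<Xi> m) (\<Xi> n) + ?d (\<Xi> n) (cls (\<lambda>_. a n))"
        by (intro C.dist_triangle emb el)
      also have "?d (cls (\<lambda>_. a m)) (\<Xi> m) = ?d (\<Xi> m) (cls (\<lambda>_. a m))" by (intro C.dist_commute emb el)
      finally have "dist_op D (a m) (a n) \<le>
        ?d (\<Xi> m) (cls (\<lambda>_. a m)) + (?d (\<Xi> m) (\<Xi> n) + ?d (\<Xi> n) (cls (\<lambda>_. a n)))" by simp
      moreover have "?d (\<Xi> m) (\<Xi> n) < e / 3" using M that by simp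
      ultimately show ?thesis using a(2)[of m] a(2)[of n] K'[OF that(1)] K'[OF that(2)] by linarith
    qed
    then show "\<exists>N. \<forall>m\<ge>N. \<forall>n\<ge>N. dist_op D (a m) (a n) < e" by blast
  qed (use a in auto)
  have "(\<lambda>n. ?d (\<Xi> n) (cls a)) \<longlonglongrightarrow> 0"
  proof (rule LIMSEQ_I)
    fix e :: real assume e: "e > 0"
    obtain M where M: "\<And>m n. m\<ge>M \<Longrightarrow> n\<ge>M \<Longrightarrow> dist_op D (a m) (a n) < e / 3"
      using cauchyD[OF ca, of "e / 3"] e by auto
    obtain K where K: "1 / (Suc K) < e / 3" using e
      using nat_approx_posE[of "e / 3"] by auto
    have "norm (?d (\<Xi> n) (cls a) - 0) < e" if n: "n \<ge> max M K" for n
    proof -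
      have "1 / (Suc n) < e / 3" using n K by (intro le_less_trans[OF _ K] frac_le) auto
      moreover have "?d (cls a) (cls (\<lambda>_. a n)) \<le> e / 3"
        by (rule completion_dist_const[of _ M]) (use ca a M n in \<open>auto simp: less_imp_le\<close>)
      moreover have "?d (\<Xi> n) (cls a) \<le> ?d (\<Xi> n) (cls (\<lambda>_. a n)) + ?d (cls (\<lambda>_. a n)) (cls a)"
        by (intro C.dist_triangle emb el cls_closed ca)
      moreover have "?d (cls (\<lambda>_. a n)) (cls a) = ?d (cls a) (cls (\<lambda>_. a n))"
        by (intro C.dist_commute emb el cls_closed ca)
      moreover have "0 \<le> ?d (\<Xi> n) (cls a)"
      proof -
        obtain \<sigma> where \<sigma>: "\<sigma> \<in> cauchy_seqs D" "\<Xi> n = cls \<sigma>" using cls_cases[OF el] by blast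
        show ?thesis unfolding \<sigma>(2)
          by (rule LIMSEQ_le_const[OF completion_dist[OF \<sigma>(1) ca]]) (use \<sigma> ca in \<open>auto simp: dist_nonneg cauchy_elems\<close>)
      qed
      ultimately show ?thesis using a(2)[of n] e by simp
    qed
    then show "\<exists>no. \<forall>n\<ge>no. norm (?d (\<Xi> n) (cls a) - 0) < e" by blast
  qed
  then show ?thesis using cls_closed[OF ca] by blast
qed

theorem (in pre_cstar_algebra) cstar_completion: "cstar_algebra (completion D)"
proof -
  let ?C = "completion D"
  interpret C: pre_cstar_algebra "completion D" by (rule pre_cstar_completion)
  have zero: "norm_op ?C X = 0 \<longleftrightarrow> X = zero_op ?C"
    if el: "X \<in> elems ?C" for X
  proof
    obtain \<sigma> where \<sigma>: "\<sigma> \<in> cauchy_seqs D" and X: "X = cls \<sigma>" by (rule cls_cases[OF el])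
    assume "norm_op ?C X = 0"
    then have "(\<lambda>n. norm_op D (\<sigma> n)) \<longlonglongrightarrow> 0" using completion_norm[OF \<sigma>] X by simp
    then show "X = zero_op ?C"
      unfolding X completion_zero
      by (intro cls_eqI) (use \<sigma> in \<open>auto simp: dist_zero cauchy_elems const_cauchy zero_closed\<close>)
  qed (simp add: C.norm_zero)
  show ?thesis
  proof
    show "\<exists>a\<in>elems ?C. (\<lambda>n. dist_op ?C (\<sigma> n) a) \<longlonglongrightarrow> 0"
      if "\<sigma> \<in> cauchy_seqs ?C" for \<sigma>
      using completion_complete[OF that] .
  qed (fact zero C.op_closed C.plus_assoc C.plus_zero C.plus_inverse C.scale_plus C.plus_scale
      C.scale_scale C.scale_one C.times_assoc C.times_plus C.plus_times C.scale_times C.times_scale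
      C.star_star C.star_plus C.star_scale C.star_times C.norm_nonneg C.norm_triangle C.norm_scale
      C.norm_times C.norm_star_times | rule C.plus_commute; assumption)+
qed

text \<open>This transports the axioms to the fibre algebras: restriction of functions is surjective and
  respects all operations, and it is isometric for the seminorm of the fibre.\<close>

lemma pre_cstar_image:
  assumes D: "pre_cstar_algebra D" and onto: "\<phi> ` elems D = elems E"
    and zero: "\<phi> (zero_op D) = zero_op E"
    and plus: "\<And>a b. a \<in> elems D \<Longrightarrow> b \<in> elems D \<Longrightarrow> plus_op E (\<phi> a) (\<phi> b) = \<phi> (plus_op D a b)"
    and scale: "\<And>c a. a \<in> elems D \<Longrightarrow> scale_op E c (\<phi> a) = \<phi> (scale_op D c a)"
    and times: "\<And>a b. a \<in> elems D \<Longrightarrow> b \<in> elems D \<Longrightarrow> times_op E (\<phi> a) (\<phi> b) = \<phi> (times_op D a b)"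
    and star: "\<And>a. a \<in> elems D \<Longrightarrow> star_op E (\<phi> a) = \<phi> (star_op D a)"
    and norm: "\<And>a. a \<in> elems D \<Longrightarrow> norm_op E (\<phi> a) = norm_op D a"
  shows "pre_cstar_algebra E"
proof -
  interpret D: pre_cstar_algebra D by (rule D)
  note hom = plus scale times star norm zero[symmetric] D.op_closed
  have cl: "\<phi> a \<in> elems E" if "a \<in> elems D" for a using that onto by blast
  show ?thesis
  proof
    show "zero_op E \<in> elems E" using cl[OF D.zero_closed] zero by simp
  next
    fix x assume "x \<in> elems E"
    then obtain a where a: "a \<in> elems D" and x: "x = \<phi> a" using onto by blast
    fix k k'
    show "scale_op E k x \<in> elems E" "star_op E x \<in> elems E"
      "plus_op E x (zero_op E) = x"
      "plus_op E x (scale_op E (- 1) x) = zero_op E"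
      "scale_op E (k + k') x = plus_op E (scale_op E k x) (scale_op E k' x)"
      "scale_op E k (scale_op E k' x) = scale_op E (k * k') x"
      "scale_op E 1 x = x"
      "star_op E (star_op E x) = x"
      "star_op E (scale_op E k x) = scale_op E (cnj k) (star_op E x)"
      "0 \<le> norm_op E x"
      "norm_op E (scale_op E k x) = cmod k * norm_op E x"
      "norm_op E (times_op E (star_op E x) x) = (norm_op E x)\<^sup>2"
      using a by (simp_all add: x hom cl D.plus_zero D.plus_inverse D.plus_scale D.scale_scale
          D.scale_one D.star_star D.star_scale D.norm_nonneg D.norm_scale D.norm_star_times)
    fix y assume "y \<in> elems E"
    then obtain b where b: "b \<in> elems D" and y: "y = \<phi> b" using onto by blast
    show "plus_op E x y \<in> elems E" "times_op E x y \<in> elems E"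
      "scale_op E k (plus_op E x y) = plus_op E (scale_op E k x) (scale_op E k y)"
      "times_op E (scale_op E k x) y = scale_op E k (times_op E x y)"
      "times_op E x (scale_op E k y) = scale_op E k (times_op E x y)"
      "star_op E (plus_op E x y) = plus_op E (star_op E x) (star_op E y)"
      "star_op E (times_op E x y) = times_op E (star_op E y) (star_op E x)"
      "norm_op E (plus_op E x y) \<le> norm_op E x + norm_op E y"
      "norm_op E (times_op E x y) \<le> norm_op E x * norm_op E y"
      using a b by (simp_all add: x y hom cl D.scale_plus D.scale_times D.times_scale D.star_plus
          D.star_times D.norm_triangle D.norm_times)
    show "plus_op E x y = plus_op E y x"
      using a b D.plus_commute[of a b] by (simp add: x y hom)
    fix z assume "z \<in> elems E"
    then obtain d where d: "d \<in> elems D" and z: "z = \<phi> d" using onto by blast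
    show "plus_op E (plus_op E x y) z = plus_op E x (plus_op E y z)"
      "times_op E (times_op E x y) z = times_op E x (times_op E y z)"
      "times_op E x (plus_op E y z) = plus_op E (times_op E x y) (times_op E x z)"
      "times_op E (plus_op E x y) z = plus_op E (times_op E x z) (times_op E y z)"
      using a b d by (simp_all add: x y z hom cl D.plus_assoc D.times_assoc D.times_plus D.plus_times)
  qed
qed

section \<open>Extending bounded linear maps to completions\<close>

definition extend_completion ::
  "'y normed_star_alg \<Rightarrow> ('x \<Rightarrow> 'y) \<Rightarrow> (nat \<Rightarrow> 'x) set \<Rightarrow> (nat \<Rightarrow> 'y) set" where
  "extend_completion E \<phi> X = (\<Union>\<sigma>\<in>X. cauchy_equiv E `` {\<lambda>n. \<phi> (\<sigma> n)})"

locale bounded_linear_map = D: pre_cstar_algebra D + E: pre_cstar_algebra E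
  for D :: "'x normed_star_alg" and E :: "'y normed_star_alg" +
  fixes \<phi> :: "'x \<Rightarrow> 'y" and B :: real
  assumes map_closed: "a \<in> elems D \<Longrightarrow> \<phi> a \<in> elems E"
    and map_plus: "a \<in> elems D \<Longrightarrow> b \<in> elems D \<Longrightarrow> \<phi> (plus_op D a b) = plus_op E (\<phi> a) (\<phi> b)"
    and map_scale: "a \<in> elems D \<Longrightarrow> \<phi> (scale_op D c a) = scale_op E c (\<phi> a)"
    and map_norm: "a \<in> elems D \<Longrightarrow> norm_op E (\<phi> a) \<le> B * norm_op D a"
    and bound_nonneg: "0 \<le> B"
begin

abbreviation extend :: "(nat \<Rightarrow> 'x) set \<Rightarrow> (nat \<Rightarrow> 'y) set" where
  "extend \<equiv> extend_completion E \<phi>"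

lemma map_dist:
  "a \<in> elems D \<Longrightarrow> b \<in> elems D \<Longrightarrow> dist_op E (\<phi> a) (\<phi> b) \<le> B * dist_op D a b"
  using map_norm[of "plus_op D a (scale_op D (- 1) b)"]
  by (simp add: dist_op_def map_plus map_scale D.op_closed)

lemma map_cauchy: "\<sigma> \<in> cauchy_seqs D \<Longrightarrow> (\<lambda>n. \<phi> (\<sigma> n)) \<in> cauchy_seqs E"
  by (rule cauchy_seqs_if_dist_le[of \<sigma> D _ _ B])
    (simp_all add: D.cauchy_elems map_closed bound_nonneg D.dist_nonneg map_dist)

lemma extend_cls:
  assumes "\<sigma> \<in> cauchy_seqs D"
  shows "extend (D.cls \<sigma>) = E.cls (\<lambda>n. \<phi> (\<sigma> n))"
  unfolding extend_completion_def
proof (rule D.UN_cls_const[OF assms])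
  fix \<sigma>' assume "\<sigma>' \<in> D.cls \<sigma>"
  then have \<sigma>': "\<sigma>' \<in> cauchy_seqs D" and lim: "(\<lambda>n. dist_op D (\<sigma> n) (\<sigma>' n)) \<longlonglongrightarrow> 0"
    by (auto simp: D.mem_cls)
  have "(\<lambda>n. B * dist_op D (\<sigma> n) (\<sigma>' n)) \<longlonglongrightarrow> 0" using tendsto_mult_left[OF lim, of B] by simp
  then have "(\<lambda>n. dist_op E (\<phi> (\<sigma> n)) (\<phi> (\<sigma>' n))) \<longlonglongrightarrow> 0"
    by (rule null_seq_le)
      (use assms \<sigma>' in \<open>simp_all add: E.dist_nonneg map_closed map_dist D.cauchy_elems\<close>)
  then show "E.cls (\<lambda>n. \<phi> (\<sigma>' n)) = E.cls (\<lambda>n. \<phi> (\<sigma> n))"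
    by (rule E.cls_eqI[OF map_cauchy[OF assms] map_cauchy[OF \<sigma>'], symmetric])
qed

lemma extend_closed: "X \<in> elems (completion D) \<Longrightarrow> extend X \<in> elems (completion E)"
  by (erule D.cls_cases) (simp add: extend_cls E.cls_closed map_cauchy)

lemma extend_plus:
  assumes "X \<in> elems (completion D)" "Y \<in> elems (completion D)"
  shows "extend (plus_op (completion D) X Y) = plus_op (completion E) (extend X) (extend Y)"
proof -
  obtain \<sigma> \<tau> where "\<sigma> \<in> cauchy_seqs D" "X = D.cls \<sigma>" "\<tau> \<in> cauchy_seqs D" "Y = D.cls \<tau>"
    using assms by (meson D.cls_cases)
  then show ?thesis
    by (simp add: extend_cls D.completion_plus E.completion_plus D.cauchy_plus map_cauchy map_plus D.cauchy_elems)
qed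

lemma extend_scale:
  assumes "X \<in> elems (completion D)"
  shows "extend (scale_op (completion D) c X) = scale_op (completion E) c (extend X)"
proof -
  obtain \<sigma> where "\<sigma> \<in> cauchy_seqs D" "X = D.cls \<sigma>"
    using assms by (meson D.cls_cases)
  then show ?thesis
    by (simp add: extend_cls D.completion_scale E.completion_scale D.cauchy_scale map_cauchy map_scale D.cauchy_elems)
qed

lemma extend_norm:
  assumes "X \<in> elems (completion D)"
  shows "norm_op (completion E) (extend X) \<le> B * norm_op (completion D) X"
proof -
  obtain \<sigma> where \<sigma>: "\<sigma> \<in> cauchy_seqs D" "X = D.cls \<sigma>"
    using assms by (meson D.cls_cases)
  have "norm_op (completion E) (E.cls (\<lambda>n. \<phi> (\<sigma> n))) \<le> B * norm_op (completion D) (D.cls \<sigma>)"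
    by (rule LIMSEQ_le[OF E.completion_norm[OF map_cauchy] tendsto_mult_left[OF D.completion_norm]])
      (use \<sigma> in \<open>auto intro!: map_norm simp: D.cauchy_elems\<close>)
  then show ?thesis by (simp add: \<sigma> extend_cls)
qed

lemma extend_dist:
  assumes "X \<in> elems (completion D)" "Y \<in> elems (completion D)"
  shows "dist_op (completion E) (extend X) (extend Y) \<le> B * dist_op (completion D) X Y"
proof -
  interpret CD: pre_cstar_algebra "completion D" by (rule D.pre_cstar_completion)
  show ?thesis
    using extend_norm[of "plus_op (completion D) X (scale_op (completion D) (- 1) Y)"] assms
    by (simp add: dist_op_def extend_plus extend_scale CD.op_closed)
qed

lemma continuous_extension_extend: "continuous_extension D E \<phi> extend"
  unfolding continuous_extension_def norm_continuous_def completion_embed_def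
proof (intro conjI ballI allI impI)
  show "extend \<in> elems (completion D) \<rightarrow> elems (completion E)" by (auto intro: extend_closed)
  fix X and e :: real assume X: "X \<in> elems (completion D)" and e: "e > 0"
  have "dist_op (completion E) (extend Y) (extend X) < e"
    if "Y \<in> elems (completion D)" "dist_op (completion D) Y X < e / (B + 1)" for Y
  proof -
    interpret CD: pre_cstar_algebra "completion D" by (rule D.pre_cstar_completion)
    have "dist_op (completion E) (extend Y) (extend X) \<le> B * dist_op (completion D) Y X"
      using extend_dist[OF that(1) X] .
    also have "\<dots> \<le> (B + 1) * dist_op (completion D) Y X"
      using CD.dist_nonneg[OF that(1) X] by (simp add: distrib_right)
    also have "\<dots> < e" using that(2) bound_nonneg e by (simp add: pos_less_divide_eq mult.commute)
    finally show ?thesis .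
  qed
  then show "\<exists>d>0. \<forall>Y\<in>elems (completion D). dist_op (completion D) Y X < d \<longrightarrow>
      dist_op (completion E) (extend Y) (extend X) < e"
    using e bound_nonneg by (intro exI[of _ "e / (B + 1)"]) auto
qed (auto simp: extend_cls map_closed D.const_cauchy)

lemma star_hom_extend:
  assumes times: "\<And>a b. a \<in> elems D \<Longrightarrow> b \<in> elems D \<Longrightarrow> \<phi> (times_op D a b) = times_op E (\<phi> a) (\<phi> b)"
    and star: "\<And>a. a \<in> elems D \<Longrightarrow> \<phi> (star_op D a) = star_op E (\<phi> a)"
  shows "star_hom (completion D) (completion E) extend"
  unfolding star_hom_def
proof (intro conjI ballI allI)
  fix X assume "X \<in> elems (completion D)"
  then obtain \<sigma> where \<sigma>: "\<sigma> \<in> cauchy_seqs D" "X = D.cls \<sigma>" by (meson D.cls_cases)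
  then show "extend (star_op (completion D) X) = star_op (completion E) (extend X)"
    by (simp add: extend_cls D.completion_star E.completion_star D.cauchy_star map_cauchy star D.cauchy_elems)
  fix Y assume "Y \<in> elems (completion D)"
  then obtain \<tau> where \<tau>: "\<tau> \<in> cauchy_seqs D" "Y = D.cls \<tau>" by (meson D.cls_cases)
  then show "extend (times_op (completion D) X Y) = times_op (completion E) (extend X) (extend Y)"
    using \<sigma> by (simp add: extend_cls D.completion_times E.completion_times D.cauchy_times map_cauchy times D.cauchy_elems)
qed (auto simp: extend_closed extend_plus extend_scale)

text \<open>Lifting the successive differences of a fast Cauchy sequence with almost no loss of norm gives a
  Cauchy sequence of lifts. This replaces the closedness of the range of a *-homomorphism, which would
  need functional calculus.\<close>

lemma extend_surj:
  assumes lift: "\<And>e \<epsilon>. e \<in> elems E \<Longrightarrow> 0 < \<epsilon> \<Longrightarrow>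
      \<exists>d\<in>elems D. \<phi> d = e \<and> norm_op D d \<le> norm_op E e + \<epsilon>"
  shows "extend ` elems (completion D) = elems (completion E)"
proof (intro equalityI subsetI)
  fix Y assume "Y \<in> elems (completion E)"
  then obtain \<tau> where \<tau>: "\<tau> \<in> cauchy_seqs E" and Y: "Y = E.cls \<tau>" by (meson E.cls_cases)
  have "\<exists>N. \<forall>m\<ge>N. \<forall>n\<ge>N. dist_op E (\<tau> m) (\<tau> n) < (1/2)^k" for k :: nat
    by (rule E.cauchyD[OF \<tau>]) simp
  then obtain N where N: "\<And>k m n. m \<ge> N k \<Longrightarrow> n \<ge> N k \<Longrightarrow> dist_op E (\<tau> m) (\<tau> n) < (1/2)^k"
    by metis
  \<comment> \<open>The partial sums dominate \<^term>\<open>N\<close>, and adding \<^term>\<open>k\<close> makes the indices tend to infinity.\<close>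
  define r where "r k = (\<Sum>i\<le>k. N i) + k" for k
  have rN: "r k \<ge> N k" for k
    unfolding r_def using member_le_sum[of k "{..k}" N] by simp
  have r_Suc: "r (Suc k) \<ge> r k" for k by (simp add: r_def)
  have r_ge: "r k \<ge> k" for k by (simp add: r_def)
  note \<tau>el = E.cauchy_elems[OF \<tau>]
  have step: "dist_op E (\<tau> (r (Suc k))) (\<tau> (r k)) < (1/2)^k" for k
    using rN[of k] r_Suc[of k] by (intro N) auto
  have "\<exists>d. \<forall>k. (d k \<in> elems D \<and> \<phi> (d k) = \<tau> (r k)) \<and> dist_op D (d k) (d (Suc k)) \<le> 2 * (1/2)^k"
  proof (rule dependent_nat_choice)
    show "\<exists>x. x \<in> elems D \<and> \<phi> x = \<tau> (r 0)"
      using lift[OF \<tau>el, of 1] by auto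
    fix x k assume x: "x \<in> elems D \<and> \<phi> x = \<tau> (r k)"
    define e where "e = plus_op E (\<tau> (r (Suc k))) (scale_op E (- 1) (\<tau> (r k)))"
    have e: "e \<in> elems E" by (simp add: e_def E.op_closed \<tau>el)
    have ne: "norm_op E e < (1/2)^k" using step[of k] by (simp add: e_def dist_op_def)
    obtain d where d: "d \<in> elems D" "\<phi> d = e" "norm_op D d \<le> norm_op E e + (1/2)^k"
      using lift[OF e, of "(1/2)^k"] by auto
    show "\<exists>y. (y \<in> elems D \<and> \<phi> y = \<tau> (r (Suc k))) \<and> dist_op D x y \<le> 2 * (1/2)^k"
    proof (intro exI[of _ "plus_op D d x"] conjI)
      show "plus_op D d x \<in> elems D" using d x by (simp add: D.op_closed)
      have "plus_op E e (\<tau> (r k)) = \<tau> (r (Suc k))"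
        unfolding e_def using E.plus_cancel_mid[of "\<tau> (r (Suc k))" "\<tau> (r k)" "zero_op E"]
        by (simp add: \<tau>el E.zero_closed E.plus_zero)
      then show "\<phi> (plus_op D d x) = \<tau> (r (Suc k))" using d x by (simp add: map_plus)
      have "dist_op D x (plus_op D d x) = dist_op D (plus_op D d x) x"
        using d x by (intro D.dist_commute) (auto simp: D.op_closed)
      also have "\<dots> = norm_op D d"
        using d x by (simp add: dist_op_def D.plus_assoc D.op_closed D.plus_inverse D.plus_zero)
      finally show "dist_op D x (plus_op D d x) \<le> 2 * (1/2)^k" using d ne by simp
    qed
  qed
  then obtain d where d: "\<And>k. d k \<in> elems D" "\<And>k. \<phi> (d k) = \<tau> (r k)"
    and dd: "\<And>k. dist_op D (d k) (d (Suc k)) \<le> 2 * (1/2)^k" by blast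
  have far: "dist_op D (d m) (d (m + j)) \<le> 4 * (1/2)^m - 4 * (1/2)^(m + j)" for m j
  proof (induction j)
    case 0 then show ?case by (simp add: D.dist_self d)
  next
    case (Suc j)
    have "dist_op D (d m) (d (m + Suc j)) \<le> dist_op D (d m) (d (m + j)) + dist_op D (d (m + j)) (d (m + Suc j))"
      by (intro D.dist_triangle d)
    then show ?case using Suc dd[of "m + j"] by simp
  qed
  have far': "dist_op D (d m) (d n) \<le> 4 * (1/2)^M" if "m \<ge> M" "n \<ge> M" for m n M
  proof -
    have *: "dist_op D (d m) (d n) \<le> 4 * (1/2)^M" if "M \<le> m" "m \<le> n" for m n
    proof -
      have "dist_op D (d m) (d n) \<le> 4 * (1/2)^m - 4 * (1/2)^n"
        using far[of m "n - m"] that by simp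
      also have "\<dots> \<le> 4 * (1/2)^m" by simp
      also have "\<dots> \<le> 4 * (1/2)^M" using that by (intro mult_left_mono power_decreasing) auto
      finally show ?thesis .
    qed
    show ?thesis using *[of m n] *[of n m] that D.dist_commute[OF d(1)[of m] d(1)[of n]] by (cases "m \<le> n") auto
  qed
  have cd: "d \<in> cauchy_seqs D"
    unfolding cauchy_seqs_def
  proof (safe)
    fix e :: real assume "e > 0"
    then obtain M where M: "(1/2::real)^M < e / 4"
      using real_arch_pow_inv[of "e / 4" "1/2"] by auto
    have "dist_op D (d m) (d n) < e" if "m \<ge> M" "n \<ge> M" for m n
      using far'[OF that] M by simp
    then show "\<exists>N. \<forall>m\<ge>N. \<forall>n\<ge>N. dist_op D (d m) (d n) < e" by blast
  qed (use d in auto)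
  have "extend (D.cls d) = E.cls (\<lambda>n. \<tau> (r n))" by (simp add: extend_cls cd d)
  also have "\<dots> = Y" unfolding Y
  proof (rule E.cls_eqI)
    show "(\<lambda>n. \<tau> (r n)) \<in> cauchy_seqs E" using map_cauchy[OF cd] d by simp
    show "(\<lambda>n. dist_op E (\<tau> (r n)) (\<tau> n)) \<longlonglongrightarrow> 0"
    proof (rule LIMSEQ_I)
      fix e :: real assume "e > 0"
      then obtain M where M: "\<forall>m\<ge>M. \<forall>n\<ge>M. dist_op E (\<tau> m) (\<tau> n) < e" using E.cauchyD[OF \<tau>] by blast
      have "norm (dist_op E (\<tau> (r n)) (\<tau> n) - 0) < e" if "n \<ge> M" for n
        using M that r_ge[of n] E.dist_nonneg[OF \<tau>el \<tau>el] by simp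
      then show "\<exists>M. \<forall>n\<ge>M. norm (dist_op E (\<tau> (r n)) (\<tau> n) - 0) < e" by blast
    qed
  qed (rule \<tau>)
  finally show "Y \<in> extend ` elems (completion D)" using D.cls_closed[OF cd] by blast
qed (auto intro: extend_closed)

end

section \<open>Compactly supported functions on locally compact Hausdorff spaces\<close>

lemma continuous_map_complex_mult:
  fixes f g :: "'a \<Rightarrow> complex"
  shows "continuous_map X euclidean f \<Longrightarrow> continuous_map X euclidean g \<Longrightarrow>
    continuous_map X euclidean (\<lambda>x. f x * g x)"
  by (simp add: continuous_map_atin tendsto_mult)

lemma continuous_map_cnj:
  "continuous_map X euclidean f \<Longrightarrow> continuous_map X euclidean (\<lambda>x. cnj (f x))"
  by (simp add: continuous_map_atin tendsto_cnj)

lemma continuous_map_complex_of_real: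
  "continuous_map X euclideanreal f \<Longrightarrow> continuous_map X euclidean (\<lambda>x. complex_of_real (f x))"
  by (simp add: continuous_map_atin tendsto_of_real)

lemma continuous_map_locally:
  assumes "\<And>x. x \<in> topspace X \<Longrightarrow> \<exists>M. openin X M \<and> x \<in> M \<and> continuous_map (subtopology X M) Y f"
  shows "continuous_map X Y f"
  by (rule pasting_lemma[where I="{M. openin X M \<and> continuous_map (subtopology X M) Y f}"
        and T="\<lambda>M. M" and f="\<lambda>_. f"]) (use assms in auto)

lemma continuous_map_realI:
  fixes F :: "'a \<Rightarrow> real"
  assumes "\<And>x e. x \<in> topspace X \<Longrightarrow> 0 < e \<Longrightarrow> \<exists>V. openin X V \<and> x \<in> V \<and> (\<forall>y\<in>V. \<bar>F y - F x\<bar> < e)"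
  shows "continuous_map X euclideanreal F"
  unfolding continuous_map_def
proof (intro conjI allI impI)
  fix S :: "real set" assume "openin euclideanreal S"
  then have S: "open S" by simp
  show "openin X {x \<in> topspace X. F x \<in> S}"
  proof (subst openin_subopen, safe)
    fix x assume x: "x \<in> topspace X" "F x \<in> S"
    then obtain e where e: "0 < e" "\<And>y. \<bar>y - F x\<bar> < e \<Longrightarrow> y \<in> S"
      using S by (auto simp: open_dist dist_real_def)
    obtain V where "openin X V" "x \<in> V" "\<forall>y\<in>V. \<bar>F y - F x\<bar> < e" using assms[OF x(1) e(1)] by blast
    then show "\<exists>V. openin X V \<and> x \<in> V \<and> V \<subseteq> {x \<in> topspace X. F x \<in> S}"
      using e(2) openin_subset[of X V] by (intro exI[of _ V]) auto
  qed
qed auto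

lemma Cc_iff:
  assumes "Hausdorff_space X"
  shows "f \<in> Cc X \<longleftrightarrow> continuous_map X euclidean f \<and> (\<exists>K. compactin X K \<and> (\<forall>x. x \<notin> K \<longrightarrow> f x = 0))"
proof
  assume f: "f \<in> Cc X"
  have "f x = 0" if "x \<notin> X closure_of {x \<in> topspace X. f x \<noteq> 0}" for x
    using f that closure_of_subset[of "{x \<in> topspace X. f x \<noteq> 0}" X] by (auto simp: Cc_def)
  then show "continuous_map X euclidean f \<and> (\<exists>K. compactin X K \<and> (\<forall>x. x \<notin> K \<longrightarrow> f x = 0))"
    using f by (auto simp: Cc_def)
next
  assume "continuous_map X euclidean f \<and> (\<exists>K. compactin X K \<and> (\<forall>x. x \<notin> K \<longrightarrow> f x = 0))"
  then obtain K where f: "continuous_map X euclidean f" and K: "compactin X K"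
    and fK: "\<And>x. x \<notin> K \<Longrightarrow> f x = 0" by blast
  have "X closure_of {x \<in> topspace X. f x \<noteq> 0} \<subseteq> K"
    by (rule closure_of_minimal) (use fK K assms compactin_imp_closedin in auto)
  then have "compactin X (X closure_of {x \<in> topspace X. f x \<noteq> 0})"
    using closed_compactin[OF K _ closedin_closure_of] by blast
  moreover have "f x = 0" if "x \<notin> topspace X" for x
    using fK compactin_subset_topspace[OF K] that by blast
  ultimately show "f \<in> Cc X" using f by (simp add: Cc_def)
qed

lemma Cc_continuous: "f \<in> Cc X \<Longrightarrow> continuous_map X euclidean f"
  by (simp add: Cc_def)

lemma Cc_outside: "f \<in> Cc X \<Longrightarrow> x \<notin> topspace X \<Longrightarrow> f x = 0"
  by (simp add: Cc_def)

lemma Cc_support: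
  assumes "Hausdorff_space X" "f \<in> Cc X"
  obtains K where "compactin X K" "\<And>x. x \<notin> K \<Longrightarrow> f x = 0"
  using assms Cc_iff by metis

lemma CcI:
  assumes "Hausdorff_space X" "continuous_map X euclidean f" "compactin X K" "\<And>x. x \<notin> K \<Longrightarrow> f x = 0"
  shows "f \<in> Cc X"
  using assms Cc_iff by metis

lemma Cc_add: 
  assumes "Hausdorff_space X" "f \<in> Cc X" "g \<in> Cc X" shows "(\<lambda>x. f x + g x) \<in> Cc X"
proof -
  obtain K L where "compactin X K" "\<And>x. x \<notin> K \<Longrightarrow> f x = 0" "compactin X L" "\<And>x. x \<notin> L \<Longrightarrow> g x = 0"
    using Cc_support assms by metis
  then show ?thesis
    by (intro CcI[of X _ "K \<union> L"])
      (use assms in \<open>auto intro: compactin_Un continuous_map_add Cc_continuous\<close>)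
qed

lemma Cc_mult_continuous:
  assumes "Hausdorff_space X" "f \<in> Cc X" "continuous_map X euclidean g"
  shows "(\<lambda>x. g x * f x) \<in> Cc X"
proof -
  obtain K where "compactin X K" "\<And>x. x \<notin> K \<Longrightarrow> f x = 0" using Cc_support assms by metis
  then show ?thesis
    by (intro CcI[of X _ K]) (use assms in \<open>auto intro: continuous_map_complex_mult Cc_continuous\<close>)
qed

lemma Cc_scale: "Hausdorff_space X \<Longrightarrow> f \<in> Cc X \<Longrightarrow> (\<lambda>x. c * f x) \<in> Cc X"
  using Cc_mult_continuous[of X f "\<lambda>_. c"] by simp

lemma Cc_zero: "(\<lambda>_. 0) \<in> Cc X"
  by (simp add: Cc_def)

lemma compact_open_bump:
  assumes lc: "locally_compact_space X" and haus: "Hausdorff_space X"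
    and K: "compactin X K" and U: "openin X U" and KU: "K \<subseteq> U"
  obtains \<theta> :: "'a \<Rightarrow> real" and L where "continuous_map X euclideanreal \<theta>" "compactin X L"
    "\<And>x. x \<in> K \<Longrightarrow> \<theta> x = 1" "\<And>x. x \<notin> U \<Longrightarrow> \<theta> x = 0" "\<And>x. x \<notin> L \<Longrightarrow> \<theta> x = 0"
    "\<And>x. 0 \<le> \<theta> x \<and> \<theta> x \<le> 1"
proof -
  obtain V L where V: "openin X V" "compactin X L" "K \<subseteq> V" "V \<subseteq> L"
    using lc K locally_compact_space_compact_closed_compact[of X] haus by blast
  have cr: "completely_regular_space X"
    using lc haus locally_compact_regular_imp_completely_regular_space by blast
  have "closedin X (topspace X - (U \<inter> V))" using U V by blast
  moreover have "disjnt K (topspace X - (U \<inter> V))" using KU V by (auto simp: disjnt_def)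
  ultimately obtain f where f: "continuous_map X (top_of_set {0..1::real}) f"
      "f ` (topspace X - (U \<inter> V)) \<subseteq> {0}" "f ` K \<subseteq> {1}"
    using Urysohn_completely_regular_compact_closed[of 0 1 X K "topspace X - (U \<inter> V)"] cr K by auto
  define \<theta> where "\<theta> x = (if x \<in> topspace X then f x else 0)" for x
  have Ktop: "K \<subseteq> topspace X" using K compactin_subset_topspace by blast
  show ?thesis
  proof
    show "continuous_map X euclideanreal \<theta>"
      by (rule continuous_map_eq[of X euclideanreal f])
        (use f(1) in \<open>auto simp: \<theta>_def continuous_map_in_subtopology\<close>)
    show "compactin X L" by fact
    show "\<theta> x = 1" if "x \<in> K" for x using f that Ktop by (auto simp: \<theta>_def)
    have 0: "\<theta> x = 0" if "x \<notin> U \<inter> V" for x using f that by (auto simp: \<theta>_def)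
    show "\<theta> x = 0" if "x \<notin> U" for x using 0 that by blast
    show "\<theta> x = 0" if "x \<notin> L" for x using 0 that V(4) by blast
    show "0 \<le> \<theta> x \<and> \<theta> x \<le> 1" for x
      using f(1) by (auto simp: \<theta>_def continuous_map_in_subtopology image_subset_iff Pi_iff)
  qed
qed

text \<open>A locally compact Hausdorff space is completely regular, so Tietze's theorem extends the function from
  the compact part of the closed set in a neighbourhood of the support; multiplying by a bump function
  that is 1 on the support makes the extension agree with the function on the rest of the closed set.\<close>

lemma Cc_extend_from_closed:
  assumes lc: "locally_compact_space X" and haus: "Hausdorff_space X"
    and C: "closedin X C" and f: "f \<in> Cc (subtopology X C)"
  obtains F where "F \<in> Cc X" "\<And>x. x \<in> C \<Longrightarrow> F x = f x"
proof -
  have haus': "Hausdorff_space (subtopology X C)" using haus by (rule Hausdorff_space_subtopology)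
  have cr: "completely_regular_space X"
    using lc haus locally_compact_regular_imp_completely_regular_space by blast
  obtain K where K: "compactin X K" "K \<subseteq> C" "\<And>x. x \<notin> K \<Longrightarrow> f x = 0"
    by (rule Cc_support[OF haus' f]) (auto simp: compactin_subtopology)
  obtain V L where V: "openin X V" "K \<subseteq> V" and L: "compactin X L" "V \<subseteq> L"
    using lc K(1) locally_compact_space_compact_closed_compact[of X] haus by blast
  obtain \<theta> M where \<theta>: "continuous_map X euclideanreal \<theta>" "compactin X M" "\<And>x. x \<in> K \<Longrightarrow> \<theta> x = 1"
      "\<And>x. x \<notin> V \<Longrightarrow> \<theta> x = 0" "\<And>x. x \<notin> M \<Longrightarrow> \<theta> x = 0"
    using compact_open_bump[OF lc haus K(1) V(1,2)] by metis
  have S: "compactin X (C \<inter> L)" using C L(1) by (rule closed_Int_compactin)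
  have tie: "\<exists>g. continuous_map X euclideanreal g \<and> (\<forall>x\<in>C \<inter> L. g x = h x)"
    if "continuous_map (subtopology X C) euclideanreal h" for h
  proof -
    have "continuous_map (subtopology X (C \<inter> L)) euclideanreal h"
      using that by (rule continuous_map_from_subtopology_mono) simp
    then obtain g where "continuous_map X euclideanreal g" "\<And>x. x \<in> C \<inter> L \<Longrightarrow> g x = h x"
      by (rule Tietze_extension_completely_regular[OF cr S is_interval_univ UNIV_not_empty _ subset_UNIV]) blast
    then show ?thesis by blast
  qed
  have cf: "continuous_map (subtopology X C) euclidean f" using f by (rule Cc_continuous)
  have "continuous_map (subtopology X C) euclideanreal (\<lambda>x. Re (f x))"
    using cf by (simp add: continuous_map_atin tendsto_Re)
  from tie[OF this] obtain g
    where g: "continuous_map X euclideanreal g" "\<And>x. x\<in>C \<inter> L \<Longrightarrow> g x = Re (f x)" by blast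
  have "continuous_map (subtopology X C) euclideanreal (\<lambda>x. Im (f x))"
    using cf by (simp add: continuous_map_atin tendsto_Im)
  from tie[OF this] obtain h
    where h: "continuous_map X euclideanreal h" "\<And>x. x\<in>C \<inter> L \<Longrightarrow> h x = Im (f x)" by blast
  define F where "F x = complex_of_real (\<theta> x) * (of_real (g x) + \<i> * of_real (h x))" for x
  show ?thesis
  proof
    show "F \<in> Cc X"
    proof (rule CcI[OF haus _ \<theta>(2)])
      show "continuous_map X euclidean F" unfolding F_def
        by (intro continuous_map_complex_mult continuous_map_add continuous_map_complex_of_real \<theta> g h) simp
    qed (simp add: F_def \<theta>)
    show "F x = f x" if "x \<in> C" for x
    proof (cases "x \<in> V")
      case True
      then have "x \<in> C \<inter> L" using that L by blast
      then have "F x = \<theta> x * f x" using complex_eq[of "f x"] by (simp add: F_def g h)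
      then show ?thesis using \<theta>(3)[of x] K(3)[of x] by (cases "x \<in> K") auto
    next
      case False
      then show ?thesis using V K(3)[of x] by (auto simp: F_def \<theta>)
    qed
  qed
qed

section \<open>Sums over the fibres of a local homeomorphism\<close>

lemma local_homeomorphism_section:
  assumes "local_homeomorphism X Y s" "x \<in> topspace X"
  obtains U \<sigma> where "openin X U" "x \<in> U" "openin Y (s ` U)"
    "continuous_map (subtopology Y (s ` U)) X \<sigma>" "\<And>u. u \<in> U \<Longrightarrow> \<sigma> (s u) = u"
proof -
  obtain U where U: "openin X U" "x \<in> U" "openin Y (s ` U)"
      "homeomorphic_map (subtopology X U) (subtopology Y (s ` U)) s"
    using assms by (auto simp: local_homeomorphism_def)
  obtain \<sigma> where "homeomorphic_maps (subtopology X U) (subtopology Y (s ` U)) s \<sigma>"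
    using U(4) homeomorphic_map_maps by blast
  then have "continuous_map (subtopology Y (s ` U)) X \<sigma>" "\<forall>u \<in> topspace X \<inter> U. \<sigma> (s u) = u"
    by (auto simp: homeomorphic_maps_def continuous_map_in_subtopology)
  with U show ?thesis using openin_subset[OF U(1)] by (intro that[of U \<sigma>]) auto
qed

text \<open>The fibre is closed, and a neighbourhood on which \<^term>\<open>s\<close> is injective meets it in one point; so the
  compact part is covered by finitely many such neighbourhoods.\<close>

lemma finite_compact_fibre:
  assumes lh: "local_homeomorphism X Y s" and cs: "continuous_map X Y s" and Y: "Hausdorff_space Y"
    and K: "compactin X K"
  shows "finite {x \<in> K. s x = y}"
proof (cases "y \<in> topspace Y")
  case True
  have Ktop: "K \<subseteq> topspace X" using K by (rule compactin_subset_topspace)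
  have "closedin X {x \<in> topspace X. s x \<in> {y}}"
    by (rule closedin_continuous_map_preimage[OF cs closedin_Hausdorff_singleton[OF Y True]])
  then have "compactin X ({x \<in> topspace X. s x \<in> {y}} \<inter> K)" by (rule closed_Int_compactin[OF _ K])
  moreover have "{x \<in> topspace X. s x \<in> {y}} \<inter> K = {x \<in> K. s x = y}" using Ktop by auto
  ultimately have co: "compactin X {x \<in> K. s x = y}" by simp
  define \<U> where "\<U> = {U. openin X U \<and> inj_on s U}"
  have "{x \<in> K. s x = y} \<subseteq> \<Union>\<U>"
  proof
    fix x assume "x \<in> {x \<in> K. s x = y}"
    then have "x \<in> topspace X" using Ktop by auto
    from local_homeomorphism_section[OF lh this] obtain U \<sigma> where "openin X U" "x \<in> U"
      "\<And>u. u \<in> U \<Longrightarrow> \<sigma> (s u) = u" by metis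
    then have "U \<in> \<U>" by (auto simp: \<U>_def intro: inj_on_inverseI)
    then show "x \<in> \<Union>\<U>" using \<open>x \<in> U\<close> by blast
  qed
  moreover have "\<forall>U\<in>\<U>. openin X U" by (simp add: \<U>_def)
  ultimately have "\<exists>\<F>. finite \<F> \<and> \<F> \<subseteq> \<U> \<and> {x \<in> K. s x = y} \<subseteq> \<Union>\<F>"
    using co unfolding compactin_def by blast
  then obtain \<F> where \<F>: "finite \<F>" "\<F> \<subseteq> \<U>" "{x \<in> K. s x = y} \<subseteq> \<Union>\<F>"
    by blast
  have "finite {x \<in> U. s x = y}" if "U \<in> \<F>" for U
  proof (cases "{x \<in> U. s x = y} = {}")
    case False
    then obtain x where "x \<in> U" "s x = y" by auto
    then have "{x \<in> U. s x = y} \<subseteq> {x}" using that \<F>(2) by (auto simp: \<U>_def inj_on_def)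
    then show ?thesis using finite_subset by blast
  qed (metis finite.emptyI)
  then have "finite (\<Union>U\<in>\<F>. {x \<in> U. s x = y})" using \<F>(1) by blast
  then show ?thesis by (rule rev_finite_subset) (use \<F>(3) in auto)
next
  case False
  have "{x \<in> K. s x = y} = {}"
    using False continuous_map_image_subset_topspace[OF cs] compactin_subset_topspace[OF K] by auto
  then show ?thesis by (metis finite.emptyI)
qed

text \<open>Near a given base point, the points of the fibre that lie in \<^term>\<open>K\<close> move along finitely many
  disjoint local sections, and no further points of \<^term>\<open>K\<close> appear, because the image of the part of \<^term>\<open>K\<close>
  away from the sections is closed. So the sum is locally a fixed finite sum of continuous functions.
  The extra parameter \<^term>\<open>z\<close> makes the lemma apply to convolutions.\<close>

lemma continuous_map_fibre_sum:
  fixes k :: "'z \<times> 'a \<Rightarrow> complex"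
  assumes lh: "local_homeomorphism X Y s" and cs: "continuous_map X Y s"
    and HX: "Hausdorff_space X" and HY: "Hausdorff_space Y"
    and K: "compactin X K" and a: "continuous_map Z Y a"
    and k: "continuous_map (subtopology (prod_topology Z X) {(z, x). s x = a z}) euclidean k"
    and k0: "\<And>z x. z \<in> topspace Z \<Longrightarrow> x \<in> topspace X \<Longrightarrow> s x = a z \<Longrightarrow> x \<notin> K \<Longrightarrow> k (z, x) = 0"
  shows "continuous_map Z euclidean (\<lambda>z. \<Sum>x\<in>{x \<in> K. s x = a z}. k (z, x))"
proof (rule continuous_map_locally)
  fix z0 assume z0: "z0 \<in> topspace Z"
  have Ktop: "K \<subseteq> topspace X" using K by (rule compactin_subset_topspace)
  define F where "F = {x \<in> K. s x = a z0}"
  have fin: "finite F" unfolding F_def by (rule finite_compact_fibre[OF lh cs HY K])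
  have Ftop: "F \<subseteq> topspace X" using Ktop by (auto simp: F_def)
  have "\<forall>x\<in>F. \<exists>U \<sigma>. openin X U \<and> x \<in> U \<and> openin Y (s ` U) \<and>
      continuous_map (subtopology Y (s ` U)) X \<sigma> \<and> (\<forall>u\<in>U. \<sigma> (s u) = u)"
    using local_homeomorphism_section[OF lh] Ftop by (metis subsetD)
  then obtain U \<sigma> where U: "\<And>x. x \<in> F \<Longrightarrow> openin X (U x)" "\<And>x. x \<in> F \<Longrightarrow> x \<in> U x"
      "\<And>x. x \<in> F \<Longrightarrow> openin Y (s ` U x)"
    and \<sigma>: "\<And>x. x \<in> F \<Longrightarrow> continuous_map (subtopology Y (s ` U x)) X (\<sigma> x)"
      "\<And>x u. x \<in> F \<Longrightarrow> u \<in> U x \<Longrightarrow> \<sigma> x (s u) = u"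
    by metis
  have "\<forall>x y. \<exists>P Q. x \<in> F \<and> y \<in> F \<and> x \<noteq> y \<longrightarrow> openin X P \<and> openin X Q \<and> x \<in> P \<and> y \<in> Q \<and> disjnt P Q"
    using HX Ftop unfolding Hausdorff_space_def by (metis subsetD)
  then obtain P Q where PQ: "\<And>x y. x \<in> F \<Longrightarrow> y \<in> F \<Longrightarrow> x \<noteq> y \<Longrightarrow>
      openin X (P x y) \<and> openin X (Q x y) \<and> x \<in> P x y \<and> y \<in> Q x y \<and> disjnt (P x y) (Q x y)"
    by metis
  \<comment> \<open>Shrinking by the separating neighbourhoods makes the local sections through the points of the
    fibre disjoint.\<close>
  define V where "V x = (\<Inter>y\<in>F - {x}. P x y \<inter> Q y x) \<inter> topspace X \<inter> U x" for x
  have V: "openin X (V x)" "x \<in> V x" "V x \<subseteq> U x" if "x \<in> F" for x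
  proof -
    show "openin X (V x)" unfolding V_def
      by (intro openin_Int[OF openin_INT] U) (use fin PQ that in auto)
    show "x \<in> V x" using PQ that U Ftop by (auto simp: V_def)
    show "V x \<subseteq> U x" by (auto simp: V_def)
  qed
  have disj: "V x \<inter> V y = {}" if "x \<in> F" "y \<in> F" "x \<noteq> y" for x y
  proof -
    have "V x \<subseteq> P x y" "V y \<subseteq> Q x y" using that by (auto simp: V_def)
    then show ?thesis using PQ[OF that] by (auto simp: disjnt_def)
  qed
  have sV: "openin Y (s ` V x)" if x: "x \<in> F" for x
  proof -
    have "openin Y {y \<in> s ` U x. \<sigma> x y \<in> V x}"
    proof -
      have "openin (subtopology Y (s ` U x)) {y \<in> topspace (subtopology Y (s ` U x)). \<sigma> x y \<in> V x}"
        by (rule openin_continuous_map_preimage[OF \<sigma>(1)[OF x] V(1)[OF x]])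
      moreover have "topspace (subtopology Y (s ` U x)) = s ` U x"
        using openin_subset[OF U(3)[OF x]] by auto
      ultimately show ?thesis using openin_trans_full U(3)[OF x] by metis
    qed
    moreover have "{y \<in> s ` U x. \<sigma> x y \<in> V x} = s ` V x"
      using \<sigma>(2)[OF x] V(3)[OF x] by (force simp: image_iff)
    ultimately show ?thesis by simp
  qed
  \<comment> \<open>Base points outside the closed image of \<open>R\<close> have no points of \<^term>\<open>K\<close> away from the sections.\<close>
  define R where "R = K - (\<Union>x\<in>F. V x)"
  have "compactin X (K \<inter> (topspace X - (\<Union>x\<in>F. V x)))"
    using V by (intro compact_Int_closedin[OF K]) auto
  moreover have "K \<inter> (topspace X - (\<Union>x\<in>F. V x)) = R" using Ktop by (auto simp: R_def)
  ultimately have "closedin Y (s ` R)"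
    using compactin_imp_closedin[OF HY image_compactin[OF _ cs]] by simp
  then have "openin Y (topspace Y - s ` R)" by blast
  define N where "N = ((\<Inter>x\<in>F. s ` V x) \<inter> topspace Y) \<inter> (topspace Y - s ` R)"
  have N: "openin Y N" unfolding N_def
    by (intro openin_Int openin_INT sV fin \<open>openin Y (topspace Y - s ` R)\<close>)
  have az0: "a z0 \<in> topspace Y" using continuous_map_image_subset_topspace[OF a] z0 by auto
  have "a z0 \<in> N"
  proof -
    have "a z0 \<in> s ` V x" if "x \<in> F" for x using V(2)[OF that] that by (force simp: F_def)
    moreover have "a z0 \<notin> s ` R" using V(2) by (auto simp: R_def F_def)
    ultimately show ?thesis using az0 by (simp add: N_def)
  qed
  define M where "M = {z \<in> topspace Z. a z \<in> N}"
  have M: "openin Z M" unfolding M_def by (rule openin_continuous_map_preimage[OF a N])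
  have sec: "\<sigma> x (a z) \<in> V x \<and> s (\<sigma> x (a z)) = a z" if "x \<in> F" "z \<in> M" for x z
  proof -
    have "a z \<in> s ` V x" using that by (auto simp: M_def N_def)
    then obtain v where "v \<in> V x" "a z = s v" by auto
    then show ?thesis using \<sigma>(2)[OF that(1), of v] V(3)[OF that(1)] by auto
  qed
  have eq: "(\<Sum>x\<in>{x \<in> K. s x = a z}. k (z, x)) = (\<Sum>x\<in>F. k (z, \<sigma> x (a z)))" if z: "z \<in> M" for z
  proof -
    let ?h = "\<lambda>x. \<sigma> x (a z)"
    have inj: "inj_on ?h F" using sec[OF _ z] disj by (force simp: inj_on_def)
    have "(\<Sum>x\<in>{x \<in> K. s x = a z}. k (z, x)) = (\<Sum>x\<in>?h ` F. k (z, x))"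
    proof (rule sum.mono_neutral_left)
      show "finite (?h ` F)" using fin by simp
      show "{x \<in> K. s x = a z} \<subseteq> ?h ` F"
      proof
        fix x assume x: "x \<in> {x \<in> K. s x = a z}"
        have "a z \<notin> s ` R" using z by (auto simp: M_def N_def)
        then have "x \<notin> R" using x by (metis (mono_tags, lifting) image_eqI mem_Collect_eq)
        then obtain y where y: "y \<in> F" "x \<in> V y" using x by (auto simp: R_def)
        then have "?h y = x" using \<sigma>(2)[OF y(1), of x] V(3)[OF y(1)] x by auto
        then show "x \<in> ?h ` F" using y(1) by blast
      qed
      show "\<forall>x\<in>?h ` F - {x \<in> K. s x = a z}. k (z, x) = 0"
      proof
        fix x assume x: "x \<in> ?h ` F - {x \<in> K. s x = a z}"
        then obtain y where y: "y \<in> F" "x = ?h y" by auto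
        have "x \<in> V y" "s x = a z" using sec[OF y(1) z] y(2) by auto
        moreover have "x \<in> topspace X" using \<open>x \<in> V y\<close> by (simp add: V_def)
        ultimately show "k (z, x) = 0" using x z by (intro k0) (auto simp: M_def)
      qed
    qed
    also have "\<dots> = (\<Sum>x\<in>F. k (z, ?h x))" by (simp add: sum.reindex[OF inj])
    finally show ?thesis .
  qed
  have cont: "continuous_map (subtopology Z M) euclidean (\<lambda>z. \<Sum>x\<in>F. k (z, \<sigma> x (a z)))"
  proof (intro continuous_map_sum fin)
    fix x assume x: "x \<in> F"
    have aM: "continuous_map (subtopology Z M) (subtopology Y (s ` U x)) a"
    proof (rule continuous_map_into_subtopology[OF continuous_map_from_subtopology[OF a]])
      show "a \<in> topspace (subtopology Z M) \<rightarrow> s ` U x"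
      proof
        fix z assume "z \<in> topspace (subtopology Z M)"
        then have "a z \<in> s ` V x" using x by (simp add: M_def N_def)
        then show "a z \<in> s ` U x" using V(3)[OF x] by blast
      qed
    qed
    have "continuous_map (subtopology Z M) (prod_topology Z X) (\<lambda>z. (z, \<sigma> x (a z)))"
      using continuous_map_compose[OF aM \<sigma>(1)[OF x]]
      by (intro continuous_map_pairedI) (auto simp: o_def continuous_map_from_subtopology)
    then have "continuous_map (subtopology Z M) (subtopology (prod_topology Z X) {(z, x). s x = a z})
        (\<lambda>z. (z, \<sigma> x (a z)))"
      using sec[OF x] by (intro continuous_map_into_subtopology) auto
    from continuous_map_compose[OF this k]
    show "continuous_map (subtopology Z M) euclidean (\<lambda>z. k (z, \<sigma> x (a z)))" by (simp add: o_def)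
  qed
  have "continuous_map (subtopology Z M) euclidean (\<lambda>z. \<Sum>x\<in>{x \<in> K. s x = a z}. k (z, x))"
    by (rule continuous_map_eq[OF cont]) (simp add: eq)
  then show "\<exists>M. openin Z M \<and> z0 \<in> M \<and>
      continuous_map (subtopology Z M) euclidean (\<lambda>z. \<Sum>x\<in>{x \<in> K. s x = a z}. k (z, x))"
    using M z0 \<open>a z0 \<in> N\<close> by (intro exI[of _ M]) (auto simp: M_def)
qed

section \<open>The convolution algebra of a twisted etale groupoid\<close>

lemma infsum_eq_finite_sum:
  fixes f :: "'a \<Rightarrow> 'b::{comm_monoid_add,t2_space}"
  assumes "finite S" "S \<subseteq> A" "\<And>x. x \<in> A \<Longrightarrow> x \<notin> S \<Longrightarrow> f x = 0"
  shows "infsum f A = sum f S"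
proof -
  have "infsum f A = infsum f S" by (rule infsum_cong_neutral) (use assms in auto)
  then show ?thesis using assms(1) by simp
qed

locale twisted_etale_groupoid = etale_groupoid G
  for G :: "'a groupoid" +
  fixes \<omega> :: "'a \<times> 'a \<Rightarrow> complex"
  assumes locally_compact: "locally_compact_space (arr_top G)"
    and Hausdorff: "Hausdorff_space (arr_top G)"
    and cocycle: "continuous_cocycle G \<omega>"
begin

abbreviation A :: "'a set" where "A \<equiv> arrows G"
abbreviation s :: "'a \<Rightarrow> 'a" where "s \<equiv> src G"
abbreviation r :: "'a \<Rightarrow> 'a" where "r \<equiv> rng G"
abbreviation prd :: "'a \<Rightarrow> 'a \<Rightarrow> 'a" (infixl "\<cdot>" 70) where "x \<cdot> y \<equiv> mul G x y"
abbreviation iv :: "'a \<Rightarrow> 'a" where "iv \<equiv> ginv G"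
abbreviation conv :: "('a \<Rightarrow> complex) \<Rightarrow> ('a \<Rightarrow> complex) \<Rightarrow> 'a \<Rightarrow> complex" where
  "conv \<equiv> twisted_conv G \<omega>"
abbreviation adj :: "('a \<Rightarrow> complex) \<Rightarrow> 'a \<Rightarrow> complex" where
  "adj \<equiv> twisted_star G \<omega>"
abbreviation "CcG \<equiv> Cc (arr_top G)"

lemma comp_iff [simp]: "(x, y) \<in> composable G \<longleftrightarrow> x \<in> A \<and> y \<in> A \<and> s x = r y"
  by (simp add: composable_def)

lemma fibre_iff [simp]: "x \<in> src_fibre G u \<longleftrightarrow> x \<in> A \<and> s x = u"
  by (simp add: src_fibre_def)

lemma rng_fibre_iff [simp]: "x \<in> rng_fibre G u \<longleftrightarrow> x \<in> A \<and> r x = u"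
  by (simp add: rng_fibre_def)

lemma units_iff: "u \<in> units G \<longleftrightarrow> u \<in> A \<and> s u = u"
  unfolding units_def using src_closed src_src by (metis (no_types, lifting) image_iff)

lemma unit_rng: "u \<in> units G \<Longrightarrow> r u = u"
  using units_iff rng_src by metis

lemma src_unit: "x \<in> A \<Longrightarrow> s x \<in> units G"
  by (simp add: units_def)

lemma prd_simps [simp]:
  assumes "x \<in> A" "y \<in> A" "s x = r y"
  shows "x \<cdot> y \<in> A" "s (x \<cdot> y) = s y" "r (x \<cdot> y) = r x"
  using assms mul_closed src_mul rng_mul by simp_all

lemma iv_simps [simp]:
  assumes "x \<in> A"
  shows "iv x \<in> A" "s (iv x) = r x" "r (iv x) = s x" "x \<cdot> iv x = r x" "iv x \<cdot> x = s x"
    "x \<cdot> s x = x" "r x \<cdot> x = x"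
  using assms ginv_closed src_ginv rng_ginv mul_ginv ginv_mul mul_src rng_mul_self by simp_all

lemma assoc:
  "x \<in> A \<Longrightarrow> y \<in> A \<Longrightarrow> z \<in> A \<Longrightarrow> s x = r y \<Longrightarrow> s y = r z \<Longrightarrow> x \<cdot> y \<cdot> z = x \<cdot> (y \<cdot> z)"
  using mul_assoc by simp

lemma right_cancel_iv: "x \<in> A \<Longrightarrow> y \<in> A \<Longrightarrow> s x = s y \<Longrightarrow> x \<cdot> iv y \<cdot> y = x"
  using assoc[of x "iv y" y] iv_simps(6)[of x] by simp

lemma right_cancel: "x \<in> A \<Longrightarrow> y \<in> A \<Longrightarrow> s x = r y \<Longrightarrow> x \<cdot> y \<cdot> iv y = x"
  using assoc[of x y "iv y"] iv_simps(6)[of x] by simp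

lemma left_cancel: "x \<in> A \<Longrightarrow> y \<in> A \<Longrightarrow> s x = r y \<Longrightarrow> iv x \<cdot> (x \<cdot> y) = y"
  using assoc[of "iv x" x y] by simp

lemma iv_unique: 
  assumes "x \<in> A" "y \<in> A" "s x = r y" "x \<cdot> y = r x" shows "y = iv x"
proof -
  have "y = iv x \<cdot> (x \<cdot> y)" by (rule left_cancel[OF assms(1-3), symmetric])
  also have "\<dots> = iv x" using assms(1,4) iv_simps(6)[OF iv_simps(1)[OF assms(1)]] by simp
  finally show ?thesis .
qed

lemma iv_iv [simp]: "x \<in> A \<Longrightarrow> iv (iv x) = x"
  using iv_unique[of "iv x" x] by simp

lemma iv_prd:
  assumes "x \<in> A" "y \<in> A" "s x = r y" shows "iv (x \<cdot> y) = iv y \<cdot> iv x"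
proof (rule iv_unique[symmetric])
  have "x \<cdot> y \<cdot> (iv y \<cdot> iv x) = x \<cdot> y \<cdot> iv y \<cdot> iv x" using assms assoc[of "x \<cdot> y" "iv y" "iv x"] by simp
  then show "x \<cdot> y \<cdot> (iv y \<cdot> iv x) = r (x \<cdot> y)" using assms by (simp add: right_cancel)
qed (use assms in auto)

lemma src_iv_unit: "u \<in> units G \<Longrightarrow> y \<in> A \<Longrightarrow> s y = u \<Longrightarrow> u \<cdot> iv y = iv y"
  using iv_simps(7)[of "iv y"] by auto

lemma unit_top_Hausdorff: "Hausdorff_space (unit_top G)"
  unfolding unit_top_def using Hausdorff by (rule Hausdorff_space_subtopology)

lemma finite_src_support:
  assumes "f \<in> CcG" shows "finite {y \<in> A. s y = u \<and> f y \<noteq> 0}"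
proof -
  obtain K where "compactin (arr_top G) K" "\<And>x. x \<notin> K \<Longrightarrow> f x = 0"
    using Cc_support[OF Hausdorff assms] by blast
  then have "finite {x \<in> K. s x = u}"
    using finite_compact_fibre[OF src_local_homeo continuous_src unit_top_Hausdorff] by blast
  then show ?thesis by (rule rev_finite_subset) (use \<open>\<And>x. x \<notin> K \<Longrightarrow> f x = 0\<close> in auto)
qed

lemma cocycle_id:
  assumes "x \<in> A" "y \<in> A" "z \<in> A" "s x = r y" "s y = r z"
  shows "\<omega> (x, y) * \<omega> (x \<cdot> y, z) = \<omega> (x, y \<cdot> z) * \<omega> (y, z)"
  using cocycle assms by (simp add: continuous_cocycle_def)

lemma cocycle_norm: "x \<in> A \<Longrightarrow> \<omega> (x, s x) = 1" "x \<in> A \<Longrightarrow> \<omega> (r x, x) = 1"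
  using cocycle by (auto simp: continuous_cocycle_def)

lemma cocycle_cmod:
  assumes "x \<in> A" "y \<in> A" "s x = r y" shows "cmod (\<omega> (x, y)) = 1"
proof -
  have "continuous_map (composable_top G) (top_of_set (sphere 0 1)) \<omega>"
    using cocycle by (simp add: continuous_cocycle_def)
  then have "\<omega> \<in> topspace (composable_top G) \<rightarrow> sphere 0 1"
    by (simp add: continuous_map_in_subtopology)
  moreover have "(x, y) \<in> topspace (composable_top G)" using assms by (simp add: composable_top_def)
  ultimately show ?thesis by auto
qed

lemma cocycle_unimodular:
  assumes "x \<in> A" "y \<in> A" "s x = r y"
  shows "\<omega> (x, y) * cnj (\<omega> (x, y)) = 1" "cnj (\<omega> (x, y)) * \<omega> (x, y) = 1" "\<omega> (x, y) \<noteq> 0"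
  using complex_norm_square[of "\<omega> (x, y)"] cocycle_cmod[OF assms] by (auto simp: mult.commute)

lemma continuous_cocycle_map: "continuous_map (composable_top G) euclidean \<omega>"
  using cocycle by (simp add: continuous_cocycle_def continuous_map_in_subtopology)

text \<open>The working form of the convolution: any finite set that contains the points where the summand can
  be nonzero may serve as index set.\<close>

lemma conv_eq_sum:
  assumes "x \<in> A" "finite S" "\<And>y. y \<in> S \<Longrightarrow> y \<in> A \<and> s y = s x"
    and "\<And>y. y \<in> A \<Longrightarrow> s y = s x \<Longrightarrow> y \<notin> S \<Longrightarrow> f (x \<cdot> iv y) = 0 \<or> g y = 0"
  shows "conv f g x = (\<Sum>y\<in>S. \<omega> (x \<cdot> iv y, y) * f (x \<cdot> iv y) * g y)"
proof -
  have "conv f g x = (\<Sum>\<^sub>\<infinity>y\<in>src_fibre G (s x). \<omega> (x \<cdot> iv y, y) * f (x \<cdot> iv y) * g y)"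
    using assms(1) by (simp add: twisted_conv_def restrict0_def)
  also have "\<dots> = (\<Sum>y\<in>S. \<omega> (x \<cdot> iv y, y) * f (x \<cdot> iv y) * g y)"
    by (rule infsum_eq_finite_sum) (use assms in auto)
  finally show ?thesis .
qed

lemma conv_eq_sum_support:
  assumes "x \<in> A" "g \<in> CcG"
  shows "conv f g x = (\<Sum>y\<in>{y \<in> A. s y = s x \<and> g y \<noteq> 0}. \<omega> (x \<cdot> iv y, y) * f (x \<cdot> iv y) * g y)"
  by (rule conv_eq_sum) (use assms finite_src_support in auto)

lemma conv_outside: "x \<notin> A \<Longrightarrow> conv f g x = 0"
  by (simp add: twisted_conv_def restrict0_def)

lemma adj_eq: "x \<in> A \<Longrightarrow> adj f x = cnj (\<omega> (x, iv x)) * cnj (f (iv x))"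
  by (simp add: twisted_star_def restrict0_def)

lemma adj_outside: "x \<notin> A \<Longrightarrow> adj f x = 0"
  by (simp add: twisted_star_def restrict0_def)

lemma conv_nonzero:
  assumes "x \<in> A" "conv f g x \<noteq> 0"
  obtains y where "y \<in> A" "s y = s x" "f (x \<cdot> iv y) \<noteq> 0" "g y \<noteq> 0"
proof -
  have "\<exists>y. y \<in> A \<and> s y = s x \<and> f (x \<cdot> iv y) \<noteq> 0 \<and> g y \<noteq> 0"
  proof (rule ccontr)
    assume "\<not> ?thesis"
    then have "conv f g x = (\<Sum>y\<in>{}. \<omega> (x \<cdot> iv y, y) * f (x \<cdot> iv y) * g y)"
      by (intro conv_eq_sum) (use assms in auto)
    then show False using assms by simp
  qed
  then show ?thesis using that by blast
qed

lemma continuous_map_composable: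
  assumes "continuous_map X (arr_top G) f" "continuous_map X (arr_top G) g"
    "\<And>x. x \<in> topspace X \<Longrightarrow> s (f x) = r (g x)"
  shows "continuous_map X (composable_top G) (\<lambda>x. (f x, g x))"
  unfolding composable_top_def
proof (rule continuous_map_into_subtopology)
  show "continuous_map X (prod_topology (arr_top G) (arr_top G)) (\<lambda>x. (f x, g x))"
    using assms by (intro continuous_map_pairedI)
  show "(\<lambda>x. (f x, g x)) \<in> topspace X \<rightarrow> composable G"
    using assms(3) continuous_map_image_subset_topspace[OF assms(1)]
      continuous_map_image_subset_topspace[OF assms(2)] by (auto simp: image_subset_iff Pi_iff)
qed

lemma continuous_map_prd:
  assumes "continuous_map X (arr_top G) f" "continuous_map X (arr_top G) g"
    "\<And>x. x \<in> topspace X \<Longrightarrow> s (f x) = r (g x)"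
  shows "continuous_map X (arr_top G) (\<lambda>x. f x \<cdot> g x)"
  using continuous_map_compose[OF continuous_map_composable[OF assms] continuous_mul]
  by (simp add: o_def)

lemma continuous_map_cocycle:
  assumes "continuous_map X (arr_top G) f" "continuous_map X (arr_top G) g"
    "\<And>x. x \<in> topspace X \<Longrightarrow> s (f x) = r (g x)"
  shows "continuous_map X euclidean (\<lambda>x. \<omega> (f x, g x))"
  using continuous_map_compose[OF continuous_map_composable[OF assms] continuous_cocycle_map]
  by (simp add: o_def)

lemma compactin_prd:
  assumes "compactin (arr_top G) K" "compactin (arr_top G) L"
  shows "compactin (arr_top G) {x \<cdot> y | x y. x \<in> K \<and> y \<in> L \<and> s x = r y}"
proof -
  let ?P = "prod_topology (arr_top G) (arr_top G)"
  have KL: "K \<subseteq> A" "L \<subseteq> A" using assms compactin_subset_topspace by auto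
  have cs: "continuous_map (arr_top G) (unit_top G) s" and cr: "continuous_map (arr_top G) (unit_top G) r"
    by (rule continuous_src, rule continuous_rng)
  have "closedin ?P {z \<in> topspace ?P. s (fst z) = r (snd z)}"
    using closedin_continuous_maps_eq[OF unit_top_Hausdorff
        continuous_map_compose[OF continuous_map_fst cs] continuous_map_compose[OF continuous_map_snd cr]]
    by (simp add: o_def)
  then have "compactin ?P ({z \<in> topspace ?P. s (fst z) = r (snd z)} \<inter> K \<times> L)"
    by (rule closed_Int_compactin) (use assms compactin_Times in auto)
  moreover have "{z \<in> topspace ?P. s (fst z) = r (snd z)} \<inter> K \<times> L \<subseteq> composable G" by auto
  ultimately have "compactin (composable_top G) ({z \<in> topspace ?P. s (fst z) = r (snd z)} \<inter> K \<times> L)"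
    by (simp add: composable_top_def compactin_subtopology)
  from image_compactin[OF this continuous_mul]
  have "compactin (arr_top G) ((\<lambda>(x, y). x \<cdot> y) ` ({z \<in> topspace ?P. s (fst z) = r (snd z)} \<inter> K \<times> L))" .
  moreover have "(\<lambda>(x, y). x \<cdot> y) ` ({z \<in> topspace ?P. s (fst z) = r (snd z)} \<inter> K \<times> L)
      = {x \<cdot> y | x y. x \<in> K \<and> y \<in> L \<and> s x = r y}"
    using KL by force
  ultimately show ?thesis by simp
qed

text \<open>The parameter space of the fibrewise sum is the groupoid itself, mapped to the units by the source.\<close>

lemma conv_Cc:
  assumes f: "f \<in> CcG" and g: "g \<in> CcG" shows "conv f g \<in> CcG"
proof -
  obtain K where K: "compactin (arr_top G) K" "\<And>x. x \<notin> K \<Longrightarrow> f x = 0" using Cc_support[OF Hausdorff f] by blast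
  obtain L where L: "compactin (arr_top G) L" "\<And>x. x \<notin> L \<Longrightarrow> g x = 0" using Cc_support[OF Hausdorff g] by blast
  have LA: "L \<subseteq> A" using L compactin_subset_topspace by blast
  define k where "k = (\<lambda>(x, y). \<omega> (x \<cdot> iv y, y) * f (x \<cdot> iv y) * g y)"
  let ?Z = "subtopology (prod_topology (arr_top G) (arr_top G)) {(x, y). s y = s x}"
  have c1: "continuous_map ?Z (arr_top G) fst" "continuous_map ?Z (arr_top G) snd"
    by (intro continuous_map_from_subtopology continuous_map_fst continuous_map_snd)+
  have c2: "continuous_map ?Z (arr_top G) (\<lambda>z. iv (snd z))"
    using continuous_map_compose[OF c1(2) continuous_ginv] by (simp add: o_def)
  have c3: "continuous_map ?Z (arr_top G) (\<lambda>z. fst z \<cdot> iv (snd z))"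
    by (rule continuous_map_prd[OF c1(1) c2]) auto
  have kk: "k = (\<lambda>z. \<omega> (fst z \<cdot> iv (snd z), snd z) * f (fst z \<cdot> iv (snd z)) * g (snd z))"
    by (auto simp: k_def)
  have "continuous_map ?Z euclidean k"
    unfolding kk
  proof (intro continuous_map_complex_mult)
    show "continuous_map ?Z euclidean (\<lambda>z. \<omega> (fst z \<cdot> iv (snd z), snd z))"
      by (rule continuous_map_cocycle[OF c3 c1(2)]) auto
    show "continuous_map ?Z euclidean (\<lambda>z. f (fst z \<cdot> iv (snd z)))"
      using continuous_map_compose[OF c3 Cc_continuous[OF f]] by (simp add: o_def)
    show "continuous_map ?Z euclidean (\<lambda>z. g (snd z))"
      using continuous_map_compose[OF c1(2) Cc_continuous[OF g]] by (simp add: o_def)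
  qed
  from continuous_map_fibre_sum[OF src_local_homeo continuous_src Hausdorff unit_top_Hausdorff L(1)
      continuous_src this]
  have "continuous_map (arr_top G) euclidean (\<lambda>x. \<Sum>y\<in>{y \<in> L. s y = s x}. k (x, y))"
    using L(2) by (simp add: k_def)
  then have cont: "continuous_map (arr_top G) euclidean (conv f g)"
  proof (rule continuous_map_eq)
    fix x assume x: "x \<in> A"
    have "finite {y \<in> L. s y = s x}"
      by (rule finite_compact_fibre[OF src_local_homeo continuous_src unit_top_Hausdorff L(1)])
    then show "(\<Sum>y\<in>{y \<in> L. s y = s x}. k (x, y)) = conv f g x"
      using x L(2) LA by (subst conv_eq_sum[of x "{y \<in> L. s y = s x}"]) (auto simp: k_def)
  qed
  have "conv f g x = 0" if "x \<notin> {x \<cdot> y | x y. x \<in> K \<and> y \<in> L \<and> s x = r y}" for x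
  proof (rule ccontr)
    assume nz: "conv f g x \<noteq> 0"
    then have x: "x \<in> A" using conv_outside by blast
    from conv_nonzero[OF x nz] obtain y where y: "y \<in> A" "s y = s x" "f (x \<cdot> iv y) \<noteq> 0" "g y \<noteq> 0" .
    then have "x \<cdot> iv y \<in> K" "y \<in> L" "x = (x \<cdot> iv y) \<cdot> y" "s (x \<cdot> iv y) = r y"
      using K L x right_cancel_iv by auto
    then show False using that by blast
  qed
  then show ?thesis using CcI[OF Hausdorff cont compactin_prd[OF K(1) L(1)]] by blast
qed

lemma adj_Cc:
  assumes f: "f \<in> CcG" shows "adj f \<in> CcG"
proof -
  obtain K where K: "compactin (arr_top G) K" "\<And>x. x \<notin> K \<Longrightarrow> f x = 0" using Cc_support[OF Hausdorff f] by blast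
  have "continuous_map (arr_top G) euclidean (\<lambda>x. cnj (\<omega> (x, iv x)) * cnj (f (iv x)))"
    using continuous_map_compose[OF continuous_ginv Cc_continuous[OF f]] continuous_ginv
    by (intro continuous_map_complex_mult continuous_map_cnj continuous_map_cocycle) (auto simp: o_def)
  then have "continuous_map (arr_top G) euclidean (adj f)"
    by (rule continuous_map_eq) (simp add: adj_eq)
  moreover have "compactin (arr_top G) (iv ` K)" using image_compactin[OF K(1) continuous_ginv] .
  moreover have "adj f x = 0" if "x \<notin> iv ` K" for x
    using that K(2)[of "iv x"] iv_iv[of x] by (cases "x \<in> A") (force simp: adj_eq adj_outside)+
  ultimately show ?thesis by (intro CcI[OF Hausdorff])
qed

text \<open>With \<open>w = z \<cdot> y\<close> both sides become the same finite double sum over \<open>y\<close> in the support of \<^term>\<open>h\<close> and \<open>w\<close> in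
  the product of the supports of \<^term>\<open>g\<close> and \<^term>\<open>h\<close>; the scalars agree by the cocycle identity for
  \<open>x \<cdot> w\<inverse>\<close>, \<open>w \<cdot> y\<inverse>\<close>, \<open>y\<close>.\<close>

lemma conv_assoc:
  assumes f: "f \<in> CcG" and g: "g \<in> CcG" and h: "h \<in> CcG"
  shows "conv (conv f g) h = conv f (conv g h)"
proof
  fix x show "conv (conv f g) h x = conv f (conv g h) x"
  proof (cases "x \<in> A")
    case x: True
    define H where "H = {y \<in> A. s y = s x \<and> h y \<noteq> 0}"
    define Gy where "Gy y = {z \<in> A. s z = r y \<and> g z \<noteq> 0}" for y
    define W where "W = (\<Union>y\<in>H. (\<lambda>z. z \<cdot> y) ` Gy y)"
    have finH: "finite H" unfolding H_def by (rule finite_src_support[OF h])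
    have "finite (Gy y)" for y unfolding Gy_def by (rule finite_src_support[OF g])
    then have finW: "finite W" using finH by (auto simp: W_def)
    have H: "y \<in> A" "s y = s x" if "y \<in> H" for y using that by (auto simp: H_def)
    have W: "w \<in> A" "s w = s x" if "w \<in> W" for w using that H by (auto simp: W_def Gy_def)
    have WI: "w \<in> W" if "w \<in> A" "s w = s x" "y \<in> H" "g (w \<cdot> iv y) \<noteq> 0" for w y
    proof -
      have "w \<cdot> iv y \<in> Gy y" "w = (w \<cdot> iv y) \<cdot> y" using that H[of y] right_cancel_iv by (auto simp: Gy_def)
      then show ?thesis using that(3) by (auto simp: W_def)
    qed
    have fg: "conv f g (x \<cdot> iv y) = (\<Sum>w\<in>W. \<omega> (x \<cdot> iv w, w \<cdot> iv y) * f (x \<cdot> iv w) * g (w \<cdot> iv y))"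
      if y: "y \<in> H" for y
    proof -
      note Hy = H[OF y]
      have inj: "inj_on (\<lambda>w. w \<cdot> iv y) W"
        using W Hy by (intro inj_on_inverseI[of _ "\<lambda>z. z \<cdot> y"]) (simp add: right_cancel_iv)
      have "conv f g (x \<cdot> iv y) = (\<Sum>z\<in>(\<lambda>w. w \<cdot> iv y) ` W.
          \<omega> (x \<cdot> iv y \<cdot> iv z, z) * f (x \<cdot> iv y \<cdot> iv z) * g z)"
      proof (rule conv_eq_sum)
        fix z assume z: "z \<in> A" "s z = s (x \<cdot> iv y)" "z \<notin> (\<lambda>w. w \<cdot> iv y) ` W"
        have zy: "s z = r y" using z(2) x Hy by simp
        have "z = (z \<cdot> y) \<cdot> iv y" using z zy Hy right_cancel by simp
        moreover have "z \<cdot> y \<in> W" if "g z \<noteq> 0"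
          using that z zy Hy y right_cancel by (intro WI[OF _ _ y]) auto
        ultimately show "f (x \<cdot> iv y \<cdot> iv z) = 0 \<or> g z = 0" using z(3) by blast
      qed (use x Hy W finW in auto)
      also have "\<dots> = (\<Sum>w\<in>W. \<omega> (x \<cdot> iv y \<cdot> iv (w \<cdot> iv y), w \<cdot> iv y) * f (x \<cdot> iv y \<cdot> iv (w \<cdot> iv y)) * g (w \<cdot> iv y))"
        by (simp add: sum.reindex[OF inj])
      also have "\<dots> = (\<Sum>w\<in>W. \<omega> (x \<cdot> iv w, w \<cdot> iv y) * f (x \<cdot> iv w) * g (w \<cdot> iv y))"
      proof (rule sum.cong[OF refl])
        fix w assume w: "w \<in> W"
        have "x \<cdot> iv y \<cdot> iv (w \<cdot> iv y) = x \<cdot> iv w"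
          using x Hy W[OF w] assoc[of "x \<cdot> iv y" y "iv w"] by (simp add: iv_prd right_cancel_iv)
        then show "\<omega> (x \<cdot> iv y \<cdot> iv (w \<cdot> iv y), w \<cdot> iv y) * f (x \<cdot> iv y \<cdot> iv (w \<cdot> iv y)) * g (w \<cdot> iv y)
          = \<omega> (x \<cdot> iv w, w \<cdot> iv y) * f (x \<cdot> iv w) * g (w \<cdot> iv y)" by simp
      qed
      finally show ?thesis .
    qed
    have gh: "conv g h w = (\<Sum>y\<in>H. \<omega> (w \<cdot> iv y, y) * g (w \<cdot> iv y) * h y)" if w: "w \<in> A" "s w = s x" for w
      using w finH by (intro conv_eq_sum) (auto simp: H_def)
    have "conv (conv f g) h x = (\<Sum>y\<in>H. \<omega> (x \<cdot> iv y, y) * conv f g (x \<cdot> iv y) * h y)"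
      using x finH by (intro conv_eq_sum) (auto simp: H_def)
    also have "\<dots> = (\<Sum>y\<in>H. \<Sum>w\<in>W. (\<omega> (x \<cdot> iv w, w \<cdot> iv y) * \<omega> (x \<cdot> iv y, y)) * f (x \<cdot> iv w) * g (w \<cdot> iv y) * h y)"
      by (rule sum.cong[OF refl]) (simp add: fg sum_distrib_left sum_distrib_right mult_ac)
    also have "\<dots> = (\<Sum>y\<in>H. \<Sum>w\<in>W. (\<omega> (x \<cdot> iv w, w) * \<omega> (w \<cdot> iv y, y)) * f (x \<cdot> iv w) * g (w \<cdot> iv y) * h y)"
    proof (intro sum.cong[OF refl])
      fix y w assume y: "y \<in> H" and w: "w \<in> W"
      have "x \<cdot> iv w \<cdot> (w \<cdot> iv y) = x \<cdot> iv y"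
        using x H[OF y] W[OF w] assoc[of "x \<cdot> iv w" w "iv y"] by (simp add: right_cancel_iv)
      then have "\<omega> (x \<cdot> iv w, w \<cdot> iv y) * \<omega> (x \<cdot> iv y, y) = \<omega> (x \<cdot> iv w, w) * \<omega> (w \<cdot> iv y, y)"
        using cocycle_id[of "x \<cdot> iv w" "w \<cdot> iv y" y] x H[OF y] W[OF w] by (simp add: right_cancel_iv)
      then show "(\<omega> (x \<cdot> iv w, w \<cdot> iv y) * \<omega> (x \<cdot> iv y, y)) * f (x \<cdot> iv w) * g (w \<cdot> iv y) * h y
        = (\<omega> (x \<cdot> iv w, w) * \<omega> (w \<cdot> iv y, y)) * f (x \<cdot> iv w) * g (w \<cdot> iv y) * h y" by simp
    qed
    also have "\<dots> = (\<Sum>w\<in>W. \<omega> (x \<cdot> iv w, w) * f (x \<cdot> iv w) * conv g h w)"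
      by (subst sum.swap) (simp add: gh W sum_distrib_left mult_ac)
    also have "\<dots> = conv f (conv g h) x"
    proof (rule conv_eq_sum[symmetric])
      fix w assume w: "w \<in> A" "s w = s x" "w \<notin> W"
      have "conv g h w = 0" unfolding gh[OF w(1,2)]
        by (rule sum.neutral) (use WI[OF w(1,2)] w(3) in auto)
      then show "f (x \<cdot> iv w) = 0 \<or> conv g h w = 0" ..
    qed (use x W finW in auto)
    finally show ?thesis .
  qed (simp add: conv_outside)
qed

lemma adj_adj: "f \<in> CcG \<Longrightarrow> adj (adj f) = f"
proof
  fix x assume f: "f \<in> CcG"
  show "adj (adj f) x = f x"
  proof (cases "x \<in> A")
    case True
    have "\<omega> (x, iv x) = \<omega> (iv x, x)"
      using cocycle_id[of x "iv x" x] cocycle_norm[of x] True by simp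
    then show ?thesis using True cocycle_unimodular[of "iv x" x] by (simp add: adj_eq algebra_simps)
  qed (use f in \<open>simp add: adj_outside Cc_outside\<close>)
qed

lemma cocycle_iv: "x \<in> A \<Longrightarrow> \<omega> (x, iv x) = \<omega> (iv x, x)"
  using cocycle_id[of x "iv x" x] cocycle_norm[of x] by simp

text \<open>The scalar identity behind the antimultiplicativity of the involution; it combines four
  instances of the cocycle identity.\<close>

lemma cocycle_adj_identity:
  assumes "x \<in> A" "y \<in> A" "s y = r x"
  shows "\<omega> (iv y, y \<cdot> x) * \<omega> (x, iv x) * \<omega> (iv x \<cdot> iv y, y) = \<omega> (iv y, y) * \<omega> (y \<cdot> x, iv x \<cdot> iv y)"
proof -
  have c1: "\<omega> (iv y, y) = \<omega> (iv y, y \<cdot> x) * \<omega> (y, x)"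
    using cocycle_id[of "iv y" y x] cocycle_norm[of x] assms by simp
  have l: "x \<cdot> (iv x \<cdot> iv y) = iv y"
    using assms left_cancel[of "iv x" "iv y"] by simp
  have c2: "\<omega> (y, x) * \<omega> (y \<cdot> x, iv x \<cdot> iv y) = \<omega> (y, iv y) * \<omega> (x, iv x \<cdot> iv y)"
    using cocycle_id[of y x "iv x \<cdot> iv y"] l assms by simp
  have l2: "iv x \<cdot> iv y \<cdot> y = iv x" using assms right_cancel_iv[of "iv x" y] by simp
  have c3: "\<omega> (x, iv x \<cdot> iv y) * \<omega> (iv y, y) = \<omega> (x, iv x) * \<omega> (iv x \<cdot> iv y, y)"
    using cocycle_id[of x "iv x \<cdot> iv y" y] l l2 assms by simp
  have nz: "\<omega> (y, x) \<noteq> 0" using cocycle_unimodular[of y x] assms by simp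
  have "\<omega> (y, x) * (\<omega> (iv y, y \<cdot> x) * \<omega> (x, iv x) * \<omega> (iv x \<cdot> iv y, y))
      = \<omega> (iv y, y) * (\<omega> (x, iv x) * \<omega> (iv x \<cdot> iv y, y))" using c1 by simp
  also have "\<dots> = \<omega> (iv y, y) * (\<omega> (y, x) * \<omega> (y \<cdot> x, iv x \<cdot> iv y))"
    unfolding c2 c3[symmetric] cocycle_iv[OF assms(2)] by simp
  finally show ?thesis using nz by (simp add: mult.assoc)
qed

text \<open>The substitution is \<open>z = y \<cdot> x\<close>, a bijection between the source fibres of the range and of the source of
  \<open>x\<close>.\<close>

lemma adj_conv:
  assumes f: "f \<in> CcG" and g: "g \<in> CcG"
  shows "adj (conv f g) = conv (adj g) (adj f)"
proof
  fix x show "adj (conv f g) x = conv (adj g) (adj f) x"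
  proof (cases "x \<in> A")
    case x: True
    define S where "S = {y \<in> A. s y = r x \<and> g y \<noteq> 0}"
    have fin: "finite S" unfolding S_def by (rule finite_src_support[OF g])
    have S: "y \<in> A" "s y = r x" if "y \<in> S" for y using that by (auto simp: S_def)
    have inj: "inj_on (\<lambda>y. y \<cdot> x) S"
      using x S by (intro inj_on_inverseI[of _ "\<lambda>z. z \<cdot> iv x"]) (simp add: right_cancel)
    have L: "conv f g (iv x) = (\<Sum>y\<in>S. \<omega> (iv x \<cdot> iv y, y) * f (iv x \<cdot> iv y) * g y)"
      using x fin by (intro conv_eq_sum) (auto simp: S_def)
    have "conv (adj g) (adj f) x = (\<Sum>z\<in>(\<lambda>y. y \<cdot> x) ` S. \<omega> (x \<cdot> iv z, z) * adj g (x \<cdot> iv z) * adj f z)"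
    proof (rule conv_eq_sum)
      fix z assume z: "z \<in> A" "s z = s x" "z \<notin> (\<lambda>y. y \<cdot> x) ` S"
      have "z = z \<cdot> iv x \<cdot> x" using z x right_cancel_iv by simp
      then have "z \<cdot> iv x \<notin> S" using z(3) by blast
      then have "g (z \<cdot> iv x) = 0" using z x by (auto simp: S_def)
      then show "adj g (x \<cdot> iv z) = 0 \<or> adj f z = 0" using z x by (simp add: adj_eq iv_prd)
    qed (use x S fin in auto)
    also have "\<dots> = (\<Sum>y\<in>S. \<omega> (x \<cdot> iv (y \<cdot> x), y \<cdot> x) * adj g (x \<cdot> iv (y \<cdot> x)) * adj f (y \<cdot> x))"
      by (simp add: sum.reindex[OF inj])
    also have "\<dots> = (\<Sum>y\<in>S. cnj (\<omega> (x, iv x)) * cnj (\<omega> (iv x \<cdot> iv y, y) * f (iv x \<cdot> iv y) * g y))"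
    proof (rule sum.cong[OF refl])
      fix y assume "y \<in> S"
      note y = S[OF this]
      have l: "x \<cdot> (iv x \<cdot> iv y) = iv y"
        using x y left_cancel[of "iv x" "iv y"] by simp
      let ?a = "\<omega> (iv y, y \<cdot> x)" let ?b = "\<omega> (iv y, y)" let ?c = "\<omega> (y \<cdot> x, iv x \<cdot> iv y)"
      let ?d = "\<omega> (x, iv x)" let ?e = "\<omega> (iv x \<cdot> iv y, y)"
      have id: "?a * ?d * ?e = ?b * ?c" using cocycle_adj_identity[of x y] x y by simp
      have b: "?b * cnj ?b = 1" and c: "?c * cnj ?c = 1" and d: "?d * cnj ?d = 1" and e: "?e * cnj ?e = 1"
        using cocycle_unimodular[of "iv y" y] cocycle_unimodular[of "y \<cdot> x" "iv x \<cdot> iv y"]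
          cocycle_unimodular[of x "iv x"] cocycle_unimodular[of "iv x \<cdot> iv y" y] x y by simp_all
      have "?a * cnj ?b * cnj ?c = (?a * ?d * ?e) * (cnj ?d * cnj ?e) * (cnj ?b * cnj ?c)"
        using d e by (simp add: mult_ac)
      also have "\<dots> = (?b * cnj ?b) * (?c * cnj ?c) * (cnj ?d * cnj ?e)" unfolding id by (simp add: mult_ac)
      also have "\<dots> = cnj ?d * cnj ?e" using b c by simp
      finally have scal: "?a * cnj ?b * cnj ?c = cnj ?d * cnj ?e" .
      have "\<omega> (x \<cdot> iv (y \<cdot> x), y \<cdot> x) * adj g (x \<cdot> iv (y \<cdot> x)) * adj f (y \<cdot> x)
        = (?a * cnj ?b * cnj ?c) * (cnj (g y) * cnj (f (iv x \<cdot> iv y)))"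
        using x y by (simp add: iv_prd l adj_eq mult_ac)
      also have "\<dots> = cnj ?d * cnj (?e * f (iv x \<cdot> iv y) * g y)"
        unfolding scal by (simp add: mult_ac)
      finally show "\<omega> (x \<cdot> iv (y \<cdot> x), y \<cdot> x) * adj g (x \<cdot> iv (y \<cdot> x)) * adj f (y \<cdot> x)
        = cnj ?d * cnj (?e * f (iv x \<cdot> iv y) * g y)" .
    qed
    also have "\<dots> = adj (conv f g) x"
      using x L by (simp add: adj_eq sum_distrib_left)
    finally show ?thesis ..
  qed (simp add: conv_outside adj_outside)
qed

lemma conv_add_left: "h \<in> CcG \<Longrightarrow> conv (\<lambda>x. f x + g x) h = (\<lambda>x. conv f h x + conv g h x)"
proof
  fix x assume h: "h \<in> CcG"
  show "conv (\<lambda>x. f x + g x) h x = conv f h x + conv g h x"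
    by (cases "x \<in> A") (simp_all add: conv_outside conv_eq_sum_support h algebra_simps sum.distrib)
qed

lemma conv_add_right:
  assumes "g \<in> CcG" "h \<in> CcG"
  shows "conv f (\<lambda>x. g x + h x) = (\<lambda>x. conv f g x + conv f h x)"
proof
  fix x show "conv f (\<lambda>x. g x + h x) x = conv f g x + conv f h x"
  proof (cases "x \<in> A")
    case x: True
    let ?S = "{y \<in> A. s y = s x \<and> g y \<noteq> 0} \<union> {y \<in> A. s y = s x \<and> h y \<noteq> 0}"
    have "finite ?S" using assms finite_src_support by blast
    then have "conv f k x = (\<Sum>y\<in>?S. \<omega> (x \<cdot> iv y, y) * f (x \<cdot> iv y) * k y)"
      if "k \<in> {g, h, \<lambda>x. g x + h x}" for k
      using that x by (intro conv_eq_sum) auto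
    then show ?thesis by (simp add: algebra_simps sum.distrib)
  qed (simp add: conv_outside)
qed

lemma conv_scale_left: "h \<in> CcG \<Longrightarrow> conv (\<lambda>x. c * f x) h = (\<lambda>x. c * conv f h x)"
proof
  fix x assume h: "h \<in> CcG"
  show "conv (\<lambda>x. c * f x) h x = c * conv f h x"
    by (cases "x \<in> A") (simp_all add: conv_outside conv_eq_sum_support h sum_distrib_left mult_ac)
qed

text \<open>A factor that depends only on the range of an arrow can be pulled out of the left argument of a
  convolution, and one that depends only on the source out of the right argument. Functions of the base
  point of a field of groupoids are of both kinds.\<close>

lemma conv_invariant_left:
  assumes "g \<in> CcG" "\<And>x. x \<in> A \<Longrightarrow> b (r x) = b x"
  shows "conv (\<lambda>x. b x * f x) g = (\<lambda>x. b x * conv f g x)"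
proof
  fix x show "conv (\<lambda>x. b x * f x) g x = b x * conv f g x"
  proof (cases "x \<in> A")
    case x: True
    have "b (x \<cdot> iv y) = b x" if "y \<in> A" "s y = s x" for y
      using assms(2)[of "x \<cdot> iv y"] assms(2)[of x] that x by simp
    then show ?thesis using x assms(1) by (simp add: conv_eq_sum_support sum_distrib_left mult_ac)
  qed (simp add: conv_outside)
qed

lemma conv_invariant_right:
  assumes "g \<in> CcG" "\<And>x. x \<in> A \<Longrightarrow> b (s x) = b x"
  shows "conv f (\<lambda>x. b x * g x) = (\<lambda>x. b x * conv f g x)"
proof
  fix x show "conv f (\<lambda>x. b x * g x) x = b x * conv f g x"
  proof (cases "x \<in> A")
    case x: True
    have b: "b y = b x" if "y \<in> A" "s y = s x" for y
      using assms(2)[of y] assms(2)[of x] that x by simp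
    let ?S = "{y \<in> A. s y = s x \<and> g y \<noteq> 0}"
    have "conv f (\<lambda>x. b x * g x) x = (\<Sum>y\<in>?S. \<omega> (x \<cdot> iv y, y) * f (x \<cdot> iv y) * (b y * g y))"
      using x finite_src_support[OF assms(1)] by (intro conv_eq_sum) auto
    also have "\<dots> = (\<Sum>y\<in>?S. b x * (\<omega> (x \<cdot> iv y, y) * f (x \<cdot> iv y) * g y))"
      by (rule sum.cong) (auto simp: b)
    finally show ?thesis using x assms(1) by (simp add: conv_eq_sum_support sum_distrib_left)
  qed (simp add: conv_outside)
qed

lemma conv_scale_right: "h \<in> CcG \<Longrightarrow> conv f (\<lambda>x. c * h x) = (\<lambda>x. c * conv f h x)"
  using conv_invariant_right[of h "\<lambda>_. c"] by simp

lemma adj_add: "adj (\<lambda>x. f x + g x) = (\<lambda>x. adj f x + adj g x)"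
proof
  fix x show "adj (\<lambda>x. f x + g x) x = adj f x + adj g x"
    by (cases "x \<in> A") (simp_all add: adj_eq adj_outside algebra_simps)
qed

lemma adj_scale: "adj (\<lambda>x. c * f x) = (\<lambda>x. cnj c * adj f x)"
proof
  fix x show "adj (\<lambda>x. c * f x) x = cnj c * adj f x"
    by (cases "x \<in> A") (simp_all add: adj_eq adj_outside)
qed

lemma cmod_adj: "x \<in> A \<Longrightarrow> cmod (adj f x) = cmod (f (iv x))"
  by (simp add: adj_eq norm_mult cocycle_cmod)

text \<open>The inner product of the regular representation at a unit is given by the convolution
  algebra itself.\<close>

lemma conv_adj_unit:
  assumes "u \<in> units G" "finite S" "\<And>y. y \<in> S \<Longrightarrow> y \<in> A \<and> s y = u"
    and "\<And>y. y \<in> A \<Longrightarrow> s y = u \<Longrightarrow> y \<notin> S \<Longrightarrow> h y = 0 \<or> k y = 0"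
  shows "conv (adj h) k u = (\<Sum>y\<in>S. cnj (h y) * k y)"
proof -
  have u: "u \<in> A" "s u = u" using assms(1) by (auto simp: units_iff)
  have *: "adj h (u \<cdot> iv y) = cnj (\<omega> (iv y, y)) * cnj (h y)" "\<omega> (u \<cdot> iv y, y) = \<omega> (iv y, y)" 
    if "y \<in> A" "s y = u" for y
    using that assms(1) by (simp_all add: src_iv_unit adj_eq)
  have "conv (adj h) k u = (\<Sum>y\<in>S. \<omega> (u \<cdot> iv y, y) * adj h (u \<cdot> iv y) * k y)"
    by (rule conv_eq_sum) (use assms u * in auto)
  also have "\<dots> = (\<Sum>y\<in>S. cnj (h y) * k y)"
  proof (rule sum.cong[OF refl])
    fix y assume "y \<in> S"
    then have y: "y \<in> A" "s y = u" using assms(3) by auto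
    then show "\<omega> (u \<cdot> iv y, y) * adj h (u \<cdot> iv y) * k y = cnj (h y) * k y"
      using cocycle_unimodular(1)[of "iv y" y] by (simp add: * mult.assoc[symmetric])
  qed
  finally show ?thesis .
qed

text \<open>A bump function supported in an open set on which the source map is injective restricts to a point
  mass on the source fibre. Linear combinations then extend every finitely supported function on a
  source fibre.\<close>

lemma point_bump:
  assumes "x \<in> A"
  obtains b where "b \<in> CcG" "b x = 1" "\<And>y. y \<in> A \<Longrightarrow> s y = s x \<Longrightarrow> y \<noteq> x \<Longrightarrow> b y = 0"
proof -
  obtain U \<sigma> where U: "openin (arr_top G) U" "x \<in> U" "\<And>u. u \<in> U \<Longrightarrow> \<sigma> (s u) = u"
    using local_homeomorphism_section[OF src_local_homeo assms] by metis
  obtain \<theta> L where \<theta>: "continuous_map (arr_top G) euclideanreal \<theta>" "compactin (arr_top G) L"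
    "\<And>y. y \<in> {x} \<Longrightarrow> \<theta> y = 1" "\<And>y. y \<notin> U \<Longrightarrow> \<theta> y = 0" "\<And>y. y \<notin> L \<Longrightarrow> \<theta> y = 0"
    by (rule compact_open_bump[OF locally_compact Hausdorff _ U(1), of "{x}"]) (use assms U(2) in auto)
  show ?thesis
  proof (rule that[of "\<lambda>y. complex_of_real (\<theta> y)"])
    show "(\<lambda>y. complex_of_real (\<theta> y)) \<in> CcG"
      by (rule CcI[OF Hausdorff continuous_map_complex_of_real[OF \<theta>(1)] \<theta>(2)]) (simp add: \<theta>)
    show "complex_of_real (\<theta> y) = 0" if "y \<in> A" "s y = s x" "y \<noteq> x" for y
    proof -
      have "y \<notin> U" using U(3)[of y] U(3)[of x] U(2) that by metis
      then show ?thesis using \<theta> by simp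
    qed
  qed (simp add: \<theta>)
qed

lemma extend_finite_support:
  assumes "finite S" "\<And>x. x \<in> S \<Longrightarrow> x \<in> A \<and> s x = u" "\<And>x. x \<notin> S \<Longrightarrow> \<xi> x = 0"
  obtains h where "h \<in> CcG" "\<And>x. x \<in> A \<Longrightarrow> s x = u \<Longrightarrow> h x = \<xi> x"
proof -
  have "\<exists>h\<in>CcG. \<forall>x\<in>A. s x = u \<longrightarrow> h x = (if x \<in> S then \<xi> x else 0)"
    using assms(1,2)
  proof (induction S rule: finite_induct)
    case empty
    then show ?case using Cc_zero[of "arr_top G"] by (intro bexI[of _ "\<lambda>_. 0"]) auto
  next
    case (insert a S)
    then obtain h where h: "h \<in> CcG" "\<forall>x\<in>A. s x = u \<longrightarrow> h x = (if x \<in> S then \<xi> x else 0)" by auto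
    have a: "a \<in> A" "s a = u" using insert.prems by auto
    obtain b where b: "b \<in> CcG" "b a = 1" "\<And>y. y \<in> A \<Longrightarrow> s y = s a \<Longrightarrow> y \<noteq> a \<Longrightarrow> b y = 0"
      using point_bump[OF a(1)] by blast
    show ?case
    proof (intro bexI[of _ "\<lambda>x. h x + \<xi> a * b x"] ballI impI)
      fix x assume x: "x \<in> A" "s x = u"
      show "h x + \<xi> a * b x = (if x \<in> insert a S then \<xi> x else 0)"
        using h(2) x b(2) b(3)[of x] a insert.hyps by (cases "x = a") auto
    qed (intro Cc_add Cc_scale Hausdorff h b)
  qed
  then show ?thesis using assms(3) that by (metis (full_types))
qed

end

section \<open>The reduced norm as a supremum over compactly supported functions\<close>

context twisted_etale_groupoid
begin

abbreviation l2norm :: "'a \<Rightarrow> ('a \<Rightarrow> complex) \<Rightarrow> real" where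
  "l2norm u h \<equiv> ell2_norm (src_fibre G u) h"

abbreviation opnorm :: "'a \<Rightarrow> ('a \<Rightarrow> complex) \<Rightarrow> ennreal" where
  "opnorm u f \<equiv> ell2_opnorm (src_fibre G u) (regular_rep G \<omega> u f)"

lemma l2norm_eq_L2_set:
  assumes "finite S" "S \<subseteq> src_fibre G u" "\<And>x. x \<in> A \<Longrightarrow> s x = u \<Longrightarrow> x \<notin> S \<Longrightarrow> h x = 0"
  shows "l2norm u h = L2_set (\<lambda>x. cmod (h x)) S"
  unfolding ell2_norm_def L2_set_def
  by (subst infsum_eq_finite_sum[OF assms(1,2)]) (use assms(3) in auto)

lemma l2norm_eq_support:
  assumes "h \<in> CcG"
  shows "l2norm u h = L2_set (\<lambda>x. cmod (h x)) {x \<in> A. s x = u \<and> h x \<noteq> 0}"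
  by (rule l2norm_eq_L2_set) (use finite_src_support[OF assms] in auto)

lemma l2norm_nonneg: "0 \<le> l2norm u h"
  unfolding ell2_norm_def by (simp add: infsum_nonneg)

lemma l2norm_cong: "(\<And>x. x \<in> A \<Longrightarrow> s x = u \<Longrightarrow> cmod (h x) = cmod (k x)) \<Longrightarrow> l2norm u h = l2norm u k"
  unfolding ell2_norm_def by (rule arg_cong[where f=sqrt]) (auto intro: infsum_cong)

lemma l2norm_scale: "l2norm u (\<lambda>x. c * h x) = cmod c * l2norm u h"
proof -
  have "(\<Sum>\<^sub>\<infinity>x\<in>src_fibre G u. (cmod (c * h x))\<^sup>2) = (cmod c)\<^sup>2 * (\<Sum>\<^sub>\<infinity>x\<in>src_fibre G u. (cmod (h x))\<^sup>2)"
    by (simp add: norm_mult power_mult_distrib infsum_cmult_right')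
  then show ?thesis by (simp add: ell2_norm_def real_sqrt_mult)
qed

lemma l2norm_add_le:
  assumes "h \<in> CcG" "k \<in> CcG" shows "l2norm u (\<lambda>x. h x + k x) \<le> l2norm u h + l2norm u k"
proof -
  let ?S = "{x \<in> A. s x = u \<and> h x \<noteq> 0} \<union> {x \<in> A. s x = u \<and> k x \<noteq> 0}"
  have fin: "finite ?S" using assms finite_src_support by blast
  have eq: "l2norm u f = L2_set (\<lambda>x. cmod (f x)) ?S" if "f \<in> {h, k, \<lambda>x. h x + k x}" for f
    by (rule l2norm_eq_L2_set[OF fin]) (use that in auto)
  have "L2_set (\<lambda>x. cmod (h x + k x)) ?S \<le> L2_set (\<lambda>x. cmod (h x) + cmod (k x)) ?S"
    by (rule L2_set_mono) (auto intro: norm_triangle_ineq)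
  also have "\<dots> \<le> L2_set (\<lambda>x. cmod (h x)) ?S + L2_set (\<lambda>x. cmod (k x)) ?S"
    by (rule L2_set_triangle_ineq)
  finally show ?thesis by (simp add: eq)
qed

lemma l2norm_eq_0:
  assumes "h \<in> CcG" "l2norm u h = 0" "x \<in> A" "s x = u" shows "h x = 0"
proof (rule ccontr)
  assume "h x \<noteq> 0"
  then have "cmod (h x) \<le> l2norm u h"
    unfolding l2norm_eq_support[OF assms(1)]
    by (intro member_le_L2_set) (use assms finite_src_support in auto)
  then show False using assms(2) \<open>h x \<noteq> 0\<close> by simp
qed

lemma l2norm_square:
  assumes "u \<in> units G" "h \<in> CcG" shows "complex_of_real ((l2norm u h)\<^sup>2) = conv (adj h) h u"
proof -
  let ?S = "{x \<in> A. s x = u \<and> h x \<noteq> 0}"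
  have "conv (adj h) h u = (\<Sum>y\<in>?S. cnj (h y) * h y)"
    by (rule conv_adj_unit) (use assms finite_src_support in auto)
  also have "\<dots> = complex_of_real (\<Sum>y\<in>?S. (cmod (h y))\<^sup>2)"
    by (simp add: complex_norm_square mult.commute del: of_real_power)
  finally show ?thesis unfolding l2norm_eq_support[OF assms(2)] L2_set_def
    by (simp add: sum_nonneg)
qed

lemma conv_adj_le:
  assumes "u \<in> units G" "h \<in> CcG" "k \<in> CcG" shows "cmod (conv (adj h) k u) \<le> l2norm u h * l2norm u k"
proof -
  let ?S = "{x \<in> A. s x = u \<and> h x \<noteq> 0} \<union> {x \<in> A. s x = u \<and> k x \<noteq> 0}"
  have fin: "finite ?S" using assms finite_src_support by blast
  have eq: "l2norm u f = L2_set (\<lambda>x. cmod (f x)) ?S" if "f \<in> {h, k}" for f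
    by (rule l2norm_eq_L2_set[OF fin]) (use that in auto)
  have "conv (adj h) k u = (\<Sum>y\<in>?S. cnj (h y) * k y)"
    by (rule conv_adj_unit[OF assms(1) fin]) auto
  then have "cmod (conv (adj h) k u) \<le> (\<Sum>y\<in>?S. \<bar>cmod (h y)\<bar> * \<bar>cmod (k y)\<bar>)"
    using norm_sum[of "\<lambda>y. cnj (h y) * k y" ?S] by (simp add: norm_mult)
  also have "\<dots> \<le> L2_set (\<lambda>x. cmod (h x)) ?S * L2_set (\<lambda>x. cmod (k x)) ?S"
    by (rule L2_set_mult_ineq)
  finally show ?thesis by (simp add: eq)
qed

lemma continuous_l2norm_square:
  assumes "h \<in> CcG"
  obtains \<phi> K where "continuous_map (arr_top G) euclideanreal \<phi>" "compactin (arr_top G) K"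
    "\<And>x. x \<notin> K \<Longrightarrow> \<phi> x = 0" "\<And>u. u \<in> units G \<Longrightarrow> (l2norm u h)\<^sup>2 = \<phi> u"
proof -
  have c: "conv (adj h) h \<in> CcG" by (intro conv_Cc adj_Cc assms)
  obtain K where K: "compactin (arr_top G) K" "\<And>x. x \<notin> K \<Longrightarrow> conv (adj h) h x = 0"
    using Cc_support[OF Hausdorff c] by blast
  show ?thesis
  proof (rule that[OF _ K(1)])
    show "continuous_map (arr_top G) euclideanreal (\<lambda>x. Re (conv (adj h) h x))"
      using Cc_continuous[OF c] by (simp add: continuous_map_atin tendsto_Re)
    show "(l2norm u h)\<^sup>2 = Re (conv (adj h) h u)" if "u \<in> units G" for u
      by (simp flip: l2norm_square[OF that assms])
  qed (simp add: K)
qed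

lemma regular_rep_eq_conv:
  assumes "\<And>x. x \<in> A \<Longrightarrow> s x = u \<Longrightarrow> \<xi> x = h x" "x \<in> A" "s x = u"
  shows "regular_rep G \<omega> u f \<xi> x = conv f h x"
proof -
  have "(\<Sum>\<^sub>\<infinity>y\<in>src_fibre G u. \<omega> (x \<cdot> iv y, y) * f (x \<cdot> iv y) * \<xi> y)
      = (\<Sum>\<^sub>\<infinity>y\<in>src_fibre G u. \<omega> (x \<cdot> iv y, y) * f (x \<cdot> iv y) * h y)"
    by (rule infsum_cong) (use assms(1) in auto)
  then show ?thesis using assms(2,3) by (simp add: regular_rep_def twisted_conv_def restrict0_def)
qed

text \<open>The regular representation acts on the restriction of \<^term>\<open>h\<close> to the source fibre by convolution.\<close>

lemma l2norm_conv_le_opnorm: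
  assumes "h \<in> CcG" "l2norm u h \<le> 1" shows "ennreal (l2norm u (conv f h)) \<le> opnorm u f"
proof -
  let ?\<xi> = "restrict0 h (src_fibre G u)"
  have eq: "l2norm u ?\<xi> = l2norm u h" by (rule l2norm_cong) (simp add: restrict0_def)
  have "(\<lambda>x. (cmod (?\<xi> x))\<^sup>2) summable_on src_fibre G u"
  proof -
    have "(\<lambda>x. (cmod (?\<xi> x))\<^sup>2) summable_on {x \<in> A. s x = u \<and> h x \<noteq> 0}"
      using finite_src_support[OF assms(1)] by (rule summable_on_finite)
    then show ?thesis
      by (rule summable_on_cong_neutral[THEN iffD1, rotated -1]) (auto simp: restrict0_def)
  qed
  then have "?\<xi> \<in> {\<xi> \<in> ell2 (src_fibre G u). l2norm u \<xi> \<le> 1}"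
    using assms(2) eq by (auto simp: ell2_def restrict0_def)
  moreover have "l2norm u (regular_rep G \<omega> u f ?\<xi>) = l2norm u (conv f h)"
    by (rule l2norm_cong) (simp add: regular_rep_eq_conv restrict0_def)
  ultimately show ?thesis unfolding ell2_opnorm_def by (metis (mono_tags, lifting) SUP_upper)
qed

text \<open>The rows of the matrix of \<^term>\<open>f\<close> in the regular representation are finite. Hence finitely
  many values of the image of an \<open>\<ell>\<^sup>2\<close>-vector depend on a finite part of the vector only, and that
  part extends to a compactly supported function.\<close>

lemma opnorm_le:
  assumes f: "f \<in> CcG" and B: "0 \<le> B" and le: "\<And>h. h \<in> CcG \<Longrightarrow> l2norm u (conv f h) \<le> B * l2norm u h"
  shows "opnorm u f \<le> ennreal B"
  unfolding ell2_opnorm_def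
proof (rule SUP_least, rule ennreal_leI)
  fix \<xi> assume "\<xi> \<in> {\<xi> \<in> ell2 (src_fibre G u). l2norm u \<xi> \<le> 1}"
  then have summ: "(\<lambda>x. (cmod (\<xi> x))\<^sup>2) summable_on src_fibre G u" and n1: "l2norm u \<xi> \<le> 1"
    by (auto simp: ell2_def)
  have xi1: "(\<Sum>\<^sub>\<infinity>x\<in>src_fibre G u. (cmod (\<xi> x))\<^sup>2) \<le> 1"
    using n1 by (simp add: ell2_norm_def)
  let ?R = "regular_rep G \<omega> u f \<xi>"
  have fin_le: "(\<Sum>x\<in>X. (cmod (?R x))\<^sup>2) \<le> B\<^sup>2" if X: "finite X" "X \<subseteq> src_fibre G u" for X
  proof -
    define Y where "Y = (\<Union>x\<in>X. (\<lambda>w. w \<cdot> x) ` {w \<in> A. s w = r x \<and> adj f w \<noteq> 0})"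
    have finY: "finite Y" unfolding Y_def
      using X finite_src_support[OF adj_Cc[OF f]] by blast
    have Y: "y \<in> A \<and> s y = u" if "y \<in> Y" for y using that X(2) by (auto simp: Y_def)
    have YI: "y \<in> Y" if "x \<in> X" "y \<in> A" "s y = u" "f (x \<cdot> iv y) \<noteq> 0" for x y
    proof -
      have x: "x \<in> A" "s x = u" using X(2) that(1) by auto
      have "adj f (y \<cdot> iv x) \<noteq> 0"
        using x that cocycle_unimodular(3)[of "y \<cdot> iv x" "x \<cdot> iv y"] by (simp add: adj_eq iv_prd)
      moreover have "y = (y \<cdot> iv x) \<cdot> x" using x that right_cancel_iv by simp
      ultimately show ?thesis using x that by (auto simp: Y_def intro!: bexI[of _ x] image_eqI[of _ _ "y \<cdot> iv x"])
    qed
    obtain h where h: "h \<in> CcG" "\<And>x. x \<in> A \<Longrightarrow> s x = u \<Longrightarrow> h x = (if x \<in> Y then \<xi> x else 0)"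
      using extend_finite_support[OF finY Y, of "\<lambda>x. if x \<in> Y then \<xi> x else 0"] by auto
    have Rx: "?R x = conv f h x" if x: "x \<in> X" for x
    proof -
      have xA: "x \<in> A" "s x = u" using X(2) x by auto
      have "?R x = (\<Sum>\<^sub>\<infinity>y\<in>src_fibre G u. \<omega> (x \<cdot> iv y, y) * f (x \<cdot> iv y) * \<xi> y)"
        using xA by (simp add: regular_rep_def restrict0_def)
      also have "\<dots> = (\<Sum>\<^sub>\<infinity>y\<in>src_fibre G u. \<omega> (x \<cdot> iv y, y) * f (x \<cdot> iv y) * h y)"
        by (rule infsum_cong) (use YI[OF x] h(2) in auto)
      finally show ?thesis using xA by (simp add: twisted_conv_def restrict0_def)
    qed
    have c: "conv f h \<in> CcG" by (intro conv_Cc f h)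
    have hB: "l2norm u h \<le> 1"
    proof -
      have "(\<Sum>x\<in>Y. (cmod (h x))\<^sup>2) = (\<Sum>x\<in>Y. (cmod (\<xi> x))\<^sup>2)"
        by (rule sum.cong) (use Y h(2) in auto)
      also have "\<dots> \<le> (\<Sum>\<^sub>\<infinity>x\<in>src_fibre G u. (cmod (\<xi> x))\<^sup>2)"
        by (rule finite_sum_le_infsum[OF summ finY]) (use Y in auto)
      finally have "(\<Sum>x\<in>Y. (cmod (h x))\<^sup>2) \<le> 1" using xi1 by simp
      moreover have "l2norm u h = L2_set (\<lambda>x. cmod (h x)) Y"
        by (rule l2norm_eq_L2_set[OF finY]) (use Y h(2) in auto)
      ultimately show ?thesis by (simp add: L2_set_def)
    qed
    let ?Z = "X \<union> {x \<in> A. s x = u \<and> conv f h x \<noteq> 0}"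
    have finZ: "finite ?Z" using X finite_src_support[OF c] by blast
    have "(\<Sum>x\<in>X. (cmod (?R x))\<^sup>2) = (\<Sum>x\<in>X. (cmod (conv f h x))\<^sup>2)" by (simp add: Rx)
    also have "\<dots> \<le> (\<Sum>x\<in>?Z. (cmod (conv f h x))\<^sup>2)" by (rule sum_mono2[OF finZ]) auto
    also have "\<dots> = (l2norm u (conv f h))\<^sup>2"
    proof -
      have "l2norm u (conv f h) = L2_set (\<lambda>x. cmod (conv f h x)) ?Z"
        by (rule l2norm_eq_L2_set[OF finZ]) (use X in auto)
      then show ?thesis by (simp add: L2_set_def sum_nonneg)
    qed
    also have "\<dots> \<le> (B * 1)\<^sup>2"
      using le[OF h(1)] hB B by (intro power_mono l2norm_nonneg) (meson mult_left_mono order_trans)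
    finally show ?thesis by simp
  qed
  have "(\<Sum>\<^sub>\<infinity>x\<in>src_fibre G u. (cmod (?R x))\<^sup>2) \<le> B\<^sup>2"
  proof (cases "(\<lambda>x. (cmod (?R x))\<^sup>2) summable_on src_fibre G u")
    case True then show ?thesis by (rule infsum_le_finite_sums) (rule fin_le)
  qed (simp add: infsum_not_exists)
  then show "l2norm u ?R \<le> B" unfolding ell2_norm_def using B by (simp add: real_le_lsqrt real_sqrt_le_iff)
qed

end

text \<open>Under rapid decay, boundedness of the regular representations follows from the finiteness of the
  weighted \<open>\<ell>\<^sup>2\<close>-norms.\<close>

locale bounded_twisted_groupoid = twisted_etale_groupoid +
  assumes reduced_norm_finite: "f \<in> Cc (arr_top G) \<Longrightarrow> reduced_norm G \<omega> f < \<infinity>"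
begin

text \<open>For the set of all units this is the reduced norm of the groupoid; for the set of units over a base
  point it is the reduced norm of the restriction to the fibre over that point.\<close>

definition rnorm :: "'a set \<Rightarrow> ('a \<Rightarrow> complex) \<Rightarrow> real" where
  "rnorm S f = enn2real (SUP u\<in>S. opnorm u f)"

lemma rnorm_nonneg: "0 \<le> rnorm S f"
  by (simp add: rnorm_def)

lemma rnorm_le:
  assumes "f \<in> CcG" "0 \<le> B" "\<And>u h. u \<in> S \<Longrightarrow> h \<in> CcG \<Longrightarrow> l2norm u (conv f h) \<le> B * l2norm u h"
  shows "rnorm S f \<le> B"
  unfolding rnorm_def by (intro enn2real_leI SUP_least opnorm_le assms)

lemma l2norm_conv_le:
  assumes S: "S \<subseteq> units G" and u: "u \<in> S" and f: "f \<in> CcG" and h: "h \<in> CcG"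
  shows "l2norm u (conv f h) \<le> rnorm S f * l2norm u h"
proof (cases "l2norm u h = 0")
  case True
  have "l2norm u (conv f h) = l2norm u (\<lambda>_. 0)"
  proof (rule l2norm_cong)
    fix x assume x: "x \<in> A" "s x = u"
    have "conv f h x = (\<Sum>y\<in>{}. \<omega> (x \<cdot> iv y, y) * f (x \<cdot> iv y) * h y)"
      by (rule conv_eq_sum) (use x l2norm_eq_0[OF h True] in auto)
    then show "cmod (conv f h x) = cmod 0" by simp
  qed
  also have "\<dots> = 0" by (simp add: ell2_norm_def)
  finally show ?thesis using True by simp
next
  case False
  then have pos: "l2norm u h > 0" using l2norm_nonneg[of u h] by simp
  define k where "k x = complex_of_real (1 / l2norm u h) * h x" for x
  have k: "k \<in> CcG" unfolding k_def by (rule Cc_scale[OF Hausdorff h])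
  have "l2norm u k = 1" using pos unfolding k_def by (subst l2norm_scale) (simp add: norm_divide)
  then have "ennreal (l2norm u (conv f k)) \<le> opnorm u f" using l2norm_conv_le_opnorm[OF k] by simp
  also have "\<dots> \<le> (SUP u\<in>S. opnorm u f)" by (rule SUP_upper[OF u])
  finally have 1: "ennreal (l2norm u (conv f k)) \<le> (SUP u\<in>S. opnorm u f)" .
  have "(SUP u\<in>S. opnorm u f) \<le> reduced_norm G \<omega> f"
    unfolding reduced_norm_def by (rule SUP_subset_mono[OF S]) simp
  then have "(SUP u\<in>S. opnorm u f) < \<infinity>" using reduced_norm_finite[OF f] by (rule le_less_trans)
  then have "ennreal (rnorm S f) = (SUP u\<in>S. opnorm u f)" by (simp add: rnorm_def)
  then have "l2norm u (conv f k) \<le> rnorm S f"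
    using 1 rnorm_nonneg[of S f] by (metis ennreal_le_iff)
  moreover have "l2norm u (conv f k) = l2norm u (conv f h) / l2norm u h"
    unfolding k_def using pos h by (simp add: conv_scale_right l2norm_scale norm_divide del: of_real_divide)
  ultimately show ?thesis using pos by (simp add: pos_divide_le_eq)
qed

lemma rnorm_cong:
  assumes "S \<subseteq> units G" "f \<in> CcG" "g \<in> CcG"
    and eq: "\<And>u h x. u \<in> S \<Longrightarrow> h \<in> CcG \<Longrightarrow> x \<in> A \<Longrightarrow> s x = u \<Longrightarrow> conv f h x = conv g h x"
  shows "rnorm S f = rnorm S g"
proof -
  have e: "l2norm u (conv f h) = l2norm u (conv g h)" if "u \<in> S" "h \<in> CcG" for u h
    by (rule l2norm_cong) (simp add: eq[OF that])
  have "rnorm S f \<le> rnorm S g"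
    using assms(1-3) e by (intro rnorm_le) (simp_all add: rnorm_nonneg l2norm_conv_le)
  moreover have "rnorm S g \<le> rnorm S f"
    using assms(1-3) by (intro rnorm_le) (simp_all add: rnorm_nonneg l2norm_conv_le flip: e)
  ultimately show ?thesis by (rule antisym)
qed

lemma rnorm_triangle:
  assumes "S \<subseteq> units G" "f \<in> CcG" "g \<in> CcG"
  shows "rnorm S (\<lambda>x. f x + g x) \<le> rnorm S f + rnorm S g"
proof (rule rnorm_le)
  fix u h assume u: "u \<in> S" and h: "h \<in> CcG"
  have "l2norm u (conv (\<lambda>x. f x + g x) h) \<le> l2norm u (conv f h) + l2norm u (conv g h)"
    using assms h by (simp add: conv_add_left l2norm_add_le conv_Cc)
  also have "\<dots> \<le> rnorm S f * l2norm u h + rnorm S g * l2norm u h"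
    using assms u h by (intro add_mono l2norm_conv_le) auto
  finally show "l2norm u (conv (\<lambda>x. f x + g x) h) \<le> (rnorm S f + rnorm S g) * l2norm u h"
    by (simp add: distrib_right)
qed (use assms rnorm_nonneg in \<open>auto intro: Cc_add Hausdorff\<close>)

lemma rnorm_scale:
  assumes S: "S \<subseteq> units G" and f: "f \<in> CcG"
  shows "rnorm S (\<lambda>x. c * f x) = cmod c * rnorm S f"
proof -
  have le: "rnorm S (\<lambda>x. c * f x) \<le> cmod c * rnorm S f" if f: "f \<in> CcG" for c f
  proof (rule rnorm_le)
    fix u h assume u: "u \<in> S" and h: "h \<in> CcG"
    have "cmod c * l2norm u (conv f h) \<le> cmod c * (rnorm S f * l2norm u h)"
      by (intro mult_left_mono l2norm_conv_le S u f h) simp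
    then show "l2norm u (conv (\<lambda>x. c * f x) h) \<le> cmod c * rnorm S f * l2norm u h"
      using h by (simp add: conv_scale_left l2norm_scale mult.assoc)
  qed (use that rnorm_nonneg in \<open>auto intro: Cc_scale Hausdorff\<close>)
  show ?thesis
  proof (cases "c = 0")
    case True
    then show ?thesis using le[OF f, of 0] rnorm_nonneg[of S "\<lambda>x. 0"] by simp
  next
    case False
    have "rnorm S f \<le> cmod (1 / c) * rnorm S (\<lambda>x. c * f x)"
      using le[OF Cc_scale[OF Hausdorff f, of c], of "1 / c"] False by simp
    then have "cmod c * rnorm S f \<le> rnorm S (\<lambda>x. c * f x)"
      using False by (simp add: norm_divide field_simps)
    then show ?thesis using le[OF f, of c] by simp
  qed
qed

lemma rnorm_conv_le:
  assumes S: "S \<subseteq> units G" and f: "f \<in> CcG" and g: "g \<in> CcG"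
  shows "rnorm S (conv f g) \<le> rnorm S f * rnorm S g"
proof (rule rnorm_le)
  fix u h assume u: "u \<in> S" and h: "h \<in> CcG"
  have "l2norm u (conv (conv f g) h) \<le> rnorm S f * l2norm u (conv g h)"
    using assms u h by (simp add: conv_assoc l2norm_conv_le conv_Cc)
  also have "\<dots> \<le> rnorm S f * (rnorm S g * l2norm u h)"
    by (intro mult_left_mono l2norm_conv_le rnorm_nonneg S u g h)
  finally show "l2norm u (conv (conv f g) h) \<le> rnorm S f * rnorm S g * l2norm u h" by (simp add: mult.assoc)
qed (use assms rnorm_nonneg in \<open>auto intro: conv_Cc\<close>)

text \<open>The usual argument for operators on a Hilbert space, with the inner product expressed by the algebra:
  \<open>\<parallel>f * h\<parallel>\<^sup>2 = (h\<^sup>* * ((f\<^sup>* * f) * h))(u)\<close>, followed by the Cauchy-Schwarz inequality.\<close>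

lemma rnorm_square_le:
  assumes S: "S \<subseteq> units G" and f: "f \<in> CcG"
  shows "(rnorm S f)\<^sup>2 \<le> rnorm S (conv (adj f) f)"
proof -
  have ff: "conv (adj f) f \<in> CcG" by (intro conv_Cc adj_Cc f)
  have "rnorm S f \<le> sqrt (rnorm S (conv (adj f) f))"
  proof (rule rnorm_le[OF f])
    fix u h assume u: "u \<in> S" and h: "h \<in> CcG"
    have uu: "u \<in> units G" using S u by blast
    have fh: "conv f h \<in> CcG" by (intro conv_Cc f h)
    have "conv (adj (conv f h)) (conv f h) = conv (adj h) (conv (conv (adj f) f) h)"
      using f h by (simp add: adj_conv conv_assoc conv_Cc adj_Cc)
    then have "(l2norm u (conv f h))\<^sup>2 = cmod (conv (adj h) (conv (conv (adj f) f) h) u)"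
      using l2norm_square[OF uu fh] by (metis abs_of_nonneg norm_of_real zero_le_power2)
    also have "\<dots> \<le> l2norm u h * l2norm u (conv (conv (adj f) f) h)"
      by (intro conv_adj_le uu h conv_Cc ff)
    also have "\<dots> \<le> l2norm u h * (rnorm S (conv (adj f) f) * l2norm u h)"
      by (intro mult_left_mono l2norm_conv_le S u ff h l2norm_nonneg)
    finally have "(l2norm u (conv f h))\<^sup>2 \<le> rnorm S (conv (adj f) f) * (l2norm u h)\<^sup>2"
      by (simp add: power2_eq_square mult_ac)
    then have "l2norm u (conv f h) \<le> sqrt (rnorm S (conv (adj f) f) * (l2norm u h)\<^sup>2)"
      by (rule real_le_rsqrt)
    then show "l2norm u (conv f h) \<le> sqrt (rnorm S (conv (adj f) f)) * l2norm u h"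
      by (simp add: real_sqrt_mult l2norm_nonneg)
  qed (simp add: rnorm_nonneg)
  then have "(rnorm S f)\<^sup>2 \<le> (sqrt (rnorm S (conv (adj f) f)))\<^sup>2"
    by (intro power_mono rnorm_nonneg)
  then show ?thesis by (simp add: rnorm_nonneg)
qed

lemma rnorm_conv_adj:
  assumes S: "S \<subseteq> units G" and f: "f \<in> CcG"
  shows "rnorm S (conv (adj f) f) = (rnorm S f)\<^sup>2" "rnorm S (adj f) = rnorm S f"
proof -
  have le: "rnorm S g \<le> rnorm S (adj g)" if g: "g \<in> CcG" for g
  proof (cases "rnorm S g = 0")
    case False
    have "(rnorm S g)\<^sup>2 \<le> rnorm S (adj g) * rnorm S g"
      using rnorm_square_le[OF S g] rnorm_conv_le[OF S adj_Cc[OF g] g] by simp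
    then show ?thesis using False rnorm_nonneg[of S g] by (simp add: power2_eq_square)
  qed (simp add: rnorm_nonneg)
  show eq: "rnorm S (adj f) = rnorm S f"
    using le[OF f] le[OF adj_Cc[OF f]] f by (simp add: adj_adj)
  show "rnorm S (conv (adj f) f) = (rnorm S f)\<^sup>2"
    using rnorm_square_le[OF S f] rnorm_conv_le[OF S adj_Cc[OF f] f] eq by (simp add: power2_eq_square)
qed

lemma pre_cstar_Cc:
  assumes S: "S \<subseteq> units G"
  shows "pre_cstar_algebra ((Cc_alg G \<omega>)\<lparr>norm_op := rnorm S\<rparr>)"
proof
qed (use S in \<open>auto simp: Cc_alg_def Cc_zero Cc_add Cc_scale Hausdorff conv_Cc adj_Cc conv_assoc conv_add_left
    conv_add_right conv_scale_left conv_scale_right adj_adj adj_add adj_scale adj_conv algebra_simps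
    rnorm_nonneg rnorm_triangle rnorm_scale rnorm_conv_le rnorm_conv_adj\<close>)

lemma Cc_alg_norm: "(Cc_alg G \<omega>)\<lparr>norm_op := rnorm (units G)\<rparr> = Cc_alg G \<omega>"
  by (simp add: Cc_alg_def rnorm_def[abs_def] reduced_norm_def)

text \<open>Convolution with a bump at a unit reproduces \<^term>\<open>f\<close> on the source fibre.\<close>

lemma l2norm_le_rnorm:
  assumes S: "S \<subseteq> units G" and u: "u \<in> S" and f: "f \<in> CcG"
  shows "l2norm u f \<le> rnorm S f"
proof -
  have uu: "u \<in> A" "s u = u" "r u = u" using S u unit_rng by (auto simp: units_iff)
  have iu: "iv u = u" using iv_unique[of u u] uu iv_simps(6)[of u] by simp
  obtain b where b: "b \<in> CcG" "b u = 1" "\<And>y. y \<in> A \<Longrightarrow> s y = s u \<Longrightarrow> y \<noteq> u \<Longrightarrow> b y = 0"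
    using point_bump[OF uu(1)] by blast
  have "l2norm u b = L2_set (\<lambda>x. cmod (b x)) {u}" by (rule l2norm_eq_L2_set) (use b uu in auto)
  then have hb: "l2norm u b = 1" using b(2) by (simp add: L2_set_def)
  have "l2norm u (conv f b) = l2norm u f"
  proof (rule l2norm_cong)
    fix x assume x: "x \<in> A" "s x = u"
    have "conv f b x = (\<Sum>y\<in>{u}. \<omega> (x \<cdot> iv y, y) * f (x \<cdot> iv y) * b y)"
      by (rule conv_eq_sum) (use b x uu in auto)
    also have "\<dots> = f x" using x iu b(2) cocycle_norm(1)[of x] iv_simps(6)[of x] by simp
    finally show "cmod (conv f b x) = cmod (f x)" by simp
  qed
  then show ?thesis using l2norm_conv_le[OF S u f b(1)] hb by simp
qed

end

section \<open>Rapid decay\<close>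

lemma compactin_real_bounded:
  assumes "compactin X K" "continuous_map X euclideanreal \<phi>"
  obtains B where "0 < B" "\<And>x. x \<in> K \<Longrightarrow> \<bar>\<phi> x\<bar> \<le> B"
proof -
  have "compact (\<phi> ` K)" using image_compactin[OF assms] by simp
  then obtain B where "B > 0" "\<forall>y\<in>\<phi> ` K. norm y \<le> B" using compact_imp_bounded bounded_pos by metis
  then show ?thesis by (intro that[of B]) auto
qed

lemma growth_limit:
  assumes "0 < \<rho>" "\<rho> < (1::real)" "0 < L"
  shows "(\<lambda>n::nat. C * (1 + real n * L) powr q * \<rho> ^ n) \<longlonglongrightarrow> 0"
  using assms by real_asymp

locale rapid_decay_groupoid = twisted_etale_groupoid +
  fixes l :: "'a \<Rightarrow> real"
  assumes length: "length_function G l" and decay: "rapid_decay G \<omega> l"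
begin

lemma continuous_length: "continuous_map (arr_top G) euclideanreal l"
  using length by (simp add: length_function_def continuous_map_in_subtopology)

lemma length_nonneg: "x \<in> A \<Longrightarrow> 0 \<le> l x"
  using length by (auto simp: length_function_def continuous_map_in_subtopology Pi_iff image_subset_iff)

lemma length_iv: "x \<in> A \<Longrightarrow> l (iv x) = l x"
  using length by (simp add: length_function_def)

lemma length_prd: "x \<in> A \<Longrightarrow> y \<in> A \<Longrightarrow> s x = r y \<Longrightarrow> l (x \<cdot> y) \<le> l x + l y"
  using length by (auto simp: length_function_def)

lemma length_bounded_on_support:
  assumes "f \<in> CcG"
  obtains L where "0 < L" "\<And>x. x \<in> A \<Longrightarrow> f x \<noteq> 0 \<Longrightarrow> l x \<le> L"
proof -
  obtain K where K: "compactin (arr_top G) K" "\<And>x. x \<notin> K \<Longrightarrow> f x = 0"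
    using Cc_support[OF Hausdorff assms] by blast
  obtain B where "0 < B" "\<And>x. x \<in> K \<Longrightarrow> \<bar>l x\<bar> \<le> B"
    using compactin_real_bounded[OF K(1) continuous_length] by blast
  then show ?thesis using K(2) that[of B] by (metis abs_le_D1)
qed

text \<open>Inversion exchanges source and range fibres and preserves the length.\<close>

lemma norm_2r_eq_adj: "norm_2r G l q f = norm_2s G l q (adj f)"
  unfolding norm_2r_def norm_2s_def
proof (rule SUP_cong[OF refl])
  fix u assume "u \<in> units G"
  have bij: "bij_betw iv (src_fibre G u) (rng_fibre G u)"
    by (rule bij_betwI[of _ _ _ iv]) auto
  have "(\<Sum>\<^sub>\<infinity>x\<in>rng_fibre G u. (cmod (f x))\<^sup>2 * (1 + l x) powr (2 * q))
      = (\<Sum>\<^sub>\<infinity>x\<in>src_fibre G u. (cmod (f (iv x)))\<^sup>2 * (1 + l (iv x)) powr (2 * q))"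
    by (rule infsum_reindex_bij_betw[OF bij, symmetric])
  also have "\<dots> = (\<Sum>\<^sub>\<infinity>x\<in>src_fibre G u. (cmod (adj f x))\<^sup>2 * (1 + l x) powr (2 * q))"
    by (rule infsum_cong) (simp add: cmod_adj length_iv)
  finally show "ennreal (sqrt (\<Sum>\<^sub>\<infinity>x\<in>rng_fibre G u. (cmod (f x))\<^sup>2 * (1 + l x) powr (2 * q)))
      = ennreal (sqrt (\<Sum>\<^sub>\<infinity>x\<in>src_fibre G u. (cmod (adj f x))\<^sup>2 * (1 + l x) powr (2 * q)))" by simp
qed

lemma norm_2s_le:
  assumes f: "f \<in> CcG" and q: "0 \<le> q" and L: "\<And>x. x \<in> A \<Longrightarrow> f x \<noteq> 0 \<Longrightarrow> l x \<le> L"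
    and M: "\<And>u. u \<in> units G \<Longrightarrow> l2norm u f \<le> M"
  shows "norm_2s G l q f \<le> ennreal ((1 + L) powr q * M)"
  unfolding norm_2s_def
proof (rule SUP_least, rule ennreal_leI)
  fix u assume u: "u \<in> units G"
  let ?S = "{x \<in> A. s x = u \<and> f x \<noteq> 0}"
  have fin: "finite ?S" by (rule finite_src_support[OF f])
  have "(\<Sum>\<^sub>\<infinity>x\<in>src_fibre G u. (cmod (f x))\<^sup>2 * (1 + l x) powr (2 * q))
      = (\<Sum>x\<in>?S. (cmod (f x))\<^sup>2 * (1 + l x) powr (2 * q))"
    by (rule infsum_eq_finite_sum[OF fin]) auto
  also have "\<dots> \<le> (\<Sum>x\<in>?S. (cmod (f x))\<^sup>2 * ((1 + L) powr q)\<^sup>2)"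
  proof (intro sum_mono mult_left_mono)
    fix x assume x: "x \<in> ?S"
    have "(1 + l x) powr (2 * q) \<le> (1 + L) powr (2 * q)"
      using x L[of x] length_nonneg[of x] q by (intro powr_mono2) auto
    also have "\<dots> = ((1 + L) powr q)\<^sup>2"
      by (simp add: power2_eq_square flip: powr_add)
    finally show "(1 + l x) powr (2 * q) \<le> ((1 + L) powr q)\<^sup>2" .
  qed simp
  also have "\<dots> = (l2norm u f)\<^sup>2 * ((1 + L) powr q)\<^sup>2"
    unfolding l2norm_eq_support[OF f] L2_set_def by (simp add: sum_distrib_right sum_nonneg)
  finally have "sqrt (\<Sum>\<^sub>\<infinity>x\<in>src_fibre G u. (cmod (f x))\<^sup>2 * (1 + l x) powr (2 * q))
      \<le> sqrt ((l2norm u f * (1 + L) powr q)\<^sup>2)" by (simp add: power_mult_distrib)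
  also have "\<dots> = (1 + L) powr q * l2norm u f" by (simp add: l2norm_nonneg mult.commute)
  also have "\<dots> \<le> (1 + L) powr q * M" by (intro mult_left_mono M u) simp
  finally show "sqrt (\<Sum>\<^sub>\<infinity>x\<in>src_fibre G u. (cmod (f x))\<^sup>2 * (1 + l x) powr (2 * q)) \<le> (1 + L) powr q * M" .
qed

text \<open>Rapid decay in the form in which it is applied: a bound for the length on the support turns the
  weighted norms into plain fibrewise \<open>\<ell>\<^sup>2\<close>-norms.\<close>

lemma decay_bound:
  obtains C q where "\<And>f L M. f \<in> CcG \<Longrightarrow> (\<And>x. x \<in> A \<Longrightarrow> f x \<noteq> 0 \<Longrightarrow> l x \<le> L) \<Longrightarrow>
    (\<And>u. u \<in> units G \<Longrightarrow> l2norm u f \<le> M) \<Longrightarrow> (\<And>u. u \<in> units G \<Longrightarrow> l2norm u (adj f) \<le> M) \<Longrightarrow>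
    reduced_norm G \<omega> f \<le> ennreal (C * (1 + L) powr q * M)" "0 < C"
proof -
  obtain C q where Cq: "C > 0" "q \<ge> 0"
    and dec: "\<And>f. f \<in> CcG \<Longrightarrow> reduced_norm G \<omega> f \<le> ennreal C * norm_2 G l q f"
    using decay unfolding rapid_decay_def by blast
  show ?thesis
  proof (rule that[OF _ Cq(1)])
    fix f L M
    assume f: "f \<in> CcG" and L: "\<And>x. x \<in> A \<Longrightarrow> f x \<noteq> 0 \<Longrightarrow> l x \<le> L"
      and M: "\<And>u. u \<in> units G \<Longrightarrow> l2norm u f \<le> M" "\<And>u. u \<in> units G \<Longrightarrow> l2norm u (adj f) \<le> M"
    have L': "l x \<le> L" if "x \<in> A" "adj f x \<noteq> 0" for x
      using L[of "iv x"] that by (auto simp: adj_eq length_iv)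
    have "norm_2 G l q f \<le> ennreal ((1 + L) powr q * M)"
      unfolding norm_2_def norm_2r_eq_adj
      using norm_2s_le[OF f Cq(2) L M(1)] norm_2s_le[OF adj_Cc[OF f] Cq(2) L' M(2)] by simp
    then have "ennreal C * norm_2 G l q f \<le> ennreal C * ennreal ((1 + L) powr q * M)"
      by (rule mult_left_mono) simp
    also have "\<dots> = ennreal (C * (1 + L) powr q * M)"
      using Cq(1) by (simp add: ennreal_mult'[symmetric] mult.assoc)
    finally show "reduced_norm G \<omega> f \<le> ennreal (C * (1 + L) powr q * M)"
      using dec[OF f] by (rule order_trans[rotated])
  qed
qed

lemma l2norm_bounded:
  assumes "f \<in> CcG" obtains M where "\<And>u. u \<in> units G \<Longrightarrow> l2norm u f \<le> M"
proof -
  obtain \<phi> K where \<phi>: "continuous_map (arr_top G) euclideanreal \<phi>" "compactin (arr_top G) K"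
    "\<And>x. x \<notin> K \<Longrightarrow> \<phi> x = 0" "\<And>u. u \<in> units G \<Longrightarrow> (l2norm u f)\<^sup>2 = \<phi> u"
    using continuous_l2norm_square[OF assms] by metis
  obtain B where B: "0 < B" "\<And>x. x \<in> K \<Longrightarrow> \<bar>\<phi> x\<bar> \<le> B"
    using compactin_real_bounded[OF \<phi>(2,1)] by blast
  have "l2norm u f \<le> sqrt B" if "u \<in> units G" for u
  proof (rule real_le_rsqrt)
    show "(l2norm u f)\<^sup>2 \<le> B" using \<phi>(3)[of u] \<phi>(4)[OF that] B(1) B(2)[of u] by (cases "u \<in> K") auto
  qed
  then show ?thesis by (rule that)
qed

sublocale bounded_twisted_groupoid
proof
  fix f assume f: "f \<in> CcG"
  obtain L where L: "\<And>x. x \<in> A \<Longrightarrow> f x \<noteq> 0 \<Longrightarrow> l x \<le> L" using length_bounded_on_support[OF f] by metis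
  obtain M1 where M1: "\<And>u. u \<in> units G \<Longrightarrow> l2norm u f \<le> M1" using l2norm_bounded[OF f] by metis
  obtain M2 where M2: "\<And>u. u \<in> units G \<Longrightarrow> l2norm u (adj f) \<le> M2" using l2norm_bounded[OF adj_Cc[OF f]] by metis
  obtain C q where "\<And>f L M. f \<in> CcG \<Longrightarrow> (\<And>x. x \<in> A \<Longrightarrow> f x \<noteq> 0 \<Longrightarrow> l x \<le> L) \<Longrightarrow>
    (\<And>u. u \<in> units G \<Longrightarrow> l2norm u f \<le> M) \<Longrightarrow> (\<And>u. u \<in> units G \<Longrightarrow> l2norm u (adj f) \<le> M) \<Longrightarrow>
    reduced_norm G \<omega> f \<le> ennreal (C * (1 + L) powr q * M)"
    by (rule decay_bound) blast
  from this[OF f L, of "max M1 M2"]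
  have "reduced_norm G \<omega> f \<le> ennreal (C * (1 + L) powr q * max M1 M2)"
    using M1 M2 by (simp add: le_max_iff_disj)
  then show "reduced_norm G \<omega> f < \<infinity>" by (rule le_less_trans) simp
qed

end

section \<open>Continuity of the fibre norms\<close>

locale rapid_decay_field = rapid_decay_groupoid +
  fixes T :: "'b topology" and p :: "'a \<Rightarrow> 'b"
  assumes base_locally_compact: "locally_compact_space T"
    and base_Hausdorff: "Hausdorff_space T"
    and field: "field_of_groupoids G T p"
begin

abbreviation units_over :: "'b \<Rightarrow> 'a set" where "units_over t \<equiv> {u \<in> units G. p u = t}"
abbreviation fnorm :: "'b \<Rightarrow> ('a \<Rightarrow> complex) \<Rightarrow> real" where "fnorm t \<equiv> rnorm (units_over t)"

lemma continuous_p: "continuous_map (arr_top G) T p"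
  using field by (simp add: field_of_groupoids_def)

lemma open_p: "openin (arr_top G) U \<Longrightarrow> openin T (p ` U)"
  using field by (simp add: field_of_groupoids_def open_map_def)

lemma p_onto: "p ` A = topspace T"
  using field by (simp add: field_of_groupoids_def)

lemma p_src: "x \<in> A \<Longrightarrow> p (s x) = p x" and p_rng: "x \<in> A \<Longrightarrow> p (r x) = p x"
  using field by (auto simp: field_of_groupoids_def)

lemma p_prd: "x \<in> A \<Longrightarrow> y \<in> A \<Longrightarrow> s x = r y \<Longrightarrow> p (x \<cdot> y) = p x"
  using p_rng[of "x \<cdot> y"] p_rng[of x] by simp

lemma p_iv: "x \<in> A \<Longrightarrow> p (iv x) = p x"
  using p_src[of "iv x"] p_rng[of x] by simp

lemma units_over_subset: "units_over t \<subseteq> units G" by blast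

lemma base_completely_regular: "completely_regular_space T"
  using base_locally_compact base_Hausdorff locally_compact_regular_imp_completely_regular_space by blast

lemma base_bump:
  assumes "openin T V" "t \<in> V"
  obtains \<theta> :: "'b \<Rightarrow> real" where "continuous_map T euclideanreal \<theta>" "\<theta> t = 1"
    "\<And>t'. t' \<in> topspace T \<Longrightarrow> t' \<notin> V \<Longrightarrow> \<theta> t' = 0" "\<And>t'. t' \<in> topspace T \<Longrightarrow> 0 \<le> \<theta> t' \<and> \<theta> t' \<le> 1"
proof -
  have "closedin T (topspace T - V)" using assms(1) by blast
  moreover have "compactin T {t}" using assms openin_subset by (fastforce intro: finite_imp_compactin)
  moreover have "disjnt {t} (topspace T - V)" using assms(2) by (auto simp: disjnt_def)
  ultimately obtain f where "continuous_map T (top_of_set {0..1::real}) f"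
      "f ` (topspace T - V) \<subseteq> {0}" "f ` {t} \<subseteq> {1}"
    using Urysohn_completely_regular_compact_closed[of 0 1 T "{t}" "topspace T - V"] base_completely_regular
    by auto
  then show ?thesis
    by (intro that[of f]) (auto simp: continuous_map_in_subtopology image_subset_iff Pi_iff)
qed

lemma base_mult_Cc:
  assumes "continuous_map T euclidean g" "f \<in> CcG"
  shows "(\<lambda>x. g (p x) * f x) \<in> CcG"
  using continuous_map_compose[OF continuous_p assms(1)] assms(2)
  by (intro Cc_mult_continuous Hausdorff) (simp_all add: o_def)

lemma conv_base_left: "h \<in> CcG \<Longrightarrow> conv (\<lambda>x. g (p x) * f x) h = (\<lambda>x. g (p x) * conv f h x)"
  by (rule conv_invariant_left) (simp_all add: p_rng)

lemma conv_base_right: "h \<in> CcG \<Longrightarrow> conv f (\<lambda>x. g (p x) * h x) = (\<lambda>x. g (p x) * conv f h x)"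
  by (rule conv_invariant_right) (simp_all add: p_src)

lemma adj_base: "adj (\<lambda>x. g (p x) * f x) = (\<lambda>x. cnj (g (p x)) * adj f x)"
proof
  fix x show "adj (\<lambda>x. g (p x) * f x) x = cnj (g (p x)) * adj f x"
    by (cases "x \<in> A") (simp_all add: adj_eq adj_outside p_iv)
qed

lemma l2norm_base: "u \<in> units G \<Longrightarrow> l2norm u (\<lambda>x. g (p x) * f x) = cmod (g (p u)) * l2norm u f"
proof -
  assume "u \<in> units G"
  have "l2norm u (\<lambda>x. g (p x) * f x) = l2norm u (\<lambda>x. g (p u) * f x)"
    by (rule l2norm_cong) (use p_src in force)
  then show ?thesis by (simp add: l2norm_scale)
qed

lemma fnorm_base:
  assumes "continuous_map T euclidean g" "f \<in> CcG"
  shows "fnorm t (\<lambda>x. g (p x) * f x) = cmod (g t) * fnorm t f"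
proof -
  have "fnorm t (\<lambda>x. g (p x) * f x) = fnorm t (\<lambda>x. g t * f x)"
  proof (rule rnorm_cong[OF units_over_subset])
    fix u h x assume "u \<in> units_over t" "h \<in> CcG" "x \<in> A" "s x = u"
    then show "conv (\<lambda>x. g (p x) * f x) h x = conv (\<lambda>x. g t * f x) h x"
      using p_src[of x] by (simp add: conv_base_left conv_scale_left)
  qed (use assms in \<open>auto intro: base_mult_Cc Cc_scale Hausdorff\<close>)
  then show ?thesis using rnorm_scale[OF units_over_subset assms(2)] by simp
qed

lemma fnorm_le_rnorm: "f \<in> CcG \<Longrightarrow> fnorm t f \<le> rnorm (units G) f"
  by (rule rnorm_le) (auto simp: rnorm_nonneg intro: l2norm_conv_le)

text \<open>Every unit lies over some base point.\<close>

lemma rnorm_le_fnorms: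
  assumes "f \<in> CcG" "0 \<le> B" "\<And>t. t \<in> topspace T \<Longrightarrow> fnorm t f \<le> B"
  shows "rnorm (units G) f \<le> B"
proof (rule rnorm_le[OF assms(1,2)])
  fix u h assume u: "u \<in> units G" and h: "h \<in> CcG"
  have "l2norm u (conv f h) \<le> fnorm (p u) f * l2norm u h"
    using u h assms(1) by (intro l2norm_conv_le units_over_subset) auto
  also have "\<dots> \<le> B * l2norm u h"
    using u p_onto by (intro mult_right_mono l2norm_nonneg assms(3)) (auto simp: units_iff)
  finally show "l2norm u (conv f h) \<le> B * l2norm u h" .
qed

text \<open>If a vector almost attains the norm at a unit, then so does the same compactly supported
  function at all nearby units, and \<^term>\<open>p\<close> is open.\<close>

lemma fnorm_lower_semicontinuous:
  assumes f: "f \<in> CcG" and c: "c < fnorm t0 f" and t0: "t0 \<in> topspace T"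
  shows "\<exists>V. openin T V \<and> t0 \<in> V \<and> (\<forall>t\<in>V. c < fnorm t f)"
proof (cases "c < 0")
  case True
  then show ?thesis using t0 rnorm_nonneg[of _ f] by (intro exI[of _ "topspace T"]) (auto intro: less_le_trans)
next
  case False
  then have "\<exists>u0\<in>units_over t0. \<exists>h\<in>CcG. c * l2norm u0 h < l2norm u0 (conv f h)"
    using rnorm_le[OF f, of c "units_over t0"] c by (meson not_le)
  then obtain u0 h where u0: "u0 \<in> units G" "p u0 = t0" and h: "h \<in> CcG"
    and gt: "c * l2norm u0 h < l2norm u0 (conv f h)" by blast
  obtain \<phi> where \<phi>: "continuous_map (arr_top G) euclideanreal \<phi>" "\<And>u. u \<in> units G \<Longrightarrow> (l2norm u h)\<^sup>2 = \<phi> u"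
    using continuous_l2norm_square[OF h] by metis
  obtain \<psi> where \<psi>: "continuous_map (arr_top G) euclideanreal \<psi>" "\<And>u. u \<in> units G \<Longrightarrow> (l2norm u (conv f h))\<^sup>2 = \<psi> u"
    using continuous_l2norm_square[OF conv_Cc[OF f h]] by metis
  have iff: "c\<^sup>2 * \<phi> u < \<psi> u \<longleftrightarrow> c * l2norm u h < l2norm u (conv f h)" if "u \<in> units G" for u
  proof -
    have "c\<^sup>2 * \<phi> u < \<psi> u \<longleftrightarrow> (c * l2norm u h)\<^sup>2 < (l2norm u (conv f h))\<^sup>2"
      by (simp add: power_mult_distrib \<phi>(2)[OF that] \<psi>(2)[OF that])
    also have "\<dots> \<longleftrightarrow> c * l2norm u h < l2norm u (conv f h)"
      using False l2norm_nonneg[of u h] l2norm_nonneg[of u "conv f h"]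
        power2_less_imp_less[of "c * l2norm u h" "l2norm u (conv f h)"]
        power_strict_mono[of "c * l2norm u h" "l2norm u (conv f h)" 2] by auto
    finally show ?thesis .
  qed
  define W where "W = {x \<in> A. s x \<in> {y \<in> A. \<psi> y - c\<^sup>2 * \<phi> y \<in> {0<..}}}"
  have cs: "continuous_map (arr_top G) (arr_top G) s"
    using continuous_src unfolding unit_top_def by (rule continuous_map_into_fulltopology)
  have "continuous_map (arr_top G) euclideanreal (\<lambda>y. \<psi> y - c\<^sup>2 * \<phi> y)"
    by (intro continuous_map_diff continuous_map_real_mult_left \<phi> \<psi>)
  then have "openin (arr_top G) {y \<in> A. \<psi> y - c\<^sup>2 * \<phi> y \<in> {0<..}}"
    by (rule openin_continuous_map_preimage) simp
  then have W: "openin (arr_top G) W" unfolding W_def by (rule openin_continuous_map_preimage[OF cs])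
  show ?thesis
  proof (intro exI[of _ "p ` W"] conjI ballI)
    show "openin T (p ` W)" by (rule open_p[OF W])
    have "u0 \<in> W" using u0 gt iff[OF u0(1)] by (auto simp: W_def units_iff)
    then show "t0 \<in> p ` W" using u0(2) by blast
    fix t assume "t \<in> p ` W"
    then obtain x where x: "x \<in> A" "p x = t" "0 < \<psi> (s x) - c\<^sup>2 * \<phi> (s x)" by (auto simp: W_def)
    have u: "s x \<in> units_over t" using x p_src src_unit by simp
    then have "c * l2norm (s x) h < l2norm (s x) (conv f h)" using x iff[of "s x"] by simp
    also have "\<dots> \<le> fnorm t f * l2norm (s x) h" by (intro l2norm_conv_le units_over_subset u f h)
    finally show "c < fnorm t f" using l2norm_nonneg[of "s x" h] by (simp add: mult_less_cancel_right)
  qed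
qed

text \<open>Iterated squares instead of powers of \<open>f\<^sup>* * f\<close>: the C*-identity then gives their norms directly.\<close>

primrec sq_iter :: "('a \<Rightarrow> complex) \<Rightarrow> nat \<Rightarrow> 'a \<Rightarrow> complex" where
  "sq_iter f 0 = f"
| "sq_iter f (Suc k) = conv (adj (sq_iter f k)) (sq_iter f k)"

lemma sq_iter_Cc: "f \<in> CcG \<Longrightarrow> sq_iter f k \<in> CcG"
  by (induction k) (simp_all add: conv_Cc adj_Cc)

lemma fnorm_sq_iter: "f \<in> CcG \<Longrightarrow> fnorm t (sq_iter f k) = fnorm t f ^ (2 ^ k)"
  by (induction k) (simp_all add: rnorm_conv_adj(1)[OF units_over_subset] sq_iter_Cc power_mult[symmetric] mult.commute)

lemma length_sq_iter:
  assumes "\<And>x. x \<in> A \<Longrightarrow> f x \<noteq> 0 \<Longrightarrow> l x \<le> L"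
  shows "x \<in> A \<Longrightarrow> sq_iter f k x \<noteq> 0 \<Longrightarrow> l x \<le> 2 ^ k * L"
proof (induction k arbitrary: x)
  case 0 then show ?case using assms by simp
next
  case (Suc k)
  obtain y where y: "y \<in> A" "s y = s x" "adj (sq_iter f k) (x \<cdot> iv y) \<noteq> 0" "sq_iter f k y \<noteq> 0"
    using conv_nonzero[OF Suc.prems(1)] Suc.prems(2) by (metis sq_iter.simps(2))
  let ?z = "x \<cdot> iv y"
  have z: "?z \<in> A" "s ?z = r y" using y Suc.prems(1) by auto
  have "sq_iter f k (iv ?z) \<noteq> 0" using y(3) z by (simp add: adj_eq)
  then have "l ?z \<le> 2 ^ k * L" using Suc.IH[of "iv ?z"] z length_iv[of ?z] by simp
  moreover have "l y \<le> 2 ^ k * L" using Suc.IH y by simp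
  moreover have "l x \<le> l ?z + l y" using length_prd[of ?z y] z y Suc.prems(1) right_cancel_iv by simp
  ultimately show ?case by simp
qed

text \<open>The units at which the fibrewise norm is at least \<^term>\<open>M\<close> form a compact set, whose image in the base
  is closed and does not contain \<open>t\<^sub>0\<close>.\<close>

lemma l2norm_upper_semicontinuous:
  assumes g: "g \<in> CcG" and M: "0 < M" and t0: "t0 \<in> topspace T"
    and lt: "\<And>u. u \<in> units_over t0 \<Longrightarrow> l2norm u g < M"
  shows "\<exists>V. openin T V \<and> t0 \<in> V \<and> (\<forall>u\<in>units G. p u \<in> V \<longrightarrow> l2norm u g < M)"
proof -
  obtain \<phi> K where \<phi>: "continuous_map (arr_top G) euclideanreal \<phi>" "compactin (arr_top G) K"
    "\<And>x. x \<notin> K \<Longrightarrow> \<phi> x = 0" "\<And>u. u \<in> units G \<Longrightarrow> (l2norm u g)\<^sup>2 = \<phi> u"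
    using continuous_l2norm_square[OF g] by metis
  define Q where "Q = {x \<in> A. s x = x} \<inter> {x \<in> A. \<phi> x \<in> {M\<^sup>2..}} \<inter> K"
  have cs: "continuous_map (arr_top G) (arr_top G) s"
    using continuous_src unfolding unit_top_def by (rule continuous_map_into_fulltopology)
  have "closedin (arr_top G) {x \<in> A. s x = x}"
    using closedin_continuous_maps_eq[OF Hausdorff cs continuous_map_id] by (simp add: id_def)
  moreover have "closedin (arr_top G) {x \<in> A. \<phi> x \<in> {M\<^sup>2..}}"
    by (rule closedin_continuous_map_preimage[OF \<phi>(1)]) simp
  ultimately have "compactin (arr_top G) Q" unfolding Q_def
    by (intro closed_Int_compactin[OF _ \<phi>(2)] closedin_Int)
  then have "closedin T (p ` Q)"
    using image_compactin[OF _ continuous_p] compactin_imp_closedin[OF base_Hausdorff] by blast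
  then have "openin T (topspace T - p ` Q)" by blast
  have Q: "u \<in> Q \<longleftrightarrow> M \<le> l2norm u g" if u: "u \<in> units G" for u
  proof -
    have "u \<in> Q \<longleftrightarrow> M\<^sup>2 \<le> \<phi> u"
      using u M \<phi>(3)[of u] by (cases "u \<in> K") (auto simp: Q_def units_iff)
    then show ?thesis using \<phi>(4)[OF u] M l2norm_nonneg[of u g] by (metis abs_le_square_iff abs_of_nonneg less_imp_le)
  qed
  show ?thesis
  proof (intro exI[of _ "topspace T - p ` Q"] conjI ballI impI)
    show "t0 \<in> topspace T - p ` Q"
    proof -
      have "t0 \<noteq> p u" if "u \<in> Q" for u
      proof
        have u: "u \<in> units G" using that by (auto simp: Q_def units_iff)
        assume "t0 = p u"
        then show False using lt[of u] Q[OF u] that u by auto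
      qed
      then show ?thesis using t0 by blast
    qed
    show "l2norm u g < M" if "u \<in> units G" "p u \<in> topspace T - p ` Q" for u
      using Q[OF that(1)] that(2) by (meson DiffD2 image_eqI not_le)
  qed fact
qed

text \<open>Rapid decay gives \<open>(fnorm t f)\<^sup>m \<le> C * (1 + m * L) powr q * c'\<^sup>m\<close> with \<open>m = 2\<^sup>N\<close> for all \<open>t\<close> near \<open>t\<^sub>0\<close>, for any
  \<open>c'\<close> above \<open>fnorm t\<^sub>0 f\<close>. If \<open>c' < c\<close>, then the right-hand side is below \<open>c\<^sup>m\<close> for large \<open>N\<close>. The neighbourhood
  depends on \<open>N\<close>, but a single suitable \<open>N\<close> is enough. Here \<open>C\<close> and \<open>q\<close> are the constants of rapid decay and
  \<open>L\<close> bounds the length on the support of \<open>f\<close>.\<close>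

theorem fnorm_upper_semicontinuous:
  assumes f: "f \<in> CcG" and c: "fnorm t0 f < c" and t0: "t0 \<in> topspace T"
  shows "\<exists>V. openin T V \<and> t0 \<in> V \<and> (\<forall>t\<in>V. fnorm t f < c)"
proof -
  define n0 where "n0 = fnorm t0 f"
  define c' where "c' = (n0 + c) / 2"
  have n0: "0 \<le> n0" by (simp add: n0_def rnorm_nonneg)
  have c': "n0 < c'" "c' < c" "0 < c'" "0 < c" using c n0 by (simp_all add: c'_def n0_def)
  obtain L where L: "0 < L" "\<And>x. x \<in> A \<Longrightarrow> f x \<noteq> 0 \<Longrightarrow> l x \<le> L"
    using length_bounded_on_support[OF f] by metis
  obtain C q where dec: "\<And>f L M. f \<in> CcG \<Longrightarrow> (\<And>x. x \<in> A \<Longrightarrow> f x \<noteq> 0 \<Longrightarrow> l x \<le> L) \<Longrightarrow>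
    (\<And>u. u \<in> units G \<Longrightarrow> l2norm u f \<le> M) \<Longrightarrow> (\<And>u. u \<in> units G \<Longrightarrow> l2norm u (adj f) \<le> M) \<Longrightarrow>
    reduced_norm G \<omega> f \<le> ennreal (C * (1 + L) powr q * M)" and C: "0 < C"
    by (rule decay_bound) blast
  have "(\<lambda>n::nat. C * (1 + real n * L) powr q * (c' / c) ^ n) \<longlonglongrightarrow> 0"
    by (rule growth_limit) (use c' L in auto)
  from LIMSEQ_D[OF this, of 1]
  obtain N where N: "\<And>n. n \<ge> N \<Longrightarrow> \<bar>C * (1 + real n * L) powr q * (c' / c) ^ n\<bar> < 1"
    by auto
  define m :: nat where "m = 2 ^ N"
  have "N \<le> m" unfolding m_def by (rule less_imp_le) simp
  then have "C * (1 + real m * L) powr q * (c' / c) ^ m < 1" using N[of m] by simp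
  then have key: "C * (1 + real m * L) powr q * c' ^ m < c ^ m"
    using c' by (simp add: power_divide pos_divide_less_eq)
  define g where "g = sq_iter f N"
  have g: "g \<in> CcG" unfolding g_def by (rule sq_iter_Cc[OF f])
  have gn: "fnorm t g = fnorm t f ^ m" for t unfolding g_def m_def by (rule fnorm_sq_iter[OF f])
  define M where "M = c' ^ m"
  have M: "0 < M" using c' by (simp add: M_def)
  have "n0 ^ m < c' ^ m" using c' n0 by (intro power_strict_mono) (simp_all add: m_def)
  then have nM: "fnorm t0 g < M" by (simp add: gn M_def n0_def)
  have "l2norm u g < M" if "u \<in> units_over t0" for u
    using l2norm_le_rnorm[OF units_over_subset that g] nM by (rule le_less_trans)
  from l2norm_upper_semicontinuous[OF g M t0 this] obtain V1
    where V1: "openin T V1" "t0 \<in> V1" "\<And>u. u \<in> units G \<Longrightarrow> p u \<in> V1 \<Longrightarrow> l2norm u g < M" by blast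
  have "l2norm u (adj g) < M" if "u \<in> units_over t0" for u
    using l2norm_le_rnorm[OF units_over_subset that adj_Cc[OF g]] rnorm_conv_adj(2)[OF units_over_subset g] nM
    by simp
  from l2norm_upper_semicontinuous[OF adj_Cc[OF g] M t0 this] obtain V2
    where V2: "openin T V2" "t0 \<in> V2" "\<And>u. u \<in> units G \<Longrightarrow> p u \<in> V2 \<Longrightarrow> l2norm u (adj g) < M" by blast
  have "fnorm t f < c" if t: "t \<in> V1 \<inter> V2" for t
  proof -
    \<comment> \<open>The decay hypothesis speaks of the whole groupoid; cutting off near \<^term>\<open>t\<close> makes it see the
      neighbourhood only and leaves the norm over \<^term>\<open>t\<close> unchanged.\<close>
    obtain \<theta> :: "'b \<Rightarrow> real" where \<theta>: "continuous_map T euclideanreal \<theta>" "\<theta> t = 1"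
      "\<And>t'. t' \<in> topspace T \<Longrightarrow> t' \<notin> V1 \<inter> V2 \<Longrightarrow> \<theta> t' = 0"
      "\<And>t'. t' \<in> topspace T \<Longrightarrow> 0 \<le> \<theta> t' \<and> \<theta> t' \<le> 1"
      using base_bump[OF openin_Int[OF V1(1) V2(1)] t] by metis
    let ?b = "\<lambda>t. complex_of_real (\<theta> t)"
    have b: "continuous_map T euclidean ?b" by (rule continuous_map_complex_of_real[OF \<theta>(1)])
    define k where "k = (\<lambda>x. ?b (p x) * g x)"
    have k: "k \<in> CcG" unfolding k_def by (rule base_mult_Cc[OF b g])
    have adjk: "adj k = (\<lambda>x. ?b (p x) * adj g x)" using adj_base[of ?b g] by (simp add: k_def)
    have cut: "\<theta> (p u) * a \<le> M" if "u \<in> units G" "0 \<le> a" "p u \<in> V1 \<inter> V2 \<Longrightarrow> a < M" for u a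
    proof -
      have pu: "p u \<in> topspace T" using that(1) p_onto by (auto simp: units_iff)
      show ?thesis
      proof (cases "p u \<in> V1 \<inter> V2")
        case True
        then have "\<theta> (p u) * a \<le> 1 * M" using \<theta>(4)[OF pu] that by (intro mult_mono) auto
        then show ?thesis by simp
      qed (use \<theta>(3)[OF pu] M in simp)
    qed
    have hk: "l2norm u k \<le> M" "l2norm u (adj k) \<le> M" if u: "u \<in> units G" for u
    proof -
      have "p u \<in> topspace T" using u p_onto by (auto simp: units_iff)
      then have ab: "\<bar>\<theta> (p u)\<bar> = \<theta> (p u)" using \<theta>(4)[of "p u"] by simp
      have hb: "l2norm u (\<lambda>x. ?b (p x) * h x) = \<theta> (p u) * l2norm u h" for h
        using l2norm_base[OF u, of ?b h] ab by simp
      show "l2norm u k \<le> M" using cut[OF u l2norm_nonneg[of u g]] V1(3)[OF u]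
        by (simp add: k_def hb)
      show "l2norm u (adj k) \<le> M" using cut[OF u l2norm_nonneg[of u "adj g"]] V2(3)[OF u]
        by (simp add: adjk hb)
    qed
    have lk: "l x \<le> real m * L" if "x \<in> A" "k x \<noteq> 0" for x
      using length_sq_iter[of f L x N] L(2) that by (auto simp: k_def g_def m_def)
    have "fnorm t f ^ m = fnorm t k"
      using fnorm_base[OF b g, of t] by (simp add: k_def \<theta>(2) gn)
    also have "\<dots> \<le> rnorm (units G) k" by (rule fnorm_le_rnorm[OF k])
    also have "\<dots> \<le> C * (1 + real m * L) powr q * M"
    proof -
      have "reduced_norm G \<omega> k \<le> ennreal (C * (1 + real m * L) powr q * M)"
        by (rule dec[OF k lk hk])
      then show ?thesis unfolding rnorm_def reduced_norm_def using C M
        by (intro enn2real_leI) auto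
    qed
    also have "\<dots> < c ^ m" using key by (simp add: M_def)
    finally show ?thesis using c' by (meson less_imp_le power_less_imp_less_base)
  qed
  then show ?thesis using V1 V2 by (intro exI[of _ "V1 \<inter> V2"]) auto
qed

end

section \<open>Functions vanishing at infinity\<close>

lemma C0_continuous: "g \<in> C0 T \<Longrightarrow> continuous_map T euclidean g"
  by (simp add: C0_def)

lemma C0_small:
  "g \<in> C0 T \<Longrightarrow> 0 < e \<Longrightarrow> \<exists>K. compactin T K \<and> (\<forall>t\<in>topspace T - K. norm (g t) < e)"
  by (simp add: C0_def)

lemma C0_bounded:
  fixes g :: "'b \<Rightarrow> complex"
  assumes "g \<in> C0 T" obtains B where "0 \<le> B" "\<And>t. t \<in> topspace T \<Longrightarrow> cmod (g t) \<le> B"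
proof -
  obtain K where K: "compactin T K" "\<And>t. t \<in> topspace T - K \<Longrightarrow> cmod (g t) < 1"
    using C0_small[OF assms zero_less_one] by blast
  have "continuous_map T euclideanreal (\<lambda>t. cmod (g t))"
    by (intro continuous_map_norm C0_continuous assms)
  then obtain B where B: "0 < B" "\<And>t. t \<in> K \<Longrightarrow> \<bar>cmod (g t)\<bar> \<le> B"
    using compactin_real_bounded[OF K(1)] by blast
  show ?thesis
  proof (rule that[of "max B 1"])
    fix t assume "t \<in> topspace T"
    then show "cmod (g t) \<le> max B 1" using B(2)[of t] K(2)[of t] by (cases "t \<in> K") auto
  qed simp
qed

text \<open>Multiplication by any bounded continuous function on the base extends to the completion. Working in
  this class reduces the laws of the action to pointwise identities on representatives.\<close>

definition bounded_continuous :: "'b topology \<Rightarrow> ('b \<Rightarrow> complex) \<Rightarrow> bool" where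
  "bounded_continuous T g \<longleftrightarrow>
     continuous_map T euclidean g \<and> (\<exists>B. \<forall>t\<in>topspace T. cmod (g t) \<le> B)"

lemma C0_bounded_continuous: "g \<in> C0 T \<Longrightarrow> bounded_continuous T g"
  unfolding bounded_continuous_def using C0_bounded[of g T] C0_continuous[of g T] by metis

lemma bounded_continuous_ops:
  assumes "bounded_continuous T g" "bounded_continuous T h"
  shows "bounded_continuous T (\<lambda>t. g t + h t)" "bounded_continuous T (\<lambda>t. g t * h t)"
    "bounded_continuous T (\<lambda>t. c * g t)" "bounded_continuous T (\<lambda>t. cnj (g t))"
proof -
  obtain B B' where B: "\<And>t. t \<in> topspace T \<Longrightarrow> cmod (g t) \<le> B" "\<And>t. t \<in> topspace T \<Longrightarrow> cmod (h t) \<le> B'"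
    using assms unfolding bounded_continuous_def by metis
  have "cmod (g t + h t) \<le> B + B'" if "t \<in> topspace T" for t
    using B[OF that] norm_triangle_ineq[of "g t" "h t"] by linarith
  moreover have "cmod (g t * h t) \<le> B * B'" if "t \<in> topspace T" for t
    using mult_mono[OF B[OF that] order_trans[OF norm_ge_zero B(1)[OF that]] norm_ge_zero]
    by (simp add: norm_mult)
  moreover have "cmod (c * g t) \<le> cmod c * B" if "t \<in> topspace T" for t
    using mult_left_mono[OF B(1)[OF that] norm_ge_zero[of c]] by (simp add: norm_mult)
  moreover have "cmod (cnj (g t)) \<le> B" if "t \<in> topspace T" for t
    using B(1)[OF that] by simp
  moreover have "continuous_map T euclidean g" "continuous_map T euclidean h"
    using assms by (simp_all add: bounded_continuous_def)
  moreover from this have "continuous_map T euclidean (\<lambda>t. g t + h t)" "continuous_map T euclidean (\<lambda>t. g t * h t)"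
    "continuous_map T euclidean (\<lambda>t. c * g t)" "continuous_map T euclidean (\<lambda>t. cnj (g t))"
    by (simp_all add: continuous_map_add continuous_map_complex_mult continuous_map_cnj)
  ultimately show "bounded_continuous T (\<lambda>t. g t + h t)" "bounded_continuous T (\<lambda>t. g t * h t)"
    "bounded_continuous T (\<lambda>t. c * g t)" "bounded_continuous T (\<lambda>t. cnj (g t))"
    unfolding bounded_continuous_def by blast+
qed

lemma bounded_continuous_scale_cnj:
  assumes "bounded_continuous T g"
  shows "bounded_continuous T (\<lambda>t. c * g t)" "bounded_continuous T (\<lambda>t. cnj (g t))"
  using bounded_continuous_ops(3,4)[OF assms assms] by blast+

section \<open>The continuous field\<close>

context rapid_decay_field
begin

abbreviation fib :: "'b \<Rightarrow> 'a groupoid" where "fib t \<equiv> fibre G p t"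
abbreviation fib_cocycle :: "'b \<Rightarrow> 'a \<times> 'a \<Rightarrow> complex" where
  "fib_cocycle t \<equiv> restrict \<omega> (composable (fib t))"
abbreviation CcAlg :: "('a \<Rightarrow> complex) normed_star_alg" where "CcAlg \<equiv> Cc_alg G \<omega>"
abbreviation FibAlg :: "'b \<Rightarrow> ('a \<Rightarrow> complex) normed_star_alg" where
  "FibAlg t \<equiv> Cc_alg (fib t) (fib_cocycle t)"
abbreviation restr :: "'b \<Rightarrow> ('a \<Rightarrow> complex) \<Rightarrow> 'a \<Rightarrow> complex" where
  "restr t f \<equiv> restrict0 f (arrows (fib t))"

lemma fib_simps [simp]: "src (fib t) = s" "rng (fib t) = r" "mul (fib t) = mul G" "ginv (fib t) = iv"
  by (simp_all add: fibre_def)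

lemma arr_top_fib: "arr_top (fib t) = subtopology (arr_top G) {x \<in> A. p x = t}"
  by (simp add: fibre_def)

lemma arrows_fib: "arrows (fib t) = {x \<in> A. p x = t}"
  by (auto simp: arr_top_fib)

lemma restr_eq: "restr t f x = (if x \<in> A \<and> p x = t then f x else 0)"
  by (simp add: restrict0_def arrows_fib)

lemma restr_zero: "restr t (\<lambda>_. 0) = (\<lambda>_. 0)"
  and restr_add: "restr t (\<lambda>x. f x + g x) = (\<lambda>x. restr t f x + restr t g x)"
  and restr_scale: "restr t (\<lambda>x. c * f x) = (\<lambda>x. c * restr t f x)"
  by (simp_all add: fun_eq_iff restr_eq)

lemma composable_fib: "(x, y) \<in> composable (fib t) \<longleftrightarrow> x \<in> A \<and> y \<in> A \<and> p x = t \<and> p y = t \<and> s x = r y"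
  by (auto simp: composable_def arrows_fib)

lemma units_fib: "units (fib t) = units_over t"
proof (intro equalityI subsetI)
  fix u assume "u \<in> units (fib t)"
  then obtain x where "x \<in> A" "p x = t" "u = s x" by (auto simp: units_def arrows_fib)
  then show "u \<in> units_over t" using src_unit p_src by simp
next
  fix u assume u: "u \<in> units_over t"
  then have "u = s u" "u \<in> arrows (fib t)" by (auto simp: units_iff arrows_fib)
  then show "u \<in> units (fib t)" by (auto simp: units_def)
qed

lemma src_fibre_fib: "p u = t \<Longrightarrow> src_fibre (fib t) u = src_fibre G u"
  using p_src by (force simp: src_fibre_def arrows_fib)

lemma fib_pair: "x \<in> A \<Longrightarrow> y \<in> A \<Longrightarrow> s x = s y \<Longrightarrow> p x = t \<Longrightarrow>
    (x \<cdot> iv y, y) \<in> composable (fib t) \<and> x \<cdot> iv y \<in> A \<and> p (x \<cdot> iv y) = t \<and> p y = t"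
  using p_prd[of x "iv y"] p_src[of x] p_src[of y] by (simp add: composable_fib)

text \<open>The source fibre of a unit over \<^term>\<open>t\<close> lies entirely over \<^term>\<open>t\<close>, so the sums in the fibre groupoid and in
  the whole groupoid have the same terms.\<close>

lemma conv_restr: "twisted_conv (fib t) (fib_cocycle t) (restr t f) (restr t g) = restr t (conv f g)"
proof
  fix x show "twisted_conv (fib t) (fib_cocycle t) (restr t f) (restr t g) x = restr t (conv f g) x"
  proof (cases "x \<in> A \<and> p x = t")
    case True
    have "src_fibre (fib t) (s x) = src_fibre G (s x)"
      using True by (intro src_fibre_fib) (simp add: p_src)
    then have "twisted_conv (fib t) c F H x
      = (\<Sum>\<^sub>\<infinity>y\<in>src_fibre G (s x). c (x \<cdot> iv y, y) * F (x \<cdot> iv y) * H y)" for c F H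
      using True by (simp add: twisted_conv_def restrict0_def arrows_fib)
    then have "twisted_conv (fib t) (fib_cocycle t) (restr t f) (restr t g) x
      = (\<Sum>\<^sub>\<infinity>y\<in>src_fibre G (s x). fib_cocycle t (x \<cdot> iv y, y) * restr t f (x \<cdot> iv y) * restr t g y)" .
    also have "\<dots> = (\<Sum>\<^sub>\<infinity>y\<in>src_fibre G (s x). \<omega> (x \<cdot> iv y, y) * f (x \<cdot> iv y) * g y)"
    proof (rule infsum_cong)
      fix y assume "y \<in> src_fibre G (s x)"
      then have y: "y \<in> A" "s y = s x" by auto
      show "fib_cocycle t (x \<cdot> iv y, y) * restr t f (x \<cdot> iv y) * restr t g y = \<omega> (x \<cdot> iv y, y) * f (x \<cdot> iv y) * g y"
        using fib_pair[of x y t] True y by (simp add: restr_eq)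
    qed
    also have "\<dots> = restr t (conv f g) x"
      using True by (simp add: twisted_conv_def restr_eq) (simp add: restrict0_def)
    finally show ?thesis .
  qed (auto simp: twisted_conv_def restrict0_def arrows_fib)
qed

lemma adj_restr: "twisted_star (fib t) (fib_cocycle t) (restr t f) = restr t (adj f)"
proof
  fix x show "twisted_star (fib t) (fib_cocycle t) (restr t f) x = restr t (adj f) x"
  proof (cases "x \<in> A \<and> p x = t")
    case True
    then have "(x, iv x) \<in> composable (fib t)" by (simp add: composable_fib p_iv)
    then show ?thesis using True by (simp add: twisted_star_def restrict0_def p_iv arrows_fib)
  qed (auto simp: twisted_star_def restrict0_def arrows_fib)
qed

lemma regular_rep_restr:
  assumes u: "u \<in> units_over t"
  shows "regular_rep (fib t) (fib_cocycle t) u (restr t f) = regular_rep G \<omega> u f"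
proof (intro ext)
  fix \<xi> x
  have sf: "src_fibre (fib t) u = src_fibre G u" using u by (simp add: src_fibre_fib)
  have "(\<Sum>\<^sub>\<infinity>y\<in>src_fibre G u. fib_cocycle t (x \<cdot> iv y, y) * restr t f (x \<cdot> iv y) * \<xi> y)
      = (\<Sum>\<^sub>\<infinity>y\<in>src_fibre G u. \<omega> (x \<cdot> iv y, y) * f (x \<cdot> iv y) * \<xi> y)" if x: "x \<in> src_fibre G u"
  proof (rule infsum_cong)
    fix y assume "y \<in> src_fibre G u"
    then show "fib_cocycle t (x \<cdot> iv y, y) * restr t f (x \<cdot> iv y) * \<xi> y = \<omega> (x \<cdot> iv y, y) * f (x \<cdot> iv y) * \<xi> y"
      using fib_pair[of x y t] x u p_src[of x] by (auto simp: restr_eq)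
  qed
  then show "regular_rep (fib t) (fib_cocycle t) u (restr t f) \<xi> x = regular_rep G \<omega> u f \<xi> x"
    unfolding regular_rep_def sf fib_simps restrict0_def[of _ "src_fibre G u"] by simp
qed

lemma reduced_norm_restr: "enn2real (reduced_norm (fib t) (fib_cocycle t) (restr t f)) = fnorm t f"
proof -
  have "reduced_norm (fib t) (fib_cocycle t) (restr t f) = (SUP u\<in>units_over t. opnorm u f)"
    unfolding reduced_norm_def units_fib
    by (rule SUP_cong[OF refl]) (simp add: regular_rep_restr src_fibre_fib)
  then show ?thesis by (simp add: rnorm_def)
qed

lemma closedin_fib: "t \<in> topspace T \<Longrightarrow> closedin (arr_top G) {x \<in> A. p x = t}"
  using closedin_continuous_map_preimage[OF continuous_p closedin_Hausdorff_singleton[OF base_Hausdorff]]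
  by simp

lemma Hausdorff_fib: "Hausdorff_space (subtopology (arr_top G) {x \<in> A. p x = t})"
  by (rule Hausdorff_space_subtopology[OF Hausdorff])

lemma restr_image: assumes t: "t \<in> topspace T" shows "restr t ` CcG = Cc (arr_top (fib t))"
proof (intro equalityI subsetI)
  fix F assume "F \<in> restr t ` CcG"
  then obtain f where f: "f \<in> CcG" "F = restr t f" by blast
  obtain K where K: "compactin (arr_top G) K" "\<And>x. x \<notin> K \<Longrightarrow> f x = 0"
    using Cc_support[OF Hausdorff f(1)] by blast
  have "restr t f \<in> Cc (subtopology (arr_top G) {x \<in> A. p x = t})"
  proof (rule CcI[OF Hausdorff_fib])
    show "continuous_map (subtopology (arr_top G) {x \<in> A. p x = t}) euclidean (restr t f)"
      by (rule continuous_map_eq[OF continuous_map_from_subtopology[OF Cc_continuous[OF f(1)]]])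
        (simp add: restr_eq)
    show "compactin (subtopology (arr_top G) {x \<in> A. p x = t}) ({x \<in> A. p x = t} \<inter> K)"
      using closed_Int_compactin[OF closedin_fib[OF t] K(1)] by (simp add: compactin_subtopology)
  qed (use K(2) in \<open>auto simp: restr_eq\<close>)
  then show "F \<in> Cc (arr_top (fib t))" by (simp add: arr_top_fib f(2))
next
  fix F assume "F \<in> Cc (arr_top (fib t))"
  then have F: "F \<in> Cc (subtopology (arr_top G) {x \<in> A. p x = t})" by (simp add: arr_top_fib)
  obtain f where f: "f \<in> CcG" "\<And>x. x \<in> {x \<in> A. p x = t} \<Longrightarrow> f x = F x"
    using Cc_extend_from_closed[OF locally_compact Hausdorff closedin_fib[OF t] F] by blast
  have "F = restr t f"
    using f(2) Cc_outside[OF F] by (auto simp: restr_eq fun_eq_iff)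
  then show "F \<in> restr t ` CcG" using f(1) by blast
qed

lemma pre_cstar_D: "pre_cstar_algebra CcAlg"
  using pre_cstar_Cc[of "units G"] by (simp add: Cc_alg_norm)

lemma norm_D: "norm_op CcAlg f = rnorm (units G) f"
  by (simp add: Cc_alg_def rnorm_def reduced_norm_def)

lemma elems_D: "elems CcAlg = CcG"
  by (simp add: Cc_alg_def)

lemma norm_E: "norm_op (FibAlg t) (restr t f) = fnorm t f"
  by (simp add: Cc_alg_def reduced_norm_restr)

lemma pre_cstar_E: assumes t: "t \<in> topspace T" shows "pre_cstar_algebra (FibAlg t)"
proof (rule pre_cstar_image[where \<phi>="restr t", OF pre_cstar_Cc[OF units_over_subset[of t]]])
  show "restr t ` elems (CcAlg\<lparr>norm_op := fnorm t\<rparr>) = elems (FibAlg t)"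
    using restr_image[OF t] by (simp add: Cc_alg_def)
qed (simp_all add: Cc_alg_def restr_zero restr_add restr_scale conv_restr adj_restr reduced_norm_restr)

lemma bounded_linear_restr:
  assumes t: "t \<in> topspace T" shows "bounded_linear_map CcAlg (FibAlg t) (restr t) 1"
proof (intro bounded_linear_map.intro bounded_linear_map_axioms.intro pre_cstar_D pre_cstar_E[OF t])
  fix f assume f: "f \<in> elems CcAlg"
  show "restr t f \<in> elems (FibAlg t)" using f restr_image[OF t] by (auto simp: Cc_alg_def)
  show "norm_op (FibAlg t) (restr t f) \<le> 1 * norm_op CcAlg f"
    using f fnorm_le_rnorm[of f t] by (simp add: norm_E norm_D elems_D)
qed (simp_all add: Cc_alg_def restr_add restr_scale)

abbreviation gmul :: "('b \<Rightarrow> complex) \<Rightarrow> ('a \<Rightarrow> complex) \<Rightarrow> 'a \<Rightarrow> complex" where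
  "gmul g f \<equiv> \<lambda>x. g (p x) * f x"

lemma bounded_linear_gmul:
  assumes g: "continuous_map T euclidean g" and B: "0 \<le> B" "\<And>t. t \<in> topspace T \<Longrightarrow> cmod (g t) \<le> B"
  shows "bounded_linear_map CcAlg CcAlg (gmul g) B"
proof (intro bounded_linear_map.intro bounded_linear_map_axioms.intro pre_cstar_D)
  fix f assume "f \<in> elems CcAlg"
  then have f: "f \<in> CcG" by (simp add: elems_D)
  show "gmul g f \<in> elems CcAlg" using base_mult_Cc[OF g f] by (simp add: elems_D)
  show "norm_op CcAlg (gmul g f) \<le> B * norm_op CcAlg f" unfolding norm_D
  proof (rule rnorm_le_fnorms[OF base_mult_Cc[OF g f]])
    show "0 \<le> B * rnorm (units G) f" using B by (simp add: rnorm_nonneg)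
    fix t assume t: "t \<in> topspace T"
    show "fnorm t (gmul g f) \<le> B * rnorm (units G) f"
      unfolding fnorm_base[OF g f]
      using B(2)[OF t] B(1) by (intro mult_mono fnorm_le_rnorm f rnorm_nonneg) auto
  qed
qed (use B in \<open>auto simp: Cc_alg_def algebra_simps\<close>)

definition ev :: "'b \<Rightarrow> (nat \<Rightarrow> 'a \<Rightarrow> complex) set \<Rightarrow> (nat \<Rightarrow> 'a \<Rightarrow> complex) set" where
  "ev t = extend_completion (FibAlg t) (restr t)"

definition act :: "('b \<Rightarrow> complex) \<Rightarrow> (nat \<Rightarrow> 'a \<Rightarrow> complex) set \<Rightarrow> (nat \<Rightarrow> 'a \<Rightarrow> complex) set" where
  "act g = extend_completion CcAlg (gmul g)"

abbreviation RedAlg :: "(nat \<Rightarrow> 'a \<Rightarrow> complex) set normed_star_alg" where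
  "RedAlg \<equiv> completion CcAlg"

lemma bounded_linear_gmul_obtain:
  assumes "bounded_continuous T g" obtains B where "bounded_linear_map CcAlg CcAlg (gmul g) B"
proof -
  obtain B where B: "\<And>t. t \<in> topspace T \<Longrightarrow> cmod (g t) \<le> B"
    using assms unfolding bounded_continuous_def by blast
  have "bounded_linear_map CcAlg CcAlg (gmul g) \<bar>B\<bar>"
    using assms order_trans[OF B abs_ge_self]
    by (intro bounded_linear_gmul) (simp_all add: bounded_continuous_def)
  then show ?thesis by (rule that)
qed

lemmas C0_gmul = bounded_linear_gmul_obtain[OF C0_bounded_continuous]

text \<open>Cutting off in the base shrinks the norm of a lift to the fibre norm, by upper
  semicontinuity.\<close>

lemma restr_lift:
  assumes t: "t \<in> topspace T" and e: "e \<in> elems (FibAlg t)" and \<epsilon>: "0 < \<epsilon>"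
  shows "\<exists>d\<in>elems CcAlg. restr t d = e \<and> norm_op CcAlg d \<le> norm_op (FibAlg t) e + \<epsilon>"
proof -
  have "e \<in> restr t ` CcG" using e restr_image[OF t] by (simp add: Cc_alg_def)
  then obtain f where f: "f \<in> CcG" and ef: "e = restr t f" by blast
  have "fnorm t f < fnorm t f + \<epsilon>" using \<epsilon> by simp
  from fnorm_upper_semicontinuous[OF f this t] obtain V
    where V: "openin T V" "t \<in> V" "\<And>t'. t' \<in> V \<Longrightarrow> fnorm t' f < fnorm t f + \<epsilon>" by blast
  obtain \<theta> :: "'b \<Rightarrow> real" where \<theta>: "continuous_map T euclideanreal \<theta>" "\<theta> t = 1"
      "\<And>t'. t' \<in> topspace T \<Longrightarrow> t' \<notin> V \<Longrightarrow> \<theta> t' = 0"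
      "\<And>t'. t' \<in> topspace T \<Longrightarrow> 0 \<le> \<theta> t' \<and> \<theta> t' \<le> 1"
    using base_bump[OF V(1,2)] by metis
  have c: "continuous_map T euclidean (\<lambda>t. complex_of_real (\<theta> t))"
    by (rule continuous_map_complex_of_real[OF \<theta>(1)])
  let ?d = "gmul (\<lambda>t. complex_of_real (\<theta> t)) f"
  have d: "?d \<in> CcG" by (rule base_mult_Cc[OF c f])
  have "restr t ?d = e" unfolding ef using \<theta>(2) by (auto simp: restr_eq fun_eq_iff)
  moreover have "rnorm (units G) ?d \<le> fnorm t f + \<epsilon>"
  proof (rule rnorm_le_fnorms[OF d])
    show nn: "0 \<le> fnorm t f + \<epsilon>" using \<epsilon> rnorm_nonneg[of "units_over t" f] by simp
    fix t' assume t': "t' \<in> topspace T"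
    show "fnorm t' ?d \<le> fnorm t f + \<epsilon>"
    proof (cases "t' \<in> V")
      case True
      have "\<theta> t' * fnorm t' f \<le> 1 * (fnorm t f + \<epsilon>)"
        using \<theta>(4)[OF t'] V(3)[OF True] nn by (intro mult_mono) (auto simp: rnorm_nonneg)
      then show ?thesis unfolding fnorm_base[OF c f] using \<theta>(4)[OF t'] by simp
    next
      case False
      then show ?thesis unfolding fnorm_base[OF c f] using \<theta>(3)[OF t' False] nn by simp
    qed
  qed
  ultimately show ?thesis using d f by (intro bexI[of _ ?d]) (simp_all add: norm_D elems_D ef norm_E)
qed

lemma C0_action_act: "C0_action T RedAlg act"
proof -
  interpret D: pre_cstar_algebra CcAlg by (rule pre_cstar_D)
  have cls: "act g (D.cls \<sigma>) = D.cls (\<lambda>n. gmul g (\<sigma> n))"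
    and cau: "(\<lambda>n. gmul g (\<sigma> n)) \<in> cauchy_seqs CcAlg"
    if g: "bounded_continuous T g" and \<sigma>: "\<sigma> \<in> cauchy_seqs CcAlg" for g \<sigma>
  proof -
    obtain B where "bounded_linear_map CcAlg CcAlg (gmul g) B" using bounded_linear_gmul_obtain[OF g] .
    then interpret bounded_linear_map CcAlg CcAlg "gmul g" B .
    show "act g (D.cls \<sigma>) = D.cls (\<lambda>n. gmul g (\<sigma> n))" unfolding act_def by (rule extend_cls[OF \<sigma>])
    show "(\<lambda>n. gmul g (\<sigma> n)) \<in> cauchy_seqs CcAlg" by (rule map_cauchy[OF \<sigma>])
  qed
  have Cc: "\<sigma> n \<in> CcG" if "\<sigma> \<in> cauchy_seqs CcAlg" for \<sigma> n using D.cauchy_elems[OF that] by (simp add: elems_D)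
  note cl = cls cau D.completion_plus D.completion_scale D.completion_times D.completion_star
    D.cauchy_plus D.cauchy_scale D.cauchy_times D.cauchy_star bounded_continuous_ops(1,2)
    bounded_continuous_scale_cnj C0_bounded_continuous
  have ops: "plus_op CcAlg = (\<lambda>f1 f2 x. f1 x + f2 x)" "scale_op CcAlg = (\<lambda>c f x. c * f x)"
    "times_op CcAlg = conv" "star_op CcAlg = adj" by (simp_all add: Cc_alg_def)
  show ?thesis
    unfolding C0_action_def
  proof (intro conjI ballI allI)
    fix g :: "'b \<Rightarrow> complex" and a assume g: "g \<in> C0 T" and "a \<in> elems RedAlg"
    then obtain \<sigma> where \<sigma>: "\<sigma> \<in> cauchy_seqs CcAlg" and a: "a = D.cls \<sigma>" by (meson D.cls_cases)
    show "act g a \<in> elems RedAlg" using g \<sigma> by (simp add: a cls cau C0_bounded_continuous D.cls_closed)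
    show "star_op RedAlg (act g a) = act (\<lambda>t. cnj (g t)) (star_op RedAlg a)"
      using g \<sigma> by (simp add: a cl) (simp add: ops adj_base)
    show "act (\<lambda>t. c * g t) a = scale_op RedAlg c (act g a)" for c
      using g \<sigma> by (simp add: a cl) (simp add: ops mult.assoc)
    show "act g (scale_op RedAlg c a) = scale_op RedAlg c (act g a)" for c
      using g \<sigma> by (simp add: a cl) (simp add: ops mult.left_commute)
    show "act (\<lambda>t. g t + h t) a = plus_op RedAlg (act g a) (act h a)" if h: "h \<in> C0 T" for h
      using g h \<sigma> by (simp add: a cl) (simp add: ops distrib_right)
    show "act (\<lambda>t. g t * h t) a = act g (act h a)" if h: "h \<in> C0 T" for h
      using g h \<sigma> by (simp add: a cl) (simp add: ops mult.assoc)
    fix b assume "b \<in> elems RedAlg"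
    then obtain \<tau> where \<tau>: "\<tau> \<in> cauchy_seqs CcAlg" and b: "b = D.cls \<tau>" by (meson D.cls_cases)
    show "act g (plus_op RedAlg a b) = plus_op RedAlg (act g a) (act g b)"
      using g \<sigma> \<tau> by (simp add: a b cl) (simp add: ops distrib_left)
    show "act g (times_op RedAlg a b) = times_op RedAlg (act g a) b"
      using g \<sigma> \<tau> by (simp add: a b cl) (simp add: ops conv_base_left Cc)
    show "act g (times_op RedAlg a b) = times_op RedAlg a (act g b)"
      using g \<sigma> \<tau> by (simp add: a b cl) (simp add: ops conv_base_right Cc)
  qed
qed

text \<open>The evaluation maps are contractive, so the fibre norms of an element of the completion are
  approximated uniformly in the base point.\<close>

lemma ev_approx:
  assumes t: "t \<in> topspace T" and a: "a \<in> elems RedAlg" and d: "d \<in> CcG"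
  shows "\<bar>norm_op (completion (FibAlg t)) (ev t a) - fnorm t d\<bar> \<le> dist_op RedAlg a (completion_embed CcAlg d)"
proof -
  interpret bounded_linear_map CcAlg "FibAlg t" "restr t" 1 by (rule bounded_linear_restr[OF t])
  interpret CE: pre_cstar_algebra "completion (FibAlg t)" by (rule E.pre_cstar_completion)
  have dD: "d \<in> elems CcAlg" using d by (simp add: elems_D)
  have emb: "completion_embed CcAlg d \<in> elems RedAlg"
    unfolding completion_embed_def by (intro D.cls_closed D.const_cauchy dD)
  have "ev t (completion_embed CcAlg d) = E.cls (\<lambda>_. restr t d)"
    unfolding ev_def completion_embed_def by (rule extend_cls[OF D.const_cauchy[OF dD]])
  moreover have "norm_op (completion (FibAlg t)) (E.cls (\<lambda>_. restr t d)) = fnorm t d"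
    using E.completion_norm[OF E.const_cauchy[OF map_closed[OF dD]]]
    by (simp add: norm_E LIMSEQ_const_iff)
  ultimately have "norm_op (completion (FibAlg t)) (ev t (completion_embed CcAlg d)) = fnorm t d" by simp
  moreover have "\<bar>norm_op (completion (FibAlg t)) (ev t a) - norm_op (completion (FibAlg t)) (ev t (completion_embed CcAlg d))\<bar>
      \<le> dist_op (completion (FibAlg t)) (ev t a) (ev t (completion_embed CcAlg d))"
    unfolding ev_def by (intro CE.norm_diff_le_dist extend_closed a emb)
  moreover have "dist_op (completion (FibAlg t)) (ev t a) (ev t (completion_embed CcAlg d))
      \<le> 1 * dist_op RedAlg a (completion_embed CcAlg d)"
    unfolding ev_def by (rule extend_dist[OF a emb])
  ultimately show ?thesis by simp
qed

lemma dense_Cc: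
  assumes "a \<in> elems RedAlg" "0 < e"
  obtains d where "d \<in> CcG" "dist_op RedAlg a (completion_embed CcAlg d) \<le> e"
  using pre_cstar_algebra.completion_dense[OF pre_cstar_D assms] that
  by (auto simp: elems_D completion_embed_def)

text \<open>On compactly supported functions this is the definition of the reduced norm. In general the evaluation
  maps are contractive, and an approximation transfers the inequality.\<close>

lemma norm_eq_SUP_ev:
  assumes a: "a \<in> elems RedAlg"
  shows "ennreal (norm_op RedAlg a) = (SUP t\<in>topspace T. ennreal (norm_op (completion (FibAlg t)) (ev t a)))"
proof (rule antisym)
  interpret D: pre_cstar_algebra CcAlg by (rule pre_cstar_D)
  interpret CD: pre_cstar_algebra RedAlg by (rule D.pre_cstar_completion)
  let ?S = "SUP t\<in>topspace T. ennreal (norm_op (completion (FibAlg t)) (ev t a))"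
  show le: "?S \<le> ennreal (norm_op RedAlg a)"
  proof (rule SUP_least, rule ennreal_leI)
    fix t assume t: "t \<in> topspace T"
    interpret bounded_linear_map CcAlg "FibAlg t" "restr t" 1 by (rule bounded_linear_restr[OF t])
    show "norm_op (completion (FibAlg t)) (ev t a) \<le> norm_op RedAlg a"
      using extend_norm[OF a] by (simp add: ev_def)
  qed
  then have "?S < top" using le_less_trans ennreal_less_top by blast
  then obtain b where b: "0 \<le> b" "?S = ennreal b" by (cases ?S) auto
  have evb: "norm_op (completion (FibAlg t)) (ev t a) \<le> b" if "t \<in> topspace T" for t
    using SUP_upper[OF that, of "\<lambda>t. ennreal (norm_op (completion (FibAlg t)) (ev t a))"] b
    by (simp add: ennreal_le_iff)
  have "norm_op RedAlg a \<le> b + e" if e: "e > 0" for e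
  proof -
    obtain d where d: "d \<in> CcG" "dist_op RedAlg a (completion_embed CcAlg d) \<le> e / 2"
      using dense_Cc[OF a, of "e / 2"] e by auto
    have dD: "d \<in> elems CcAlg" using d(1) by (simp add: elems_D)
    have emb: "completion_embed CcAlg d \<in> elems RedAlg"
      unfolding completion_embed_def by (intro D.cls_closed D.const_cauchy dD)
    have "norm_op RedAlg (completion_embed CcAlg d) = rnorm (units G) d"
      using D.completion_norm[OF D.const_cauchy[OF dD]]
      by (simp add: norm_D LIMSEQ_const_iff completion_embed_def)
    moreover have "rnorm (units G) d \<le> b + e / 2"
    proof (rule rnorm_le_fnorms[OF d(1)])
      show "fnorm t d \<le> b + e / 2" if t: "t \<in> topspace T" for t
        using ev_approx[OF t a d(1)] evb[OF t] d(2) by linarith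
    qed (use b e in simp)
    moreover have "\<bar>norm_op RedAlg a - norm_op RedAlg (completion_embed CcAlg d)\<bar>
        \<le> dist_op RedAlg a (completion_embed CcAlg d)" by (rule CD.norm_diff_le_dist[OF a emb])
    ultimately show ?thesis using d(2) by linarith
  qed
  then have "norm_op RedAlg a \<le> b" by (rule field_le_epsilon)
  then show "ennreal (norm_op RedAlg a) \<le> ?S" using b by (simp add: ennreal_leI)
qed

text \<open>By \<open>ev_approx\<close> the function is a uniform limit of fibre norms of compactly supported functions. Those are
  continuous, and they vanish off the image of the support in the base.\<close>

lemma ev_norm_C0:
  assumes a: "a \<in> elems RedAlg"
  shows "(\<lambda>t. if t \<in> topspace T then norm_op (completion (FibAlg t)) (ev t a) else 0) \<in> C0 T"
    (is "?F \<in> C0 T")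
  unfolding C0_def
proof (safe)
  show "continuous_map T euclideanreal ?F"
  proof (rule continuous_map_realI)
    fix t0 and e :: real assume t0: "t0 \<in> topspace T" and e: "0 < e"
    obtain d where d: "d \<in> CcG" "dist_op RedAlg a (completion_embed CcAlg d) \<le> e / 3"
      using dense_Cc[OF a, of "e / 3"] e by auto
    have "fnorm t0 d < fnorm t0 d + e / 3" using e by simp
    from fnorm_upper_semicontinuous[OF d(1) this t0] obtain V
      where V: "openin T V" "t0 \<in> V" "\<And>t. t \<in> V \<Longrightarrow> fnorm t d < fnorm t0 d + e / 3" by blast
    have "fnorm t0 d - e / 3 < fnorm t0 d" using e by simp
    from fnorm_lower_semicontinuous[OF d(1) this t0] obtain W
      where W: "openin T W" "t0 \<in> W" "\<And>t. t \<in> W \<Longrightarrow> fnorm t0 d - e / 3 < fnorm t d" by blast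
    show "\<exists>V. openin T V \<and> t0 \<in> V \<and> (\<forall>t\<in>V. \<bar>?F t - ?F t0\<bar> < e)"
    proof (intro exI[of _ "V \<inter> W"] conjI ballI openin_Int V(1) W(1))
      show "t0 \<in> V \<inter> W" using V(2) W(2) by blast
      fix t assume "t \<in> V \<inter> W"
      then have t: "t \<in> topspace T" "t \<in> V" "t \<in> W" using openin_subset[OF V(1)] by auto
      show "\<bar>?F t - ?F t0\<bar> < e"
        using ev_approx[OF t(1) a d(1)] ev_approx[OF t0 a d(1)] V(3)[OF t(2)] W(3)[OF t(3)] d(2) t(1) t0
        by (simp add: abs_le_iff abs_less_iff)
    qed
  qed
  fix e :: real assume e: "0 < e"
  obtain d where d: "d \<in> CcG" "dist_op RedAlg a (completion_embed CcAlg d) \<le> e / 2"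
    using dense_Cc[OF a, of "e / 2"] e by auto
  obtain K where K: "compactin (arr_top G) K" "\<And>x. x \<notin> K \<Longrightarrow> d x = 0"
    using Cc_support[OF Hausdorff d(1)] by blast
  have "norm (?F t) < e" if t: "t \<in> topspace T - p ` K" for t
  proof -
    interpret E: pre_cstar_algebra "FibAlg t" using pre_cstar_E t by blast
    interpret CE: pre_cstar_algebra "completion (FibAlg t)" by (rule E.pre_cstar_completion)
    have "restr t d = zero_op (FibAlg t)" using t K(2) by (fastforce simp: Cc_alg_def restr_eq fun_eq_iff)
    then have "fnorm t d = 0" using norm_E[of t d] E.norm_zero by simp
    moreover have "0 \<le> norm_op (completion (FibAlg t)) (ev t a)"
    proof -
      interpret bounded_linear_map CcAlg "FibAlg t" "restr t" 1 using bounded_linear_restr t by blast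
      show ?thesis unfolding ev_def by (intro CE.norm_nonneg extend_closed a)
    qed
    ultimately show ?thesis using ev_approx[of t a d] t a d e by auto
  qed
  then show "\<exists>K. compactin T K \<and> (\<forall>t\<in>topspace T - K. norm (?F t) < e)"
    using image_compactin[OF K(1) continuous_p] by blast
qed auto

lemma ev_act:
  assumes g: "g \<in> C0 T" and a: "a \<in> elems RedAlg" and t: "t \<in> topspace T"
  shows "ev t (act g a) = scale_op (completion (FibAlg t)) (g t) (ev t a)"
proof -
  interpret bounded_linear_map CcAlg "FibAlg t" "restr t" 1 by (rule bounded_linear_restr[OF t])
  obtain B where "bounded_linear_map CcAlg CcAlg (gmul g) B" using C0_gmul[OF g] .
  then interpret M: bounded_linear_map CcAlg CcAlg "gmul g" B .
  obtain \<sigma> where \<sigma>: "\<sigma> \<in> cauchy_seqs CcAlg" and a: "a = D.cls \<sigma>" using a by (meson D.cls_cases)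
  have "restr t (gmul g f) = scale_op (FibAlg t) (g t) (restr t f)" for f
    by (auto simp: Cc_alg_def restr_eq fun_eq_iff)
  then show ?thesis
    by (simp add: a ev_def act_def M.extend_cls extend_cls \<sigma> M.map_cauchy map_cauchy E.completion_scale)
qed

theorem continuous_field_reduced:
  "continuous_field T (reduced_cstar G \<omega>) (\<lambda>t. reduced_cstar (fib t) (fib_cocycle t)) ev act"
  unfolding continuous_field_def cstar_bundle_def reduced_cstar_def
proof (intro conjI ballI)
  show "cstar_algebra RedAlg" by (rule pre_cstar_algebra.cstar_completion[OF pre_cstar_D])
  fix t assume t: "t \<in> topspace T"
  show "cstar_algebra (completion (FibAlg t))" by (rule pre_cstar_algebra.cstar_completion[OF pre_cstar_E[OF t]])
  interpret bounded_linear_map CcAlg "FibAlg t" "restr t" 1 by (rule bounded_linear_restr[OF t])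
  show "star_hom RedAlg (completion (FibAlg t)) (ev t)"
    unfolding ev_def by (rule star_hom_extend) (simp_all add: Cc_alg_def conv_restr adj_restr)
  show "ev t ` elems RedAlg = elems (completion (FibAlg t))"
    unfolding ev_def by (rule extend_surj) (rule restr_lift[OF t])
qed (fact base_locally_compact base_Hausdorff C0_action_act | rule ev_act norm_eq_SUP_ev ev_norm_C0; assumption)+

end

theorem theorem1p2:
  fixes G :: "'a groupoid" and \<omega> :: "'a \<times> 'a \<Rightarrow> complex"
    and T :: "'b topology" and p :: "'a \<Rightarrow> 'b"
  assumes "etale_groupoid G"
    and "locally_compact_space (arr_top G)"
    and "second_countable (arr_top G)"
    and "Hausdorff_space (arr_top G)"
    and "continuous_cocycle G \<omega>"
    and "locally_compact_space T"
    and "Hausdorff_space T"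
    and "field_of_groupoids G T p"
    and "\<exists>l. length_function G l \<and> rapid_decay G \<omega> l"
  shows "\<exists>ev act.
    (\<forall>t\<in>topspace T. continuous_extension
       (Cc_alg G \<omega>) (Cc_alg (fibre G p t) (restrict \<omega> (composable (fibre G p t))))
       (\<lambda>f. restrict0 f (arrows (fibre G p t))) (ev t)) \<and>
    (\<forall>g\<in>C0 T. continuous_extension (Cc_alg G \<omega>) (Cc_alg G \<omega>) (\<lambda>f x. g (p x) * f x) (act g)) \<and>
    continuous_field T
      (reduced_cstar G \<omega>)
      (\<lambda>t. reduced_cstar (fibre G p t) (restrict \<omega> (composable (fibre G p t))))
      ev act"
proof -
  obtain l where l: "length_function G l" "rapid_decay G \<omega> l" using assms(9) by blast
  interpret rapid_decay_field G \<omega> l T p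
    by (intro rapid_decay_field.intro rapid_decay_groupoid.intro twisted_etale_groupoid.intro
        twisted_etale_groupoid_axioms.intro rapid_decay_groupoid_axioms.intro
        rapid_decay_field_axioms.intro assms l)
  show ?thesis
  proof (intro exI[of _ ev] exI[of _ act] conjI ballI)
    fix t assume "t \<in> topspace T"
    then interpret bounded_linear_map "Cc_alg G \<omega>" "FibAlg t" "restr t" 1 by (rule bounded_linear_restr)
    show "continuous_extension (Cc_alg G \<omega>) (FibAlg t) (restr t) (ev t)"
      unfolding ev_def by (rule continuous_extension_extend)
  next
    fix g :: "'b \<Rightarrow> complex" assume "g \<in> C0 T"
    then obtain B where "bounded_linear_map (Cc_alg G \<omega>) (Cc_alg G \<omega>) (\<lambda>f x. g (p x) * f x) B"
      by (rule C0_gmul)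
    then interpret bounded_linear_map "Cc_alg G \<omega>" "Cc_alg G \<omega>" "\<lambda>f x. g (p x) * f x" B .
    show "continuous_extension (Cc_alg G \<omega>) (Cc_alg G \<omega>) (\<lambda>f x. g (p x) * f x) (act g)"
      unfolding act_def by (rule continuous_extension_extend)
  qed (rule continuous_field_reduced)
qed

end
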